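(* Let $(\mathcal H,\langle\cdot,\cdot\rangle,\|\cdot\|)$ be a separable Hilbert space, $\Psi:\mathcal H\to\mathcal H$, $u_0\in\mathcal H$, and signal $u_j=\Psi(u_{j-1})$, $j\ge1$. Let $H:\mathcal H\to\mathbb R^k$ be linear with $HH^*=I_k$, $P:=H^*H$, and observations $y_j=Hu_j+\varepsilon\eta_j$ with $\varepsilon>0$ and $\eta_j$ independent, $\mathbb E\eta_j=0$, $\mathrm{Cov}[\eta_j]=R$. Suppose $\Psi,H$ satisfy Assumption A and a surrogate map $\Psi^s:\mathcal H\to\mathcal H$ satisfies Assumption B with parameter $\delta$ (see context), and that $N\ge 6k$. Let $\widehat m^s_j$ be the means output by the square-root ensemble Kalman filter with surrogate model (Algorithm EnKF-s in the context) with $N$ particles and inflation $Q=aP$. Then, if the inflation parameter $a>0$ is sufficiently large, there is a constant $\mathsf C^s$ independent of $\varepsilon$ and $\delta$ such that $$\limsup_{j\to\infty}\mathbb E\|\widehat m^s_j-u_j\|\le\mathsf C^s(\varepsilon+\delta).$$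
   Context: For $\beta\ge0$, $V(u):=(\|u\|^2+\beta\|Pu\|^2)^{1/2}$. Assumption A: there exist $r>0,\beta\ge0,L>0,\alpha\in(0,1)$ such that (i) $\mathcal B=\{u:\|u\|\le r\}$ is absorbing and forward invariant for $u\mapsto\Psi(u)$; (ii) $V^2(\Psi(u)-\Psi(v))\le LV^2(u-v)$ for $u,v\in\mathcal B$; (iii) $V^2((I-P)(\Psi(u)-\Psi(v)))\le\alpha V^2(u-v)$ for $u,v\in\mathcal B$. Assumption B: there exist $\kappa>0$, $L_s>0$, $\delta>0$ with $\|\Psi^s(u)-\Psi(u)\|\le\kappa$ for $u\in\mathcal B$; $V^2(\Psi^s(u)-\Psi^s(v))\le L_sV^2(u-v)$ for $u,v\in\mathcal B$; and $\|(I-P)(\Psi^s(u)-\Psi(u))\|\le\delta$ for $u\in\mathcal B$. $P_{\mathcal B_V}$ is the orthogonal projection onto $\mathcal B$ in the $V$-norm; $\mathscr K(\Sigma):=\Sigma H^*(H\Sigma H^*+\varepsilon^2R)^{-1}$. Algorithm EnKF-s: draw $u_0^{(n),s}\overset{iid}\sim\mathcal N(m_0,C_0)$, $1\le n\le N$. For $j\ge1$: $v_j^{(n),s}=\Psi^s(P_{\mathcal B_V}u^{(n),s}_{j-1})+\xi_j^{(n)}$, $\xi_j^{(n)}\overset{iid}\sim\mathcal N(0,aP)$ independent of everything else; $\widehat\mu^s_j=\frac1N\sum_nv_j^{(n),s}$, $\widehat\Sigma^s_j=\frac1N\sum_n(v_j^{(n),s}-\widehat\mu^s_j)\otimes(v_j^{(n),s}-\widehat\mu^s_j)$;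 then transform into any ensemble $\{u_j^{(n),s}\}$ with mean $\widehat m^s_j=\widehat\mu^s_j+\mathscr K(\widehat\Sigma^s_j)(y_j-H\widehat\mu^s_j)$ and covariance $\widehat C^s_j:=\frac1{N-1}\sum_n(u_j^{(n),s}-\widehat m^s_j)\otimes(u_j^{(n),s}-\widehat m^s_j)=(I-\mathscr K(\widehat\Sigma^s_j)H)\widehat\Sigma^s_j$. Expectations are over all randomness. *)

theory Defs
  imports "HOL-Analysis.Analysis" "HOL-Probability.Probability"
begin

definition projP :: "('h::real_inner \<Rightarrow> real^'k) \<Rightarrow> 'h \<Rightarrow> 'h" where
  "projP H u = adjoint H (H u)"

definition Vn :: "('h::real_inner \<Rightarrow> real^'k) \<Rightarrow> real \<Rightarrow> 'h \<Rightarrow> real" where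
  "Vn H \<beta> u = sqrt (norm u ^ 2 + \<beta> * norm (projP H u) ^ 2)"

definition ballB :: "real \<Rightarrow> 'h::real_normed_vector set" where
  "ballB r = {u. norm u \<le> r}"

definition proj_BV :: "('h::real_inner \<Rightarrow> real^'k) \<Rightarrow> real \<Rightarrow> real \<Rightarrow> 'h \<Rightarrow> 'h" where
  "proj_BV H \<beta> r u =
     (SOME x. x \<in> ballB r \<and> (\<forall>y\<in>ballB r. Vn H \<beta> (u - x) \<le> Vn H \<beta> (u - y)))"

definition absorbing_fwd_inv :: "('h::real_normed_vector \<Rightarrow> 'h) \<Rightarrow> 'h set \<Rightarrow> bool" where
  "absorbing_fwd_inv \<Psi> S \<longleftrightarrow>
     \<Psi> ` S \<subseteq> S \<and> (\<forall>D. bounded D \<longrightarrow> (\<exists>J. \<forall>j\<ge>J. (\<Psi> ^^ j) ` D \<subseteq> S))"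

definition assumption_A ::
  "('h::real_inner \<Rightarrow> 'h) \<Rightarrow> ('h \<Rightarrow> real^'k) \<Rightarrow> real \<Rightarrow> real \<Rightarrow> real \<Rightarrow> real \<Rightarrow> bool" where
  "assumption_A \<Psi> H r \<beta> L \<alpha> \<longleftrightarrow>
     r > 0 \<and> \<beta> \<ge> 0 \<and> L > 0 \<and> 0 < \<alpha> \<and> \<alpha> < 1 \<and>
     absorbing_fwd_inv \<Psi> (ballB r) \<and>
     (\<forall>u\<in>ballB r. \<forall>v\<in>ballB r.
        (Vn H \<beta> (\<Psi> u - \<Psi> v))\<^sup>2 \<le> L * (Vn H \<beta> (u - v))\<^sup>2) \<and>
     (\<forall>u\<in>ballB r. \<forall>v\<in>ballB r.
        (Vn H \<beta> ((\<Psi> u - \<Psi> v) - projP H (\<Psi> u - \<Psi> v)))\<^sup>2 \<le> \<alpha> * (Vn H \<beta> (u - v))\<^sup>2)"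

definition assumption_B ::
  "('h::real_inner \<Rightarrow> 'h) \<Rightarrow> ('h \<Rightarrow> 'h) \<Rightarrow> ('h \<Rightarrow> real^'k) \<Rightarrow> real \<Rightarrow> real
    \<Rightarrow> real \<Rightarrow> real \<Rightarrow> real \<Rightarrow> bool" where
  "assumption_B \<Psi> \<Psi>s H r \<beta> \<kappa> Ls \<delta> \<longleftrightarrow>
     \<kappa> > 0 \<and> Ls > 0 \<and> \<delta> > 0 \<and>
     (\<forall>u\<in>ballB r. norm (\<Psi>s u - \<Psi> u) \<le> \<kappa>) \<and>
     (\<forall>u\<in>ballB r. \<forall>v\<in>ballB r.
        (Vn H \<beta> (\<Psi>s u - \<Psi>s v))\<^sup>2 \<le> Ls * (Vn H \<beta> (u - v))\<^sup>2) \<and>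
     (\<forall>u\<in>ballB r. norm ((\<Psi>s u - \<Psi> u) - projP H (\<Psi>s u - \<Psi> u)) \<le> \<delta>)"

definition ens_mean :: "nat \<Rightarrow> (nat \<Rightarrow> 'h::real_vector) \<Rightarrow> 'h" where
  "ens_mean N v = (1 / real N) *\<^sub>R (\<Sum>n<N. v n)"

text \<open>c * sum_n (v_n - mean) \<otimes> (v_n - mean), as an operator on the space,
  where (a \<otimes> b) x = (b \<bullet> x) a.\<close>
definition ens_cov :: "real \<Rightarrow> nat \<Rightarrow> (nat \<Rightarrow> 'h::real_inner) \<Rightarrow> 'h \<Rightarrow> 'h" where
  "ens_cov c N v x = c *\<^sub>R (\<Sum>n<N. ((v n - ens_mean N v) \<bullet> x) *\<^sub>R (v n - ens_mean N v))"

definition kalman_gain ::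
  "('h::real_inner \<Rightarrow> real^'k) \<Rightarrow> real^'k^'k \<Rightarrow> real \<Rightarrow> ('h \<Rightarrow> 'h) \<Rightarrow> real^'k \<Rightarrow> 'h" where
  "kalman_gain H R \<epsilon> \<Sigma> y =
     \<Sigma> (adjoint H (matrix_inv (matrix (\<lambda>z. H (\<Sigma> (adjoint H z))) + \<epsilon>\<^sup>2 *\<^sub>R R) *v y))"

definition enkf_analysis_ok ::
  "('h::real_inner \<Rightarrow> real^'k) \<Rightarrow> real^'k^'k \<Rightarrow> real \<Rightarrow> nat \<Rightarrow> real^'k
    \<Rightarrow> (nat \<Rightarrow> 'h) \<Rightarrow> (nat \<Rightarrow> 'h) \<Rightarrow> bool" where
  "enkf_analysis_ok H R \<epsilon> N y v u \<longleftrightarrow>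
     (let \<mu> = ens_mean N v; \<Sigma> = ens_cov (1 / real N) N v; K = kalman_gain H R \<epsilon> \<Sigma>
      in ens_mean N u = \<mu> + K (y - H \<mu>) \<and>
         ens_cov (1 / (real N - 1)) N u = (\<lambda>x. \<Sigma> x - K (H (\<Sigma> x))))"

definition normal_law :: "real \<Rightarrow> real \<Rightarrow> real measure" where
  "normal_law \<mu> var =
     (if var = 0 then return borel \<mu> else density lborel (normal_density \<mu> (sqrt var)))"

definition gaussian_rv :: "'w measure \<Rightarrow> ('w \<Rightarrow> 'h::real_inner) \<Rightarrow> 'h \<Rightarrow> ('h \<Rightarrow> 'h) \<Rightarrow> bool" where
  "gaussian_rv M X m C \<longleftrightarrow>
     X \<in> borel_measurable M \<and>
     (\<forall>\<phi>. distr M borel (\<lambda>\<omega>. \<phi> \<bullet> X \<omega>) = normal_law (\<phi> \<bullet> m) (\<phi> \<bullet> C \<phi>))"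

definition events_of :: "'w measure \<Rightarrow> ('w \<Rightarrow> 'b::topological_space) \<Rightarrow> 'w set set" where
  "events_of M X = {X -` A \<inter> space M | A. A \<in> sets borel}"

text \<open>enkf_s_run ... eta xi U: on the probability space M with filtration F,
  U j n (n < N) is the analysis ensemble at time j, xi j n the inflation noise,
  eta j the observation noise; the true signal is u_j = (Psi ^^ j) u0 and
  y_j = H u_j + eps eta_j.\<close>
definition enkf_s_run ::
  "'w measure \<Rightarrow> (nat \<Rightarrow> 'w measure) \<Rightarrow> ('h::{real_inner,complete_space,second_countable_topology} \<Rightarrow> 'h)
    \<Rightarrow> ('h \<Rightarrow> 'h) \<Rightarrow> ('h \<Rightarrow> real^'k) \<Rightarrow> real^'k^'k \<Rightarrow> real \<Rightarrow> real \<Rightarrow> real \<Rightarrow> real \<Rightarrow> nat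
    \<Rightarrow> 'h \<Rightarrow> ('h \<Rightarrow> 'h) \<Rightarrow> 'h
    \<Rightarrow> (nat \<Rightarrow> 'w \<Rightarrow> real^'k) \<Rightarrow> (nat \<Rightarrow> nat \<Rightarrow> 'w \<Rightarrow> 'h) \<Rightarrow> (nat \<Rightarrow> nat \<Rightarrow> 'w \<Rightarrow> 'h) \<Rightarrow> bool" where
  "enkf_s_run M F \<Psi> \<Psi>s H R \<epsilon> a r \<beta> N m0 C0 u0 \<eta> \<xi> U \<longleftrightarrow>
     prob_space M \<and>
     (\<forall>j. subalgebra M (F j)) \<and>
     (\<forall>i j. i \<le> j \<longrightarrow> sets (F i) \<subseteq> sets (F j)) \<and>
     \<comment> \<open>initial ensemble: iid N(m0, C0)\<close>
     (\<forall>n<N. U 0 n \<in> borel_measurable (F 0) \<and> gaussian_rv M (U 0 n) m0 C0) \<and>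
     prob_space.indep_vars M (\<lambda>_. borel) (U 0) {..<N} \<and>
     \<comment> \<open>adaptedness\<close>
     (\<forall>j\<ge>1. \<eta> j \<in> borel_measurable (F j) \<and>
        (\<forall>n<N. \<xi> j n \<in> borel_measurable (F j) \<and> U j n \<in> borel_measurable (F j))) \<and>
     \<comment> \<open>inflation noise: iid N(0, a P), independent of everything else\<close>
     (\<forall>j\<ge>1. \<forall>n<N. gaussian_rv M (\<xi> j n) 0 (\<lambda>x. a *\<^sub>R projP H x)) \<and>
     (\<forall>j\<ge>1. prob_space.indep_sets M
        (\<lambda>i. if i < N then events_of M (\<xi> j i)
             else if i = N then events_of M (\<eta> j) else sets (F (j - 1))) {..N+1}) \<and>
     \<comment> \<open>observation noise: mean zero, covariance R\<close>
     (\<forall>j\<ge>1. \<forall>i. integrable M (\<lambda>\<omega>. (\<eta> j \<omega> $ i)\<^sup>2) \<and>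
        integral\<^sup>L M (\<lambda>\<omega>. \<eta> j \<omega> $ i) = 0 \<and>
        (\<forall>l. integral\<^sup>L M (\<lambda>\<omega>. \<eta> j \<omega> $ i * \<eta> j \<omega> $ l) = R $ i $ l)) \<and>
     \<comment> \<open>forecast with the surrogate model, then square-root analysis\<close>
     (\<forall>j\<ge>1. \<forall>\<omega>\<in>space M.
        enkf_analysis_ok H R \<epsilon> N (H ((\<Psi> ^^ j) u0) + \<epsilon> *\<^sub>R \<eta> j \<omega>)
          (\<lambda>n. \<Psi>s (proj_BV H \<beta> r (U (j - 1) n \<omega>)) + \<xi> j n \<omega>)
          (\<lambda>n. U j n \<omega>))"

end

theory Submission
  imports Defs "HOL-Probability.Sinc_Integral"
begin

text \<open>Write \<open>Q = I - P\<close>. The spread of the projected ensemble contracts deterministically: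
  the analysis step does not increase the spread in the unobserved directions, and bounds it by
  \<open>\<epsilon>\<^sup>2\<close> times the trace of \<open>R\<close> in the observed ones, while \<open>Q \<circ> \<Psi>\<close>
  contracts pairs of members. Hence the spread is eventually of order \<open>\<epsilon> + \<delta>\<close>, whatever the
  noise. The Kalman gain applied to the innovation, in the unobserved directions, is bounded by the
  spread times the inverse square root of the smallest eigenvalue \<open>\<lambda>\<close> of the observed ensemble
  covariance, so it is a mere forcing term of order \<open>\<epsilon> + \<delta>\<close> once \<open>1 / \<lambda>\<close> has a bounded
  expectation; the same bound makes the observed error of order \<open>\<epsilon>\<close>. The distance of the
  members to the signal then obeys a contractive recursion in expectation. Inflation of any
  positive size bounds the expectation of \<open>1 / \<lambda>\<close>, since \<open>N \<ge> 6 k\<close>.\<close>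

subsection \<open>Hilbert space geometry\<close>

text \<open>The obstacle is the correlation between the gain and the error: bounding the correction
  by the gain times the previous error would make the contraction factor random, and possibly larger
  than 1. But the projection keeps all members in \<open>ballB r\<close>, so the innovation is at
  most a constant plus the noise, whatever the previous error. Smallness then comes from the factor
  \<epsilon> or the spread alone, the randomness is purely additive, and it enters the recursion
  through its expectation only. The forecasts are arbitrary functions of the past, so the law of
  \<lambda> is not explicit, and a bound must hold uniformly over all shifts of the members.
  Integrating a Gaussian weight over all of \<open>real^'k\<close> reduces this to one-dimensional
  density bounds for fixed directions. With k = \<open>CARD('k)\<close>, the N - 1 differences of
  members give decay of order N - 1 in the norm of z; it has to pay for the weight, of degree k + 2,
  and for 2 k more powers that make a product of Cauchy factors an integrable majorant. So N - 1 >=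
  3 k + 2 is required, and N >= 6 k ensures it.\<close>

lemma midpoint_norm_identity:
  fixes a x y :: "'a::real_inner"
  shows "(norm (x - y))\<^sup>2
    = 2 * (norm (a - x))\<^sup>2 + 2 * (norm (a - y))\<^sup>2 - 4 * (norm (a - (1/2) *\<^sub>R (x + y)))\<^sup>2"
  by (simp add: power2_norm_eq_inner inner_simps inner_commute algebra_simps)

text \<open>Closed balls are not compact here, so the minimizer comes from completeness: the
  midpoint of two near-minimizers lies in \<open>S\<close>, hence is no closer to \<open>a\<close>
  than the infimum, and the parallelogram law forces the two together.\<close>

lemma nearest_point_exists:
  fixes S :: "'a::{real_inner,complete_space} set" and a :: 'a
  assumes "closed S" "convex S" "S \<noteq> {}"
  shows "\<exists>x\<in>S. \<forall>y\<in>S. norm (a - x) \<le> norm (a - y)"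
proof -
  define d where "d = (INF y\<in>S. (norm (a - y))\<^sup>2)"
  have bdd: "bdd_below ((\<lambda>y. (norm (a - y))\<^sup>2) ` S)"
    by (rule bdd_belowI2[of _ 0]) simp
  have lower: "d \<le> (norm (a - y))\<^sup>2" if "y \<in> S" for y
    unfolding d_def by (rule cINF_lower[OF bdd that])
  have "\<exists>y\<in>S. (norm (a - y))\<^sup>2 < d + 1 / real (Suc n)" for n
    using cINF_less_iff[OF assms(3) bdd, of "d + 1 / real (Suc n)"] by (simp add: d_def)
  then obtain x where xS: "\<And>n. x n \<in> S" and xd: "\<And>n. (norm (a - x n))\<^sup>2 < d + 1 / real (Suc n)"
    by metis
  have close: "(norm (x m - x n))\<^sup>2 \<le> 2 / real (Suc m) + 2 / real (Suc n)" for m n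
  proof -
    have "(1/2) *\<^sub>R (x m + x n) \<in> S"
      using convexD[OF assms(2) xS[of m] xS[of n], of "1/2" "1/2"] by (simp add: scaleR_add_right)
    from lower[OF this] show ?thesis
      using midpoint_norm_identity[of "x m" "x n" a] xd[of m] xd[of n] by simp
  qed
  have "Cauchy x"
  proof (rule metric_CauchyI)
    fix e :: real assume "e > 0"
    then obtain M where M: "1 / real (Suc M) < e\<^sup>2 / 4"
      using reals_Archimedean[of "e\<^sup>2 / 4"] by (auto simp: inverse_eq_divide)
    have "dist (x m) (x n) < e" if "m \<ge> M" "n \<ge> M" for m n
    proof -
      have "1 / real (Suc m) \<le> 1 / real (Suc M)" "1 / real (Suc n) \<le> 1 / real (Suc M)"
        using that by (auto simp: field_simps)
      then have "(norm (x m - x n))\<^sup>2 < e\<^sup>2" using close[of m n] M by simp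
      then show ?thesis using \<open>e > 0\<close> by (simp add: dist_norm power2_less_imp_less)
    qed
    then show "\<exists>M. \<forall>m\<ge>M. \<forall>n\<ge>M. dist (x m) (x n) < e" by blast
  qed
  then obtain l where l: "x \<longlonglongrightarrow> l"
    by (auto simp: Cauchy_convergent_iff convergent_def)
  have "l \<in> S" by (rule closed_sequentially[OF assms(1) xS l])
  have "(\<lambda>n. (norm (a - x n))\<^sup>2) \<longlonglongrightarrow> (norm (a - l))\<^sup>2"
    by (intro tendsto_intros l)
  moreover have "(\<lambda>n. d + 1 / real (Suc n)) \<longlonglongrightarrow> d + 0"
    by (intro tendsto_add tendsto_const LIMSEQ_inverse_real_of_nat[unfolded inverse_eq_divide])
  ultimately have "(norm (a - l))\<^sup>2 \<le> d"
    using LIMSEQ_le[of "\<lambda>n. (norm (a - x n))\<^sup>2" "(norm (a - l))\<^sup>2"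
        "\<lambda>n. d + 1 / real (Suc n)" "d + 0"] less_imp_le[OF xd] by auto
  then have "norm (a - l) \<le> norm (a - y)" if "y \<in> S" for y
    using power2_le_imp_le[OF order_trans[OF _ lower[OF that]]] by simp
  with \<open>l \<in> S\<close> show ?thesis by (intro bexI[of _ l] ballI)
qed

lemma nearest_point_obtuse:
  fixes S :: "'a::real_inner set"
  assumes "convex S" "closed S" "x \<in> S" "y \<in> S" and near: "\<And>z. z \<in> S \<Longrightarrow> norm (a - x) \<le> norm (a - z)"
  shows "(a - x) \<bullet> (y - x) \<le> 0"
  by (rule any_closest_point_dot[OF assms(1-4)]) (simp add: dist_norm near)

text \<open>Adding the obtuse-angle inequalities at \<open>x\<close> and at \<open>y\<close> gives
  |x - y|^2 <= (a - b) . (x - y). The nearest points are hypotheses rather than values of a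
  projection operator, because the filter comes with its own choice \<open>proj_BV\<close>.\<close>

lemma nearest_point_nonexpansive:
  fixes S :: "'a::real_inner set"
  assumes "convex S" "closed S" "x \<in> S" "y \<in> S"
    and "\<And>z. z \<in> S \<Longrightarrow> norm (a - x) \<le> norm (a - z)"
    and "\<And>z. z \<in> S \<Longrightarrow> norm (b - y) \<le> norm (b - z)"
  shows "norm (x - y) \<le> norm (a - b)"
proof -
  have "(a - x) \<bullet> (y - x) \<le> 0" "(b - y) \<bullet> (x - y) \<le> 0"
    using nearest_point_obtuse[OF assms(1-4) assms(5)]
      nearest_point_obtuse[OF assms(1,2,4,3) assms(6)] by simp_all
  moreover have "(a - b) \<bullet> (x - y) - (x - y) \<bullet> (x - y)
      = - ((a - x) \<bullet> (y - x)) - (b - y) \<bullet> (x - y)"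
    by (simp add: inner_diff_left inner_diff_right)
  ultimately have "(x - y) \<bullet> (x - y) \<le> (a - b) \<bullet> (x - y)" by linarith
  also have "\<dots> \<le> norm (a - b) * norm (x - y)" by (rule norm_cauchy_schwarz)
  finally have "norm (x - y) * norm (x - y) \<le> norm (a - b) * norm (x - y)"
    by (metis power2_norm_eq_inner power2_eq_square)
  then have "norm (x - y) \<le> norm (a - b)" if "norm (x - y) > 0"
    by (rule mult_right_le_imp_le) (rule that)
  then show ?thesis using norm_ge_zero[of "a - b"] norm_ge_zero[of "x - y"] by linarith
qed

text \<open>The vector of least norm in the hyperplane f = 1 is orthogonal to the kernel of
  \<open>f\<close>; the representing vector is a multiple of it.\<close>

lemma riesz_representation:
  fixes f :: "'a::{real_inner,complete_space} \<Rightarrow> real"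
  assumes "bounded_linear f"
  shows "\<exists>w. \<forall>x. f x = x \<bullet> w"
proof (cases "\<forall>x. f x = 0")
  case True
  then show ?thesis by (intro exI[of _ 0]) simp
next
  case False
  interpret f: bounded_linear f by fact
  from False obtain x0 where "f x0 \<noteq> 0" by blast
  define S where "S = {x. f x = 1}"
  have x1: "(1 / f x0) *\<^sub>R x0 \<in> S" using \<open>f x0 \<noteq> 0\<close> by (simp add: S_def f.scaleR)
  have "closed S" unfolding S_def
    by (intro closed_Collect_eq continuous_intros f.continuous_on)
  moreover have "convex S" unfolding S_def convex_def
    by (auto simp: f.add f.scaleR)
  ultimately obtain w where w: "w \<in> S" and near: "\<And>y. y \<in> S \<Longrightarrow> norm (0 - w) \<le> norm (0 - y)"
    using nearest_point_exists[of S 0] x1 by blast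
  have orth: "w \<bullet> z \<ge> 0" if "f z = 0" for z
  proof -
    have "w + z \<in> S" using w that by (simp add: S_def f.add)
    from nearest_point_obtuse[OF \<open>convex S\<close> \<open>closed S\<close> w this near] show ?thesis by simp
  qed
  have orth0: "w \<bullet> z = 0" if "f z = 0" for z
    using orth[OF that] orth[of "- z"] that by (simp add: f.neg)
  have w0: "w \<bullet> w \<noteq> 0" using w by (auto simp: S_def f.zero)
  have "f x = x \<bullet> ((1 / (w \<bullet> w)) *\<^sub>R w)" for x
  proof -
    have "f (x - f x *\<^sub>R w) = 0" using w by (simp add: S_def f.diff f.scaleR)
    from orth0[OF this] show ?thesis using w0 by (simp add: inner_simps inner_commute field_simps)
  qed
  then show ?thesis by blast
qed

text \<open>\<open>adjoint\<close> is a choice among the functions with this property, so all that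
  has to be shown is that one exists; Riesz supplies it for each \<open>y\<close>.\<close>

lemma adjoint_bounded_linear_works:
  fixes f :: "'a::{real_inner,complete_space} \<Rightarrow> 'b::euclidean_space"
  assumes "bounded_linear f"
  shows "x \<bullet> adjoint f y = f x \<bullet> y"
proof -
  have "\<exists>w. \<forall>x. f x \<bullet> y = x \<bullet> w" for y
    by (rule riesz_representation)
       (rule bounded_linear_compose[OF bounded_linear_inner_left assms])
  then have "\<exists>g. \<forall>x y. f x \<bullet> y = x \<bullet> g y" by metis
  from someI_ex[OF this] have "\<forall>x y. f x \<bullet> y = x \<bullet> adjoint f y" unfolding adjoint_def .
  then show ?thesis by metis
qed

text \<open>Parseval for an orthogonal set that need not be normalized. A zero vector in
  \<open>C\<close> does no harm: \<open>1 / norm e\<close> is then 0, and its term vanishes on both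
  sides.\<close>

lemma orthogonal_expansion_finite:
  fixes C :: "'a::real_inner set"
  assumes "finite C" "pairwise orthogonal C" "x \<in> span C"
  shows "(norm x)\<^sup>2 = (\<Sum>e\<in>C. (x \<bullet> ((1 / norm e) *\<^sub>R e))\<^sup>2)"
proof -
  obtain c where c: "x = (\<Sum>e\<in>C. c e *\<^sub>R e)"
    using assms(1,3) by (auto simp: span_finite)
  have xe: "x \<bullet> e = c e * (norm e)\<^sup>2" if "e \<in> C" for e
  proof -
    have "x \<bullet> e = (\<Sum>f\<in>C. c f * (f \<bullet> e))" by (simp add: c inner_sum_left)
    also have "\<dots> = (\<Sum>f\<in>C. if f = e then c e * (e \<bullet> e) else 0)"
      using assms(2) that by (intro sum.cong) (auto simp: pairwise_def orthogonal_def)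
    also have "\<dots> = c e * (norm e)\<^sup>2"
      using assms(1) that by (simp add: power2_norm_eq_inner)
    finally show ?thesis .
  qed
  have "(norm x)\<^sup>2 = (\<Sum>e\<in>C. c e * (x \<bullet> e))"
    by (subst power2_norm_eq_inner, subst (2) c) (simp add: inner_sum_right)
  also have "\<dots> = (\<Sum>e\<in>C. (x \<bullet> ((1 / norm e) *\<^sub>R e))\<^sup>2)"
    by (intro sum.cong refl) (auto simp: xe power2_eq_square)
  finally show ?thesis .
qed

text \<open>Trace monotonicity for operators of finite rank, without reference to a trace.\<close>

lemma sum_norm_square_mono:
  fixes a b :: "nat \<Rightarrow> 'a::real_inner"
  assumes le: "\<And>x. (\<Sum>n<N. (a n \<bullet> x)\<^sup>2) \<le> c * (\<Sum>n<N. (b n \<bullet> x)\<^sup>2)"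
  shows "(\<Sum>n<N. (norm (a n))\<^sup>2) \<le> c * (\<Sum>n<N. (norm (b n))\<^sup>2)"
proof -
  \<comment> \<open>One orthogonal set spanning both families turns each sum of squared norms into a
    sum over directions, where the hypothesis applies term by term.\<close>
  obtain C where C: "finite C" "span C = span (a ` {..<N} \<union> b ` {..<N})" "pairwise orthogonal C"
    using basis_orthogonal[of "a ` {..<N} \<union> b ` {..<N}"] by auto
  have ex: "(\<Sum>n<N. (norm (f n))\<^sup>2) = (\<Sum>e\<in>C. \<Sum>n<N. (f n \<bullet> ((1 / norm e) *\<^sub>R e))\<^sup>2)"
    if "\<And>n. n < N \<Longrightarrow> f n \<in> span C" for f
  proof -
    have "(\<Sum>n<N. (norm (f n))\<^sup>2) = (\<Sum>n<N. \<Sum>e\<in>C. (f n \<bullet> ((1 / norm e) *\<^sub>R e))\<^sup>2)"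
      by (intro sum.cong refl orthogonal_expansion_finite[OF C(1,3)] that) auto
    also have "\<dots> = (\<Sum>e\<in>C. \<Sum>n<N. (f n \<bullet> ((1 / norm e) *\<^sub>R e))\<^sup>2)" by (rule sum.swap)
    finally show ?thesis .
  qed
  have "(\<Sum>n<N. (norm (a n))\<^sup>2) = (\<Sum>e\<in>C. \<Sum>n<N. (a n \<bullet> ((1 / norm e) *\<^sub>R e))\<^sup>2)"
    by (rule ex) (simp add: C(2) span_base)
  also have "\<dots> \<le> (\<Sum>e\<in>C. c * (\<Sum>n<N. (b n \<bullet> ((1 / norm e) *\<^sub>R e))\<^sup>2))"
    by (intro sum_mono le)
  also have "\<dots> = c * (\<Sum>n<N. (norm (b n))\<^sup>2)"
  proof -
    have "(\<Sum>n<N. (norm (b n))\<^sup>2) = (\<Sum>e\<in>C. \<Sum>n<N. (b n \<bullet> ((1 / norm e) *\<^sub>R e))\<^sup>2)"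
      by (rule ex) (simp add: C(2) span_base)
    then show ?thesis by (simp only: sum_distrib_left)
  qed
  finally show ?thesis .
qed

subsection \<open>Coisometries and the \<open>V\<close>-norm\<close>

locale coisometry =
  fixes H :: "'h::{real_inner,complete_space} \<Rightarrow> real^'k"
  assumes bounded_linear: "bounded_linear H"
    and H_adjoint: "H (adjoint H y) = y"
begin

sublocale H: bounded_linear H by (rule bounded_linear)

abbreviation Q :: "'h \<Rightarrow> 'h" where "Q x \<equiv> x - projP H x"

lemma inner_adjoint: "x \<bullet> adjoint H y = H x \<bullet> y"
  by (rule adjoint_bounded_linear_works[OF bounded_linear])

lemma inner_adjoint': "adjoint H y \<bullet> x = H x \<bullet> y"
  by (subst inner_commute) (rule inner_adjoint)

lemma norm_adjoint: "norm (adjoint H y) = norm y"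
  using inner_adjoint[of "adjoint H y" y] by (simp add: H_adjoint norm_eq_sqrt_inner)

lemma linear_adjoint: "linear (adjoint H)"
proof (rule linearI)
  fix x y c
  have "(adjoint H (x + y) - (adjoint H x + adjoint H y)) \<bullet> z = 0" for z
    by (simp add: inner_diff_left inner_add_left inner_add_right inner_adjoint')
  from this[of "adjoint H (x + y) - (adjoint H x + adjoint H y)"]
  show "adjoint H (x + y) = adjoint H x + adjoint H y" by simp
  have "(adjoint H (c *\<^sub>R x) - c *\<^sub>R adjoint H x) \<bullet> z = 0" for z
    by (simp add: inner_diff_left inner_adjoint')
  from this[of "adjoint H (c *\<^sub>R x) - c *\<^sub>R adjoint H x"]
  show "adjoint H (c *\<^sub>R x) = c *\<^sub>R adjoint H x" by simp
qed

lemma H_projP: "H (projP H x) = H x"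
  by (simp add: projP_def H_adjoint)

lemma norm_projP: "norm (projP H x) = norm (H x)"
  by (simp add: projP_def norm_adjoint)

lemma H_Q: "H (Q x) = 0"
  by (simp add: H.diff H_projP)

lemma linear_Q: "linear Q"
proof -
  have "linear (projP H)"
    unfolding projP_def using linear_compose[OF H.linear linear_adjoint] by (simp add: o_def)
  then show ?thesis by (intro linear_compose_sub linear_ident)
qed

lemma Q_diff: "Q (x - y) = Q x - Q y"
  by (rule linear_diff[OF linear_Q])

lemma Q_add: "Q (x + y) = Q x + Q y"
  by (rule linear_add[OF linear_Q])

lemma Q_selfadjoint: "Q x \<bullet> y = x \<bullet> Q y"
  by (simp add: projP_def inner_diff_left inner_diff_right inner_adjoint inner_adjoint' inner_commute)

lemma norm_square_split: "(norm x)\<^sup>2 = (norm (H x))\<^sup>2 + (norm (Q x))\<^sup>2"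
proof -
  have "Q x \<bullet> Q x = x \<bullet> x - H x \<bullet> H x"
    by (simp add: projP_def inner_diff_left inner_diff_right inner_adjoint inner_adjoint'
        H_adjoint H.diff)
  then show ?thesis by (simp add: power2_norm_eq_inner)
qed

lemma norm_H_le: "norm (H x) \<le> norm x"
  by (rule power2_le_imp_le) (simp_all add: norm_square_split[of x])

end

locale coisometry_V = coisometry H for H :: "'h::{real_inner,complete_space} \<Rightarrow> real^'k" +
  fixes \<beta> :: real
  assumes \<beta>_nonneg: "\<beta> \<ge> 0"
begin

text \<open>The \<open>V\<close>-norm is the pull-back of the norm of a product Hilbert space, so the projection
  theorem for the ball in the \<open>V\<close>-norm is the one for its image, the part of the graph
  of a bounded operator over the ball.\<close>

definition T :: "'h \<Rightarrow> 'h \<times> (real^'k)" where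
  "T u = (u, sqrt \<beta> *\<^sub>R H u)"

lemma Vn_eq_norm: "Vn H \<beta> u = norm (T u)"
  using \<beta>_nonneg by (simp add: Vn_def T_def norm_Pair norm_projP power_mult_distrib)

lemma T_diff: "T (u - v) = T u - T v"
  by (simp add: T_def H.diff scaleR_diff_right)

lemma T_add: "T (u + v) = T u + T v"
  by (simp add: T_def H.add scaleR_add_right)

lemma T_scaleR: "T (c *\<^sub>R u) = c *\<^sub>R T u"
  by (simp add: T_def H.scaleR)

lemma Vn_nonneg: "Vn H \<beta> u \<ge> 0"
  by (simp add: Vn_eq_norm)

lemma Vn_add_le: "Vn H \<beta> (u + v) \<le> Vn H \<beta> u + Vn H \<beta> v"
  by (simp add: Vn_eq_norm T_add norm_triangle_ineq)

lemma Vn_square: "(Vn H \<beta> u)\<^sup>2 = (1 + \<beta>) * (norm (H u))\<^sup>2 + (norm (Q u))\<^sup>2"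
  using \<beta>_nonneg norm_square_split[of u]
  by (simp add: Vn_def norm_projP algebra_simps)

lemma norm_le_Vn: "norm u \<le> Vn H \<beta> u"
  by (rule power2_le_imp_le[OF _ Vn_nonneg]) (use \<beta>_nonneg in \<open>simp add: Vn_def\<close>)

lemma Vn_le_norm: "Vn H \<beta> u \<le> sqrt (1 + \<beta>) * norm u"
proof (rule power2_le_imp_le)
  show "(Vn H \<beta> u)\<^sup>2 \<le> (sqrt (1 + \<beta>) * norm u)\<^sup>2"
    using \<beta>_nonneg by (simp add: Vn_square power_mult_distrib norm_square_split[of u] algebra_simps)
qed (simp add: \<beta>_nonneg)

lemma Vn_Q: "Vn H \<beta> (Q u) = norm (Q u)"
proof -
  have "projP H (Q u) = 0" using H_Q[of u] by (simp add: projP_def linear_0[OF linear_adjoint])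
  then show ?thesis by (simp add: Vn_def)
qed

lemma Vn_le_H_Q: "Vn H \<beta> u \<le> sqrt (1 + \<beta>) * norm (H u) + norm (Q u)"
proof (rule power2_le_imp_le)
  show "(Vn H \<beta> u)\<^sup>2 \<le> (sqrt (1 + \<beta>) * norm (H u) + norm (Q u))\<^sup>2"
    using \<beta>_nonneg by (simp add: Vn_square power2_sum power_mult_distrib)
qed (simp add: \<beta>_nonneg)

lemma T_image_ball: "closed (T ` ballB r)" "convex (T ` ballB r)"
proof -
  have img: "T ` ballB r = {p. norm (fst p) \<le> r \<and> snd p = sqrt \<beta> *\<^sub>R H (fst p)}"
    by (force simp: T_def ballB_def image_iff)
  show "closed (T ` ballB r)" unfolding img
    by (intro closed_Collect_conj closed_Collect_le closed_Collect_eq continuous_intros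
        H.continuous_on)
  have "linear T" by (intro linearI T_add T_scaleR)
  moreover have "ballB r = cball (0::'h) r" by (auto simp: ballB_def)
  ultimately show "convex (T ` ballB r)" by (simp add: convex_linear_image)
qed

lemma proj_BV_props:
  assumes "r > 0"
  shows "proj_BV H \<beta> r u \<in> ballB r"
    and "y \<in> ballB r \<Longrightarrow> Vn H \<beta> (u - proj_BV H \<beta> r u) \<le> Vn H \<beta> (u - y)"
proof -
  have "0 \<in> ballB r" using assms by (simp add: ballB_def)
  then have "\<exists>p\<in>T ` ballB r. \<forall>q\<in>T ` ballB r. norm (T u - p) \<le> norm (T u - q)"
    by (intro nearest_point_exists T_image_ball) auto
  then have "\<exists>x. x \<in> ballB r \<and> (\<forall>y\<in>ballB r. Vn H \<beta> (u - x) \<le> Vn H \<beta> (u - y))"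
    by (auto simp: Vn_eq_norm T_diff)
  from someI_ex[OF this]
  have *: "proj_BV H \<beta> r u \<in> ballB r \<and>
      (\<forall>y\<in>ballB r. Vn H \<beta> (u - proj_BV H \<beta> r u) \<le> Vn H \<beta> (u - y))"
    unfolding proj_BV_def .
  show "proj_BV H \<beta> r u \<in> ballB r" by (rule conjunct1[OF *])
  show "y \<in> ballB r \<Longrightarrow> Vn H \<beta> (u - proj_BV H \<beta> r u) \<le> Vn H \<beta> (u - y)"
    by (rule bspec[OF conjunct2[OF *]])
qed

lemma proj_BV_nonexpansive:
  assumes "r > 0"
  shows "Vn H \<beta> (proj_BV H \<beta> r u - proj_BV H \<beta> r v) \<le> Vn H \<beta> (u - v)"
proof -
  have near: "norm (T w - T (proj_BV H \<beta> r w)) \<le> norm (T w - z)" if "z \<in> T ` ballB r" for w z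
    using that proj_BV_props(2)[OF assms, of _ w] by (auto simp: Vn_eq_norm T_diff)
  have "norm (T (proj_BV H \<beta> r u) - T (proj_BV H \<beta> r v)) \<le> norm (T u - T v)"
    by (rule nearest_point_nonexpansive[OF T_image_ball(2,1) imageI imageI near near])
       (simp_all add: proj_BV_props(1)[OF assms])
  then show ?thesis by (simp add: Vn_eq_norm T_diff)
qed

lemma proj_BV_fix:
  assumes "r > 0" "v \<in> ballB r"
  shows "proj_BV H \<beta> r v = v"
proof -
  have "Vn H \<beta> (v - proj_BV H \<beta> r v) \<le> Vn H \<beta> (v - v)"
    by (rule proj_BV_props(2)[OF assms])
  also have "\<dots> = 0" unfolding Vn_eq_norm T_diff by simp
  finally have "norm (v - proj_BV H \<beta> r v) \<le> 0"
    using norm_le_Vn[of "v - proj_BV H \<beta> r v"] by linarith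
  then show ?thesis by simp
qed

lemma proj_BV_dist_le:
  assumes "r > 0" "v \<in> ballB r"
  shows "Vn H \<beta> (proj_BV H \<beta> r u - v) \<le> Vn H \<beta> (u - v)"
  using proj_BV_nonexpansive[OF assms(1), of u v] by (simp add: proj_BV_fix[OF assms])

text \<open>A map that is Lipschitz on the ball says nothing off it, so measurability of the
  forecasts is obtained for the composite: the projection is nonexpansive in the V-norm, which is
  equivalent to the norm, so the composite is Lipschitz on the whole space.\<close>

lemma continuous_comp_proj_BV:
  fixes f :: "'h \<Rightarrow> 'h"
  assumes "r > 0" "l \<ge> 0"
    and lip: "\<And>u v. u \<in> ballB r \<Longrightarrow> v \<in> ballB r \<Longrightarrow>
      (Vn H \<beta> (f u - f v))\<^sup>2 \<le> l * (Vn H \<beta> (u - v))\<^sup>2"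
  shows "continuous_on UNIV (\<lambda>u. f (proj_BV H \<beta> r u))"
proof -
  have "norm (f (proj_BV H \<beta> r u) - f (proj_BV H \<beta> r v)) \<le> (sqrt l * sqrt (1 + \<beta>)) * norm (u - v)"
    for u v
  proof -
    have "norm (f (proj_BV H \<beta> r u) - f (proj_BV H \<beta> r v))
        \<le> Vn H \<beta> (f (proj_BV H \<beta> r u) - f (proj_BV H \<beta> r v))" by (rule norm_le_Vn)
    also have "\<dots> \<le> sqrt l * Vn H \<beta> (proj_BV H \<beta> r u - proj_BV H \<beta> r v)"
    proof (rule power2_le_imp_le)
      show "(Vn H \<beta> (f (proj_BV H \<beta> r u) - f (proj_BV H \<beta> r v)))\<^sup>2
          \<le> (sqrt l * Vn H \<beta> (proj_BV H \<beta> r u - proj_BV H \<beta> r v))\<^sup>2"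
        using lip[OF proj_BV_props(1)[OF assms(1)] proj_BV_props(1)[OF assms(1)], of u v] assms(2)
        by (simp add: power_mult_distrib)
    qed (simp add: assms(2) Vn_nonneg)
    also have "\<dots> \<le> sqrt l * (sqrt (1 + \<beta>) * norm (u - v))"
      by (intro mult_left_mono order_trans[OF proj_BV_nonexpansive[OF assms(1)] Vn_le_norm])
         (simp add: assms(2))
    finally show ?thesis by (simp add: mult.assoc)
  qed
  then have "(sqrt l * sqrt (1 + \<beta>))-lipschitz_on UNIV (\<lambda>u. f (proj_BV H \<beta> r u))"
    using assms(2) \<beta>_nonneg by (intro lipschitz_onI) (simp_all add: dist_norm)
  then show ?thesis by (rule lipschitz_on_continuous_on)
qed

end

subsection \<open>The analysis step\<close>

lemma ens_mean_sum: "N > 0 \<Longrightarrow> (\<Sum>n<N. v n) = real N *\<^sub>R ens_mean N v"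
  by (simp add: ens_mean_def)

lemma (in bounded_linear) ens_mean: "f (ens_mean N v) = ens_mean N (\<lambda>n. f (v n))"
  by (simp add: ens_mean_def scaleR sum)

lemma linear_ens_mean: "linear f \<Longrightarrow> f (ens_mean N v) = ens_mean N (\<lambda>n. f (v n))"
  by (simp add: ens_mean_def linear_scale linear_sum)

lemma pos_def_lower_bound:
  fixes R :: "real^'k^'k"
  assumes "\<And>x. x \<noteq> 0 \<Longrightarrow> x \<bullet> (R *v x) > 0"
  shows "\<exists>r0>0. \<forall>x. r0 * (norm x)\<^sup>2 \<le> x \<bullet> (R *v x)"
proof -
  have "continuous_on (sphere 0 1) (\<lambda>x::real^'k. x \<bullet> (R *v x))"
    by (intro continuous_intros)
  moreover have "sphere (0::real^'k) 1 \<noteq> {}" by simp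
  ultimately obtain x0 :: "real^'k" where x0: "norm x0 = 1"
    "\<And>x. norm x = 1 \<Longrightarrow> x0 \<bullet> (R *v x0) \<le> x \<bullet> (R *v x)"
    using continuous_attains_inf[OF compact_sphere, of 0 1 "\<lambda>x::real^'k. x \<bullet> (R *v x)"]
    by (auto simp: Ball_def)
  have "(x0 \<bullet> (R *v x0)) * (norm x)\<^sup>2 \<le> x \<bullet> (R *v x)" for x
  proof (cases "x = 0")
    case False
    have "x0 \<bullet> (R *v x0) \<le> ((1 / norm x) *\<^sub>R x) \<bullet> (R *v ((1 / norm x) *\<^sub>R x))"
      by (rule x0(2)) (use False in simp)
    also have "\<dots> = (x \<bullet> (R *v x)) / (norm x)\<^sup>2"
      by (simp add: matrix_vector_mult_scaleR power2_eq_square)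
    finally show ?thesis using False by (simp add: field_simps)
  qed simp
  moreover have "x0 \<bullet> (R *v x0) > 0" by (rule assms) (use x0(1) in auto)
  ultimately show ?thesis by blast
qed

text \<open>One analysis step for one outcome: \<open>v\<close> is the forecast ensemble,
  \<open>u\<close> the analysis ensemble, and nothing is random.\<close>

locale enkf_analysis = coisometry H for H :: "'h::{real_inner,complete_space} \<Rightarrow> real^'k" +
  fixes R :: "real^'k^'k" and \<epsilon> :: real and N :: nat and y :: "real^'k"
    and v u :: "nat \<Rightarrow> 'h"
  assumes R_pos: "x \<noteq> 0 \<Longrightarrow> x \<bullet> (R *v x) > 0"
    and R_sym: "R $ i $ l = R $ l $ i"
    and \<epsilon>_pos: "\<epsilon> > 0" and N_gt: "N > 1"
    and ok: "enkf_analysis_ok H R \<epsilon> N y v u"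
begin

definition b :: "nat \<Rightarrow> 'h" where "b n = v n - ens_mean N v"
definition c :: "nat \<Rightarrow> 'h" where "c n = u n - ens_mean N u"
definition Cov :: "'h \<Rightarrow> 'h" where "Cov = ens_cov (1 / real N) N v"
text \<open>The ensemble covariance seen in observation space (\<open>H_Cov_adjoint\<close>),
  written so that its quadratic form is a sum of squares. \<open>A\<close> is the covariance of the
  innovation, and \<open>G\<close> solves with it.\<close>

definition S :: "real^'k \<Rightarrow> real^'k" where
  "S z = (1 / real N) *\<^sub>R (\<Sum>n<N. (H (b n) \<bullet> z) *\<^sub>R H (b n))"
definition A :: "real^'k^'k" where
  "A = matrix (\<lambda>z. H (Cov (adjoint H z))) + \<epsilon>\<^sup>2 *\<^sub>R R"
definition G :: "real^'k \<Rightarrow> real^'k" where "G w = matrix_inv A *v w"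

lemma Cov_eq: "Cov x = (1 / real N) *\<^sub>R (\<Sum>n<N. (b n \<bullet> x) *\<^sub>R b n)"
  by (simp add: Cov_def ens_cov_def b_def)

lemma H_Cov_adjoint: "H (Cov (adjoint H z)) = S z"
  by (simp add: Cov_eq S_def H.scaleR H.sum inner_adjoint)

lemma linear_S: "linear S"
  by (intro linearI)
     (simp_all add: S_def inner_add_right scaleR_add_left sum.distrib scaleR_add_right
        scaleR_sum_right mult_ac)

lemma A_mult: "A *v z = S z + \<epsilon>\<^sup>2 *\<^sub>R (R *v z)"
proof -
  have "matrix (\<lambda>z. H (Cov (adjoint H z))) *v z = S z"
    using matrix_works[of S] linear_S by (simp add: H_Cov_adjoint linear_matrix_vector_mul_eq)
  then show ?thesis
    by (simp add: A_def matrix_vector_mult_add_rdistrib scaleR_matrix_vector_assoc)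
qed

lemma inner_S: "z \<bullet> S w = (1 / real N) * (\<Sum>n<N. (H (b n) \<bullet> z) * (H (b n) \<bullet> w))"
  by (simp add: S_def inner_sum_right inner_commute[of z] mult_ac)

lemma inner_S_sym: "z \<bullet> S w = w \<bullet> S z"
  by (simp add: inner_S mult.commute)

lemma inner_S_nonneg: "z \<bullet> S z \<ge> 0"
  by (simp add: inner_S sum_nonneg)

lemma inner_R_sym: "x \<bullet> (R *v z) = z \<bullet> (R *v x)"
proof -
  have "transpose R = R" by (simp add: transpose_def vec_eq_iff R_sym)
  then show ?thesis by (metis dot_lmul_matrix inner_commute vector_transpose_matrix)
qed

lemma inner_A: "z \<bullet> (A *v z) = z \<bullet> S z + \<epsilon>\<^sup>2 * (z \<bullet> (R *v z))"
  by (simp add: A_mult inner_add_right)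

lemma inner_A_nonneg: "z \<bullet> (A *v z) \<ge> 0"
  using R_pos[of z] inner_S_nonneg[of z] \<epsilon>_pos by (cases "z = 0") (simp_all add: inner_A)

lemma A_G: "A *v G w = w"
proof -
  have "z = 0" if "A *v z = 0" for z
  proof (rule ccontr)
    assume "z \<noteq> 0"
    then have "z \<bullet> (A *v z) > 0"
      using R_pos[of z] inner_S_nonneg[of z] \<epsilon>_pos
      by (simp add: inner_A add_nonneg_pos)
    then show False using that by simp
  qed
  then have "invertible A"
    by (simp add: invertible_left_inverse matrix_left_invertible_ker)
  then have "A ** matrix_inv A = mat 1"
    unfolding invertible_def matrix_inv_def by (rule someI2_ex) simp
  then show ?thesis by (simp add: G_def matrix_vector_mul_assoc)
qed

lemma G_add: "G (w + w') = G w + G w'"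
  by (simp add: G_def matrix_vector_right_distrib)

lemma gain_eq: "kalman_gain H R \<epsilon> Cov w = Cov (adjoint H (G w))"
  by (simp add: kalman_gain_def G_def A_def)

lemma mean_update: "ens_mean N u = ens_mean N v + Cov (adjoint H (G (y - H (ens_mean N v))))"
  using ok by (simp add: enkf_analysis_ok_def Let_def gain_eq Cov_def[symmetric])

text \<open>The square-root step leaves the members themselves undetermined. What it fixes is this
  quadratic form, from which all spread bounds are read off. The two covariances are normalized by N
  and by N - 1, hence the factors.\<close>

lemma cov_update:
  "(\<Sum>n<N. (c n \<bullet> x)\<^sup>2) = (real N - 1) *
     ((1 / real N) * (\<Sum>n<N. (b n \<bullet> x)\<^sup>2) - H (Cov x) \<bullet> G (H (Cov x)))"
proof -
  have "ens_cov (1 / (real N - 1)) N u x = Cov x - Cov (adjoint H (G (H (Cov x))))"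
    using ok by (simp add: enkf_analysis_ok_def Let_def gain_eq Cov_def[symmetric])
  then have "x \<bullet> ens_cov (1 / (real N - 1)) N u x = x \<bullet> Cov x - x \<bullet> Cov (adjoint H (G (H (Cov x))))"
    by (simp add: inner_diff_right)
  moreover have "x \<bullet> ens_cov (1 / (real N - 1)) N u x = (1 / (real N - 1)) * (\<Sum>n<N. (c n \<bullet> x)\<^sup>2)"
    by (simp add: ens_cov_def c_def inner_sum_right inner_commute[of x] power2_eq_square)
  moreover have "x \<bullet> Cov x = (1 / real N) * (\<Sum>n<N. (b n \<bullet> x)\<^sup>2)"
    by (simp add: Cov_eq inner_sum_right inner_commute[of x] power2_eq_square)
  moreover have "x \<bullet> Cov (adjoint H z) = H (Cov x) \<bullet> z" for z
    by (simp add: Cov_eq inner_adjoint H.scaleR H.sum inner_sum_right inner_sum_left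
        inner_commute[of x] mult_ac)
  ultimately have "(1 / (real N - 1)) * (\<Sum>n<N. (c n \<bullet> x)\<^sup>2)
    = (1 / real N) * (\<Sum>n<N. (b n \<bullet> x)\<^sup>2) - H (Cov x) \<bullet> G (H (Cov x))" by simp
  then show ?thesis using N_gt by (simp add: field_simps)
qed

text \<open>The posterior variance in direction \<open>z\<close> is at most that of the observation
  noise, whatever the prior \<open>S\<close>: with t = A^-1 S z, expanding (t - z) . A (t - z) >= 0
  gives exactly z . S z - S z . A^-1 S z <= \<epsilon>^2 z . R z.\<close>

lemma observed_direction_le: "(\<Sum>n<N. (H (c n) \<bullet> z)\<^sup>2) \<le> (real N - 1) * (\<epsilon>\<^sup>2 * (z \<bullet> (R *v z)))"
proof -
  define t where "t = G (S z)"
  have At: "A *v t = S z" by (simp add: t_def A_G)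
  have tA: "t \<bullet> (A *v z) = z \<bullet> (A *v t)"
    by (simp add: A_mult inner_add_right inner_S_sym[of t] inner_R_sym[of t])
  have "0 \<le> (t - z) \<bullet> (A *v (t - z))" by (rule inner_A_nonneg)
  also have "\<dots> = t \<bullet> S z - 2 * (z \<bullet> S z) + z \<bullet> (A *v z)"
    using tA At by (simp add: matrix_vector_mult_diff_distrib inner_diff_left inner_diff_right)
  finally have "z \<bullet> S z - \<epsilon>\<^sup>2 * (z \<bullet> (R *v z)) \<le> S z \<bullet> t"
    by (simp add: inner_A inner_commute)
  then have "z \<bullet> S z - S z \<bullet> G (S z) \<le> \<epsilon>\<^sup>2 * (z \<bullet> (R *v z))"
    by (simp add: t_def)
  moreover have "(\<Sum>n<N. (H (c n) \<bullet> z)\<^sup>2) = (real N - 1) * (z \<bullet> S z - S z \<bullet> G (S z))"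
    using cov_update[of "adjoint H z"]
    by (simp add: inner_adjoint H_Cov_adjoint inner_S power2_eq_square)
  ultimately show ?thesis using N_gt by (simp add: mult_left_mono)
qed

lemma observed_spread: "(\<Sum>n<N. (norm (H (c n)))\<^sup>2) \<le> (real N - 1) * \<epsilon>\<^sup>2 * (\<Sum>i\<in>UNIV. R $ i $ i)"
proof -
  have "(\<Sum>n<N. (norm (H (c n)))\<^sup>2) = (\<Sum>n<N. \<Sum>i\<in>UNIV. (H (c n) \<bullet> axis i 1)\<^sup>2)"
    by (intro sum.cong refl)
       (simp only: power2_norm_eq_inner, simp add: inner_vec_def[of "H _" "H _"] inner_axis power2_eq_square)
  also have "\<dots> = (\<Sum>i\<in>UNIV. \<Sum>n<N. (H (c n) \<bullet> axis i 1)\<^sup>2)" by (rule sum.swap)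
  also have "\<dots> \<le> (\<Sum>i\<in>UNIV. (real N - 1) * (\<epsilon>\<^sup>2 * R $ i $ i))"
  proof (rule sum_mono)
    fix i :: 'k
    have "axis i 1 \<bullet> (R *v axis i 1) = R $ i $ i"
      by (simp add: inner_axis' matrix_vector_mult_basis column_def)
    then show "(\<Sum>n<N. (H (c n) \<bullet> axis i 1)\<^sup>2) \<le> (real N - 1) * (\<epsilon>\<^sup>2 * R $ i $ i)"
      using observed_direction_le[of "axis i 1"] by simp
  qed
  finally show ?thesis by (simp add: sum_distrib_left mult_ac)
qed

text \<open>The term subtracted in \<open>cov_update\<close> is nonnegative, so the forms are
  ordered in every direction. As \<open>Q\<close> is self-adjoint, it can be moved onto the test
  vector, and trace monotonicity turns the order of forms into one of sums of norms.\<close>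

lemma unobserved_spread: "(\<Sum>n<N. (norm (Q (c n)))\<^sup>2) \<le> (\<Sum>n<N. (norm (Q (b n)))\<^sup>2)"
proof -
  have "(\<Sum>n<N. (c n \<bullet> x)\<^sup>2) \<le> 1 * (\<Sum>n<N. (b n \<bullet> x)\<^sup>2)" for x
  proof -
    let ?s = "\<Sum>n<N. (b n \<bullet> x)\<^sup>2"
    have "H (Cov x) \<bullet> G (H (Cov x)) \<ge> 0"
      using inner_A_nonneg[of "G (H (Cov x))"] by (simp add: A_G inner_commute)
    then have "(\<Sum>n<N. (c n \<bullet> x)\<^sup>2) \<le> (real N - 1) * ((1 / real N) * ?s)"
      unfolding cov_update using N_gt by (intro mult_left_mono) auto
    also have "\<dots> = ((real N - 1) / real N) * ?s" by simp
    also have "\<dots> \<le> 1 * ?s" using N_gt by (intro mult_right_mono sum_nonneg) auto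
    finally show ?thesis .
  qed
  from this[of "Q _"] have "(\<Sum>n<N. (Q (c n) \<bullet> x)\<^sup>2) \<le> 1 * (\<Sum>n<N. (Q (b n) \<bullet> x)\<^sup>2)" for x
    by (simp only: Q_selfadjoint)
  then show ?thesis using sum_norm_square_mono[of "\<lambda>n. Q (c n)" N 1 "\<lambda>n. Q (b n)"] by simp
qed

lemma norm_G_le:
  assumes "lam \<ge> 0" and lam: "\<And>z. lam * (norm z)\<^sup>2 \<le> z \<bullet> S z"
    and "r0 \<ge> 0" and r0: "\<And>z. r0 * (norm z)\<^sup>2 \<le> z \<bullet> (R *v z)"
  shows "(lam + \<epsilon>\<^sup>2 * r0) * norm (G w) \<le> norm w"
proof (cases "G w = 0")
  case False
  have "((lam + \<epsilon>\<^sup>2 * r0) * norm (G w)) * norm (G w) = lam * (norm (G w))\<^sup>2 + \<epsilon>\<^sup>2 * (r0 * (norm (G w))\<^sup>2)"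
    by (simp add: power2_eq_square algebra_simps)
  also have "\<dots> \<le> G w \<bullet> (A *v G w)"
    unfolding inner_A by (intro add_mono mult_left_mono lam r0) simp
  also have "\<dots> = w \<bullet> G w" by (simp add: A_G inner_commute)
  also have "\<dots> \<le> norm w * norm (G w)" by (rule norm_cauchy_schwarz)
  finally show ?thesis using False by (simp add: mult_le_cancel_right)
qed simp

lemma inner_G_S_G_le: "G w \<bullet> S (G w) \<le> norm (G w) * norm w"
proof -
  have "\<epsilon>\<^sup>2 * (G w \<bullet> (R *v G w)) \<ge> 0"
    using R_pos[of "G w"] by (cases "G w = 0") auto
  then have "G w \<bullet> S (G w) \<le> G w \<bullet> (A *v G w)" by (simp add: inner_A)
  also have "\<dots> \<le> norm (G w) * norm w" by (simp add: A_G norm_cauchy_schwarz)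
  finally show ?thesis .
qed

text \<open>Cauchy-Schwarz over the members bounds a cross covariance by the two standard
  deviations. Keeping \<open>t \<bullet> S t\<close>, and not a norm of \<open>S\<close>, lets the
  inverse inside the gain cancel the size of \<open>S\<close>.\<close>

lemma norm_Q_Cov_adjoint_le:
  "norm (Q (Cov (adjoint H t))) \<le> sqrt ((1 / real N) * (\<Sum>n<N. (norm (Q (b n)))\<^sup>2)) * sqrt (t \<bullet> S t)"
proof (rule power2_le_imp_le)
  have "Q (Cov (adjoint H t)) = (1 / real N) *\<^sub>R (\<Sum>n<N. (H (b n) \<bullet> t) *\<^sub>R Q (b n))"
    by (simp only: Cov_eq linear_scale[OF linear_Q] linear_sum[OF linear_Q] inner_adjoint)
  then have "norm (Q (Cov (adjoint H t))) \<le> (1 / real N) * (\<Sum>n<N. \<bar>H (b n) \<bullet> t\<bar> * norm (Q (b n)))"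
    by (simp add: divide_right_mono sum_norm_le)
  then have "(norm (Q (Cov (adjoint H t))))\<^sup>2
      \<le> ((1 / real N) * (\<Sum>n<N. \<bar>H (b n) \<bullet> t\<bar> * norm (Q (b n))))\<^sup>2"
    by (rule power_mono) simp
  also have "\<dots> = (1 / real N)\<^sup>2 * (\<Sum>n<N. \<bar>H (b n) \<bullet> t\<bar> * norm (Q (b n)))\<^sup>2"
    by (rule power_mult_distrib)
  also have "\<dots> \<le> (1 / real N)\<^sup>2 * ((\<Sum>n<N. \<bar>H (b n) \<bullet> t\<bar>\<^sup>2) * (\<Sum>n<N. (norm (Q (b n)))\<^sup>2))"
    by (intro mult_left_mono Cauchy_Schwarz_ineq_sum) simp
  also have "\<dots> = ((1 / real N) * (\<Sum>n<N. (norm (Q (b n)))\<^sup>2)) * (t \<bullet> S t)"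
    by (simp add: inner_S power2_eq_square)
  also have "\<dots> = (sqrt ((1 / real N) * (\<Sum>n<N. (norm (Q (b n)))\<^sup>2)) * sqrt (t \<bullet> S t))\<^sup>2"
    using inner_S_nonneg[of t] by (simp add: power_mult_distrib sum_nonneg)
  finally show "(norm (Q (Cov (adjoint H t))))\<^sup>2 \<le>
    (sqrt ((1 / real N) * (\<Sum>n<N. (norm (Q (b n)))\<^sup>2)) * sqrt (t \<bullet> S t))\<^sup>2" .
qed (simp add: sum_nonneg inner_S_nonneg)

text \<open>The innovation is split into the forecast error \<open>w\<close> and the noise, with
  separate solutions \<open>t1\<close> and \<open>t2\<close> of the linear system:
  \<open>lam\<close> is needed for the first only, while for the second the positivity of
  \<open>R\<close> suffices.\<close>

lemma mean_error:
  assumes "lam > 0" and lam: "\<And>z. lam * (norm z)\<^sup>2 \<le> z \<bullet> S z"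
    and "r0 > 0" and r0: "\<And>z. r0 * (norm z)\<^sup>2 \<le> z \<bullet> (R *v z)"
    and "\<rho> \<ge> 0" and \<rho>: "\<And>z. norm (R *v z) \<le> \<rho> * norm z"
    and y: "y = H x + \<epsilon> *\<^sub>R \<eta>"
  shows "norm (H (ens_mean N u - x)) \<le>
      \<epsilon> * (\<rho> / (2 * sqrt r0) * (norm (H (x - ens_mean N v)) / sqrt lam) + (1 + \<rho> / r0) * norm \<eta>)"
    and "norm (Q (ens_mean N u - x)) \<le> norm (Q (ens_mean N v - x)) +
      sqrt ((1 / real N) * (\<Sum>n<N. (norm (Q (b n)))\<^sup>2)) *
        (norm (H (x - ens_mean N v)) / sqrt lam + norm \<eta> / sqrt r0)"
proof -
  define \<mu> w t1 t2 where "\<mu> = ens_mean N v" and "w = H (x - \<mu>)"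
    and "t1 = G w" and "t2 = G (\<epsilon> *\<^sub>R \<eta>)"
  have upd: "ens_mean N u = \<mu> + Cov (adjoint H (t1 + t2))"
  proof -
    have "y - H \<mu> = w + \<epsilon> *\<^sub>R \<eta>" by (simp add: y w_def H.diff)
    then show ?thesis using mean_update by (simp add: \<mu>_def t1_def t2_def G_add)
  qed
  have At: "S t1 + \<epsilon>\<^sup>2 *\<^sub>R (R *v t1) = w" "S t2 + \<epsilon>\<^sup>2 *\<^sub>R (R *v t2) = \<epsilon> *\<^sub>R \<eta>"
    using A_G[of w] A_G[of "\<epsilon> *\<^sub>R \<eta>"] by (simp_all add: A_mult t1_def t2_def)
  \<comment> \<open>The arithmetic-geometric mean inequality keeps the observed error at order
    \<epsilon> times 1 / sqrt lam, where discarding the noise term would give \<epsilon>^2 / lam,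
    which is not bounded by a multiple of the former.\<close>
  have s: "(2 * \<epsilon> * (sqrt lam * sqrt r0)) * norm t1 \<le> norm w"
  proof -
    have "0 \<le> (sqrt lam - \<epsilon> * sqrt r0)\<^sup>2" by simp
    then have "2 * \<epsilon> * (sqrt lam * sqrt r0) \<le> lam + \<epsilon>\<^sup>2 * r0"
      using assms(1,3) by (simp add: power2_diff power_mult_distrib mult_ac)
    then have "(2 * \<epsilon> * (sqrt lam * sqrt r0)) * norm t1 \<le> (lam + \<epsilon>\<^sup>2 * r0) * norm t1"
      by (rule mult_right_mono) simp
    also have "\<dots> \<le> norm w" unfolding t1_def
      by (rule norm_G_le) (use assms in auto)
    finally show ?thesis .
  qed
  have s1: "lam * norm t1 \<le> norm w"
  proof -
    have "lam * norm t1 \<le> (lam + \<epsilon>\<^sup>2 * r0) * norm t1"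
      by (rule mult_right_mono) (use assms in auto)
    also have "\<dots> \<le> norm w" unfolding t1_def
      by (rule norm_G_le) (use assms in auto)
    finally show ?thesis .
  qed
  \<comment> \<open>Here \<open>lam\<close> is taken as 0. One \<epsilon> of the scaled noise
    cancels against \<open>\<epsilon>\<^sup>2 * r0\<close>.\<close>
  have s2: "\<epsilon> * r0 * norm t2 \<le> norm \<eta>"
  proof -
    have "(0 + \<epsilon>\<^sup>2 * r0) * norm t2 \<le> norm (\<epsilon> *\<^sub>R \<eta>)" unfolding t2_def
      by (rule norm_G_le) (use assms inner_S_nonneg in auto)
    then have "\<epsilon> * (\<epsilon> * r0 * norm t2) \<le> \<epsilon> * norm \<eta>"
      using \<epsilon>_pos by (simp add: power2_eq_square mult_ac)
    then show ?thesis using \<epsilon>_pos by simp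
  qed
  \<comment> \<open>The update \<open>S t1\<close> undoes \<open>w\<close> up to
    \<open>\<epsilon>\<^sup>2 *\<^sub>R (R *v t1)\<close>; both residual terms carry a factor
    \<epsilon>.\<close>
  have "H (ens_mean N u - x) = - (\<epsilon>\<^sup>2 *\<^sub>R (R *v t1)) + (\<epsilon> *\<^sub>R \<eta> - \<epsilon>\<^sup>2 *\<^sub>R (R *v t2))"
  proof -
    have "H (ens_mean N u - x) = - w + (S t1 + S t2)"
      by (simp add: upd H.diff H.add H_Cov_adjoint linear_add[OF linear_S] w_def)
    moreover have "S t1 = w - \<epsilon>\<^sup>2 *\<^sub>R (R *v t1)" "S t2 = \<epsilon> *\<^sub>R \<eta> - \<epsilon>\<^sup>2 *\<^sub>R (R *v t2)"
      using At by (simp_all only: add_diff_cancel_right' flip: At)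
    ultimately show ?thesis by simp
  qed
  also have "norm \<dots> \<le> \<epsilon>\<^sup>2 * norm (R *v t1) + (\<epsilon> * norm \<eta> + \<epsilon>\<^sup>2 * norm (R *v t2))"
    using \<epsilon>_pos
    by (intro order_trans[OF norm_triangle_ineq] add_mono order_trans[OF norm_triangle_ineq4]) simp_all
  also have "\<dots> \<le> \<epsilon>\<^sup>2 * (\<rho> * norm t1) + (\<epsilon> * norm \<eta> + \<epsilon>\<^sup>2 * (\<rho> * norm t2))"
    using \<epsilon>_pos by (intro add_mono mult_left_mono \<rho>) simp_all
  also have "\<dots> = \<epsilon> * (\<rho> * (\<epsilon> * norm t1) + (norm \<eta> + \<rho> * (\<epsilon> * norm t2)))"
    by (simp add: power2_eq_square algebra_simps)
  also have "\<dots> \<le> \<epsilon> * (\<rho> * (norm w / (2 * (sqrt lam * sqrt r0))) + (norm \<eta> + \<rho> * (norm \<eta> / r0)))"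
    using s s2 assms(1,3,5) \<epsilon>_pos
    by (intro mult_left_mono add_mono order_refl) (simp_all add: field_simps)
  also have "\<dots> = \<epsilon> * (\<rho> / (2 * sqrt r0) * (norm w / sqrt lam) + (1 + \<rho> / r0) * norm \<eta>)"
    by (simp add: algebra_simps)
  finally show "norm (H (ens_mean N u - x)) \<le>
      \<epsilon> * (\<rho> / (2 * sqrt r0) * (norm (H (x - ens_mean N v)) / sqrt lam) + (1 + \<rho> / r0) * norm \<eta>)"
    by (simp only: w_def \<mu>_def)
  \<comment> \<open>S <= A bounds the form by |t1| |w|, and |t1| <= |w| / lam leaves a single 1 /
    sqrt lam after the root.\<close>
  have r1: "sqrt (t1 \<bullet> S t1) \<le> norm w / sqrt lam"
  proof (rule real_le_lsqrt)
    show "t1 \<bullet> S t1 \<le> (norm w / sqrt lam)\<^sup>2"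
    proof -
      have "t1 \<bullet> S t1 \<le> norm t1 * norm w" unfolding t1_def by (rule inner_G_S_G_le)
      also have "\<dots> \<le> (norm w / lam) * norm w"
        using s1 assms(1) by (intro mult_right_mono) (simp_all add: field_simps)
      finally show ?thesis using assms(1) by (simp add: power_divide power2_eq_square)
    qed
  qed (use assms(1) in simp_all)
  have r2: "sqrt (t2 \<bullet> S t2) \<le> norm \<eta> / sqrt r0"
  proof (rule real_le_lsqrt)
    show "t2 \<bullet> S t2 \<le> (norm \<eta> / sqrt r0)\<^sup>2"
    proof -
      have "t2 \<bullet> S t2 \<le> norm t2 * norm (\<epsilon> *\<^sub>R \<eta>)" unfolding t2_def by (rule inner_G_S_G_le)
      also have "\<dots> = (\<epsilon> * norm t2) * norm \<eta>" using \<epsilon>_pos by simp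
      also have "\<dots> \<le> (norm \<eta> / r0) * norm \<eta>"
        using s2 assms(3) by (intro mult_right_mono) (simp_all add: field_simps)
      finally show ?thesis using assms(3) by (simp add: power_divide power2_eq_square)
    qed
  qed (use assms(3) in simp_all)
  let ?\<tau> = "sqrt ((1 / real N) * (\<Sum>n<N. (norm (Q (b n)))\<^sup>2))"
  have lin: "Cov (adjoint H (t1 + t2)) = Cov (adjoint H t1) + Cov (adjoint H t2)"
    by (simp add: Cov_eq inner_adjoint inner_add_right scaleR_add_left sum.distrib scaleR_add_right)
  have "Q (ens_mean N u - x) = Q (\<mu> - x) + (Q (Cov (adjoint H t1)) + Q (Cov (adjoint H t2)))"
    unfolding Q_add[symmetric] by (simp only: upd lin) (simp add: algebra_simps)
  then have "norm (Q (ens_mean N u - x)) \<le>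
      norm (Q (\<mu> - x)) + (norm (Q (Cov (adjoint H t1))) + norm (Q (Cov (adjoint H t2))))"
    by (simp only:) (intro order_trans[OF norm_triangle_ineq] add_left_mono norm_triangle_ineq)
  also have "\<dots> \<le> norm (Q (\<mu> - x)) + (?\<tau> * (norm w / sqrt lam) + ?\<tau> * (norm \<eta> / sqrt r0))"
    using r1 r2
    by (intro add_mono order_refl order_trans[OF norm_Q_Cov_adjoint_le] mult_left_mono)
       (simp_all add: sum_nonneg)
  finally show "norm (Q (ens_mean N u - x)) \<le> norm (Q (ens_mean N v - x)) +
      ?\<tau> * (norm (H (x - ens_mean N v)) / sqrt lam + norm \<eta> / sqrt r0)"
    by (simp add: distrib_left w_def \<mu>_def)
qed

end

subsection \<open>Smallest eigenvalues of ensemble covariances\<close>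

lemma nn_integral_inverse_1_plus_square:
  "(\<integral>\<^sup>+x. ennreal (inverse (1 + x\<^sup>2)) \<partial>lborel) < \<infinity>"
proof -
  have "einterval (-\<infinity>) \<infinity> = (UNIV :: real set)" by (auto simp: einterval_def)
  then have "integrable lborel (\<lambda>x::real. inverse (1 + x\<^sup>2))"
    using integrable_inverse_1_plus_square by (simp add: set_integrable_def)
  then show ?thesis
    by (subst nn_integral_eq_integral) auto
qed

text \<open>The integrable majorant is chosen as a product over coordinates so that the integral
  factorizes into one-dimensional ones.\<close>

lemma nn_integral_prod_Cauchy:
  "(\<integral>\<^sup>+z. ennreal (\<Prod>i\<in>UNIV. inverse (1 + (z $ i)\<^sup>2)) \<partial>(lborel :: (real^'k) measure)) < \<infinity>"
proof -
  have "(\<Prod>i\<in>UNIV. inverse (1 + (z $ i)\<^sup>2)) = (\<Prod>b\<in>Basis. inverse (1 + (z \<bullet> b)\<^sup>2))" for z :: "real^'k"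
  proof -
    have B: "(Basis :: (real^'k) set) = (\<lambda>i. axis i 1) ` UNIV"
      by (auto simp: Basis_vec_def)
    have "inj (\<lambda>i::'k. axis i (1::real))" by (auto simp: inj_on_def axis_eq_axis)
    then show ?thesis unfolding B by (subst prod.reindex) (simp_all add: inner_axis)
  qed
  then have "(\<integral>\<^sup>+z. ennreal (\<Prod>i\<in>UNIV. inverse (1 + (z $ i)\<^sup>2)) \<partial>(lborel :: (real^'k) measure))
    = (\<integral>\<^sup>+z. (\<Prod>b\<in>Basis. ennreal (inverse (1 + (z \<bullet> b)\<^sup>2))) \<partial>(lborel :: (real^'k) measure))"
    by (subst prod_ennreal) simp_all
  also have "\<dots> = (\<Prod>b\<in>(Basis :: (real^'k) set). \<integral>\<^sup>+x. ennreal (inverse (1 + x\<^sup>2)) \<partial>lborel)"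
    by (rule nn_integral_lborel_prod) simp_all
  also have "\<dots> < \<infinity>"
    using nn_integral_inverse_1_plus_square by (simp add: power_less_top_ennreal)
  finally show ?thesis .
qed

text \<open>Count powers of \<open>norm z\<close>. Outside the unit ball, the weight contributes k +
  2 and the product of all 1 + z_i^2 at most 2 k, so decay of order 3 k + 2 suffices. Inside, the
  bound 1 in the minimum is used, and the product is at most 2^k.\<close>

lemma weight_le_prod_Cauchy:
  fixes z :: "real^'k"
  assumes B: "B \<ge> 1" and p: "3 * CARD('k) + 2 \<le> p"
  shows "norm z ^ (CARD('k) + 2) * min 1 ((B / norm z) ^ p)
    \<le> (2 ^ CARD('k) * B ^ p) * (\<Prod>i\<in>UNIV. inverse (1 + (z $ i)\<^sup>2))"
proof -
  let ?k = "CARD('k)"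
  have P: "(\<Prod>i\<in>UNIV. inverse (1 + (z $ i)\<^sup>2)) = inverse (\<Prod>i\<in>UNIV. 1 + (z $ i)\<^sup>2)"
    by (simp add: prod_inversef[symmetric] comp_def)
  have Ppos: "(\<Prod>i\<in>UNIV. 1 + (z $ i)\<^sup>2) > 0"
    by (intro prod_pos) (simp add: add_pos_nonneg)
  have Ple: "(\<Prod>i\<in>UNIV. 1 + (z $ i)\<^sup>2) \<le> (1 + (norm z)\<^sup>2) ^ ?k"
  proof -
    have "(\<Prod>i\<in>UNIV. 1 + (z $ i)\<^sup>2) \<le> (\<Prod>i\<in>(UNIV::'k set). 1 + (norm z)\<^sup>2)"
    proof (intro prod_mono conjI)
      fix i show "1 + (z $ i)\<^sup>2 \<le> 1 + (norm z)\<^sup>2"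
        using power_mono[OF component_le_norm_cart[of z i], of 2] by simp
    qed simp
    then show ?thesis by simp
  qed
  have "norm z ^ (?k + 2) * min 1 ((B / norm z) ^ p) * (\<Prod>i\<in>UNIV. 1 + (z $ i)\<^sup>2) \<le> 2 ^ ?k * B ^ p"
  proof (cases "norm z \<le> 1")
    case True
    have "norm z ^ (?k + 2) * min 1 ((B / norm z) ^ p) \<le> 1 * 1"
      using True B by (intro mult_mono power_le_one) auto
    moreover have "(\<Prod>i\<in>UNIV. 1 + (z $ i)\<^sup>2) \<le> 2 ^ ?k"
    proof -
      have "(1 + (norm z)\<^sup>2) ^ ?k \<le> 2 ^ ?k"
        using power_le_one[of "norm z" 2] True by (intro power_mono) auto
      with Ple show ?thesis by linarith
    qed
    moreover have "0 \<le> norm z ^ (?k + 2) * min 1 ((B / norm z) ^ p)" using B by simp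
    ultimately have "norm z ^ (?k + 2) * min 1 ((B / norm z) ^ p) * (\<Prod>i\<in>UNIV. 1 + (z $ i)\<^sup>2) \<le> 1 * 2 ^ ?k"
      using Ppos by (intro mult_mono) auto
    also have "\<dots> \<le> 2 ^ ?k * B ^ p" using B by simp
    finally show ?thesis .
  next
    case False
    then have z: "norm z > 1" by simp
    have "(1 + (norm z)\<^sup>2) ^ ?k \<le> (2 * (norm z)\<^sup>2) ^ ?k"
      using one_le_power[of "norm z" 2] z by (intro power_mono) auto
    then have "(\<Prod>i\<in>UNIV. 1 + (z $ i)\<^sup>2) \<le> 2 ^ ?k * norm z ^ (2 * ?k)"
      using Ple by (simp add: power_mult_distrib power_mult)
    then have "norm z ^ (?k + 2) * min 1 ((B / norm z) ^ p) * (\<Prod>i\<in>UNIV. 1 + (z $ i)\<^sup>2)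
      \<le> norm z ^ (?k + 2) * (B / norm z) ^ p * (2 ^ ?k * norm z ^ (2 * ?k))"
      using Ppos B by (intro mult_mono) auto
    also have "\<dots> = 2 ^ ?k * B ^ p * (norm z ^ (3 * ?k + 2) / norm z ^ p)"
      by (simp add: power_divide power_add[symmetric] field_simps)
    also have "\<dots> \<le> 2 ^ ?k * B ^ p * 1"
    proof -
      have "norm z ^ (3 * ?k + 2) \<le> norm z ^ p" using p z by (intro power_increasing) auto
      moreover have "norm z ^ p > 0" by (rule zero_less_power) (use z in linarith)
      ultimately have "norm z ^ (3 * ?k + 2) / norm z ^ p \<le> 1" by simp
      then show ?thesis using B by (intro mult_left_mono) auto
    qed
    finally show ?thesis by simp
  qed
  then show ?thesis unfolding P using Ppos by (simp add: field_simps)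
qed

text \<open>The ensemble mean couples all members; differences to the zeroth one decouple once that
  member is fixed. Each squared difference is split at \<open>s\<close>; the term of
  \<open>x 0\<close> then occurs up to N times and is itself bounded by the whole sum, hence 2 N +
  2.\<close>

lemma sum_centered_ge_sum_differences:
  fixes x :: "nat \<Rightarrow> real"
  assumes "N > 0"
  shows "(\<Sum>n\<in>{1..<N}. (x n - x 0)\<^sup>2) \<le> (2 * real N + 2) * (\<Sum>n<N. (x n - s)\<^sup>2)"
proof -
  have ab: "(a - b)\<^sup>2 \<le> 2 * (a - s)\<^sup>2 + 2 * (b - s)\<^sup>2" for a b :: real
    using sum_squares_bound[of "a - s" "s - b"] by (simp add: power2_eq_square algebra_simps)
  have x0: "(x 0 - s)\<^sup>2 \<le> (\<Sum>n<N. (x n - s)\<^sup>2)"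
    using assms by (intro member_le_sum) auto
  have "(\<Sum>n\<in>{1..<N}. (x n - x 0)\<^sup>2) \<le> (\<Sum>n\<in>{1..<N}. 2 * (x n - s)\<^sup>2 + 2 * (x 0 - s)\<^sup>2)"
    by (intro sum_mono ab)
  also have "\<dots> \<le> (\<Sum>n<N. 2 * (x n - s)\<^sup>2 + 2 * (x 0 - s)\<^sup>2)"
    by (intro sum_mono2) auto
  also have "\<dots> = 2 * (\<Sum>n<N. (x n - s)\<^sup>2) + 2 * real N * (x 0 - s)\<^sup>2"
    by (simp add: sum.distrib sum_distrib_left)
  also have "\<dots> \<le> 2 * (\<Sum>n<N. (x n - s)\<^sup>2) + 2 * real N * (\<Sum>n<N. (x n - s)\<^sup>2)"
    using x0 by (intro add_left_mono mult_left_mono) auto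
  finally show ?thesis by (simp add: algebra_simps)
qed

text \<open>If the quadratic form were small at the unit vector \<open>z / norm z\<close>, the Gaussian-type integral
  below would pick up a large contribution from a ball far out in that direction.
  This turns an upper bound on the expected integral into one on the expected inverse of the
  smallest eigenvalue.\<close>

definition tilt_integral :: "nat \<Rightarrow> (nat \<Rightarrow> real^'k) \<Rightarrow> ennreal" where
  "tilt_integral N h = (\<integral>\<^sup>+z. ennreal (norm z ^ (CARD('k) + 2) *
     exp (- ((1 / real N) * (\<Sum>n<N. (h n \<bullet> z)\<^sup>2)))) \<partial>lborel)"

text \<open>The reciprocal of a lower bound on the integral over a small ball: \<open>exp 3\<close>
  from the exponential, 2^(k + 2) from \<open>norm z\<close> being at least half the distance of the
  center, 2^k from the radius, and the volume of the unit ball.\<close>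

definition tilt_const :: "'k::finite itself \<Rightarrow> real" where
  "tilt_const _ = exp 3 * 2 ^ (2 * CARD('k) + 2) / unit_ball_vol (real CARD('k))"

lemma tilt_const_pos: "tilt_const TYPE('k::finite) > 0"
  by (simp add: tilt_const_def)

lemma quadratic_form_lower_bound:
  fixes h :: "nat \<Rightarrow> real^'k" and N :: nat
  defines "T \<equiv> 1 + (1 / real N) * (\<Sum>n<N. (norm (h n))\<^sup>2)"
  assumes g: "tilt_integral N h = ennreal g" "g \<ge> 0"
  shows "(norm z)\<^sup>2 / (T + tilt_const TYPE('k) * g) \<le> (1 / real N) * (\<Sum>n<N. (h n \<bullet> z)\<^sup>2)"
proof -
  let ?k = "CARD('k)"
  define q where "q z = (1 / real N) * (\<Sum>n<N. (h n \<bullet> z)\<^sup>2)" for z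
  define lam where "lam = 1 / (T + tilt_const TYPE('k) * g)"
  have T1: "T \<ge> 1" by (simp add: T_def sum_nonneg)
  have Cg: "tilt_const TYPE('k) * g \<ge> 0" using g(2) tilt_const_pos[where 'k='k] by (simp add: less_imp_le)
  have lam: "0 < lam" "lam \<le> 1" using T1 Cg by (auto simp: lam_def)
  have q_nonneg: "q z \<ge> 0" for z by (simp add: q_def sum_nonneg)
  have q_scale: "q (c *\<^sub>R z) = c\<^sup>2 * q z" for c z
    by (simp add: q_def power_mult_distrib sum_distrib_left mult_ac)
  have q_le: "q z \<le> T * (norm z)\<^sup>2" for z
  proof -
    have "(h n \<bullet> z)\<^sup>2 \<le> (norm (h n))\<^sup>2 * (norm z)\<^sup>2" for n
      using Cauchy_Schwarz_ineq[of "h n" z] by (simp add: power2_norm_eq_inner)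
    then have "q z \<le> (1 / real N) * (\<Sum>n<N. (norm (h n))\<^sup>2 * (norm z)\<^sup>2)"
      unfolding q_def by (intro mult_left_mono sum_mono) auto
    also have "\<dots> \<le> T * (norm z)\<^sup>2"
      by (simp add: T_def sum_distrib_right[symmetric] distrib_right)
    finally show ?thesis .
  qed
  have q_add: "q (x + y) \<le> 2 * q x + 2 * q y" for x y
  proof -
    have "(h n \<bullet> (x + y))\<^sup>2 \<le> 2 * (h n \<bullet> x)\<^sup>2 + 2 * (h n \<bullet> y)\<^sup>2" for n
      using sum_squares_bound[of "h n \<bullet> x" "h n \<bullet> y"]
      by (simp add: inner_add_right power2_eq_square algebra_simps)
    then have "q (x + y) \<le> (1 / real N) * (\<Sum>n<N. 2 * (h n \<bullet> x)\<^sup>2 + 2 * (h n \<bullet> y)\<^sup>2)"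
      unfolding q_def by (intro mult_left_mono sum_mono) auto
    also have "\<dots> = 2 * q x + 2 * q y"
      by (simp add: q_def sum.distrib sum_distrib_left algebra_simps add_divide_distrib)
    finally show ?thesis .
  qed
  have unit: "lam \<le> q x" if x: "norm x = 1" for x
  proof (rule ccontr)
    assume "\<not> lam \<le> q x"
    \<comment> \<open>\<open>q x\<close> may be 0, so the scale is built from a positive number
      strictly between \<open>q x\<close> and \<open>lam\<close>; it makes
      \<open>q (s *\<^sub>R x)\<close> at most 1.\<close>
    then obtain q' where q': "q x < q'" "q' < lam" using dense by (metis not_le)
    have q'0: "q' > 0" using q' q_nonneg[of x] by linarith
    define s t where "s = 1 / sqrt q'" and "t = sqrt T"
    have s2: "s\<^sup>2 = 1 / q'" using q'0 by (simp add: s_def power_divide)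
    have t1: "t \<ge> 1" using T1 by (simp add: t_def)
    have t2: "t\<^sup>2 = T" using T1 by (simp add: t_def)
    have s_gt: "T + tilt_const TYPE('k) * g < s\<^sup>2"
    proof -
      have "1 / lam < 1 / q'" using q' q'0 by (intro divide_strict_left_mono) auto
      then show ?thesis by (simp add: s2 lam_def)
    qed
    have s0: "s > 0" using q'0 by (simp add: s_def)
    have st: "t \<le> s"
      by (rule power2_le_imp_le) (use s_gt Cg s0 t2 in auto)
    \<comment> \<open>\<open>T\<close> bounds \<open>q\<close> on unit vectors, so on this ball
      \<open>q\<close> of the offset is at most 1/4. Then \<open>q z\<close> is at most 2 + 1/2,
      below the 3 in \<open>m\<close>.\<close>
    define \<rho> where "\<rho> = 1 / (2 * t)"
    have \<rho>: "\<rho> > 0" "\<rho> \<le> 1 / 2" using t1 by (auto simp: \<rho>_def field_simps)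
    have s1: "s \<ge> 1" using st t1 by linarith
    define m where "m = (s / 2) ^ (?k + 2) * exp (- 3)"
    have m0: "m \<ge> 0" using s0 by (simp add: m_def)
    have low: "ennreal m * indicator (ball (s *\<^sub>R x) \<rho>) z
        \<le> ennreal (norm z ^ (?k + 2) * exp (- q z))" for z
    proof (cases "z \<in> ball (s *\<^sub>R x) \<rho>")
      case True
      then have d: "norm (z - s *\<^sub>R x) < \<rho>" by (simp add: dist_norm norm_minus_commute)
      have "s = norm (s *\<^sub>R x)" using x s0 by simp
      also have "\<dots> \<le> norm z + norm (z - s *\<^sub>R x)"
        by (metis norm_minus_commute norm_triangle_sub)
      finally have nz: "s / 2 \<le> norm z" using d \<rho> s1 by linarith
      have "q z \<le> 2 * q (s *\<^sub>R x) + 2 * q (z - s *\<^sub>R x)"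
        using q_add[of "s *\<^sub>R x" "z - s *\<^sub>R x"] by simp
      moreover have "q (s *\<^sub>R x) \<le> 1"
        using q' q'0 by (simp add: q_scale s2 field_simps)
      moreover have "q (z - s *\<^sub>R x) \<le> T * \<rho>\<^sup>2"
        using q_le[of "z - s *\<^sub>R x"] d T1
        by (meson less_imp_le mult_left_mono norm_ge_zero order_trans power_mono zero_le_one)
      moreover have "T * \<rho>\<^sup>2 = 1 / 4"
        using t1 by (simp add: \<rho>_def power_divide power_mult_distrib flip: t2)
      ultimately have "q z \<le> 3" by linarith
      then have "m \<le> norm z ^ (?k + 2) * exp (- q z)"
        unfolding m_def using nz s0 by (intro mult_mono power_mono) auto
      then show ?thesis using True by (simp add: ennreal_leI)
    qed simp
    have "ennreal (m * (unit_ball_vol (real ?k) * \<rho> ^ ?k))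
        = (\<integral>\<^sup>+z. ennreal m * indicator (ball (s *\<^sub>R x) \<rho>) z \<partial>lborel)"
      using \<rho> m0 by (simp add: nn_integral_cmult_indicator emeasure_ball ennreal_mult')
    also have "\<dots> \<le> tilt_integral N h"
      unfolding tilt_integral_def q_def[symmetric] by (intro nn_integral_mono low)
    finally have "m * (unit_ball_vol (real ?k) * \<rho> ^ ?k) \<le> g"
      using g by (simp add: ennreal_le_iff)
    moreover have "m * (unit_ball_vol (real ?k) * \<rho> ^ ?k)
        = s\<^sup>2 * (s / t) ^ ?k / tilt_const TYPE('k)"
    proof -
      have "m = (s ^ ?k / 2 ^ ?k) * (s\<^sup>2 / 4) / exp 3"
        unfolding m_def power_add power_divide exp_minus by (simp add: inverse_eq_divide)
      moreover have "\<rho> ^ ?k = 1 / (2 ^ ?k * t ^ ?k)"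
        by (simp add: \<rho>_def power_divide power_mult_distrib)
      moreover have "tilt_const TYPE('k) = exp 3 * (2 ^ ?k * 2 ^ ?k * 4) / unit_ball_vol (real ?k)"
        unfolding tilt_const_def mult_2 power_add by simp
      moreover have "(a / p) * (b / 4) / e * (w * (1 / (p * d))) = b * (a / d) / (e * (p * p * 4) / w)"
        if "p > 0" "e > 0" "w > 0" "d > 0" for a b d e p w :: real
        using that by (simp add: divide_simps)
      moreover have "unit_ball_vol (real ?k) > 0" "t ^ ?k > 0" using t1 by simp_all
      ultimately show ?thesis by (simp only: power_divide) simp
    qed
    \<comment> \<open>This explains the degree k + 2 of the weight: k powers of \<open>s\<close>
      outweigh the factor t^-k from the volume of the ball, since s >= t, and the two that remain
      are s^2 = 1 / q'.\<close>
    moreover have "s\<^sup>2 / tilt_const TYPE('k) \<le> s\<^sup>2 * (s / t) ^ ?k / tilt_const TYPE('k)"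
    proof (rule divide_right_mono)
      have "s\<^sup>2 * 1 \<le> s\<^sup>2 * (s / t) ^ ?k"
        using st t1 by (intro mult_left_mono one_le_power) auto
      then show "s\<^sup>2 \<le> s\<^sup>2 * (s / t) ^ ?k" by simp
    qed (simp add: tilt_const_pos less_imp_le)
    ultimately have "s\<^sup>2 / tilt_const TYPE('k) \<le> g" by simp
    then have "s\<^sup>2 \<le> tilt_const TYPE('k) * g"
      using tilt_const_pos[where 'k='k] by (simp add: field_simps)
    then show False using s_gt T1 by linarith
  qed
  have "lam * (norm z)\<^sup>2 \<le> q z"
  proof (cases "z = 0")
    case False
    have "z = norm z *\<^sub>R ((1 / norm z) *\<^sub>R z)" using False by simp
    then have "q z = (norm z)\<^sup>2 * q ((1 / norm z) *\<^sub>R z)" by (metis q_scale)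
    moreover have "lam \<le> q ((1 / norm z) *\<^sub>R z)" by (rule unit) (use False in simp)
    ultimately show ?thesis by (simp add: mult.commute[of lam] mult_left_mono)
  qed (simp add: q_nonneg)
  then show ?thesis by (simp add: lam_def q_def)
qed

subsection \<open>Gaussian noise\<close>

lemma nn_integral_normal_law:
  assumes "var > 0" and [measurable]: "f \<in> borel_measurable borel"
  shows "(\<integral>\<^sup>+x. f x \<partial>normal_law \<mu> var)
    = (\<integral>\<^sup>+x. ennreal (normal_density \<mu> (sqrt var) x) * f x \<partial>lborel)"
  using assms(1) by (simp add: normal_law_def nn_integral_density)

text \<open>The normal density is at most 1 / sqrt (2 pi var), and the other factor is an
  unnormalized normal density of variance 1 / (2 c) centered at \<open>s\<close>. Hence the bound is
  uniform in \<open>s\<close>.\<close>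

lemma normal_law_small_ball:
  assumes "var > 0" "c > 0"
  shows "(\<integral>\<^sup>+x. ennreal (exp (- (c * (x - s)\<^sup>2))) \<partial>normal_law 0 var) \<le> ennreal (1 / sqrt (2 * c * var))"
proof -
  define \<tau> where "\<tau> = 1 / sqrt (2 * c)"
  have \<tau>: "\<tau> > 0" "\<tau>\<^sup>2 = 1 / (2 * c)" using assms(2) by (simp_all add: \<tau>_def power_divide)
  define d where "d = 1 / sqrt (2 * c * var)"
  have le: "normal_density 0 (sqrt var) x * exp (- (c * (x - s)\<^sup>2)) \<le> d * normal_density s \<tau> x" for x
  proof -
    have "normal_density s \<tau> x = sqrt (c / pi) * exp (- (c * (x - s)\<^sup>2))"
      using assms(2) by (simp add: normal_density_def \<tau>(2) real_sqrt_divide field_simps)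
    moreover have "normal_density 0 (sqrt var) x \<le> 1 / sqrt (2 * pi * var)"
      using assms(1) by (simp add: normal_density_def divide_right_mono)
    moreover have "d * sqrt (c / pi) = 1 / sqrt (2 * pi * var) "
    proof -
      have "sqrt (2 * c * var) = sqrt 2 * sqrt c * sqrt var" "sqrt (2 * pi * var) = sqrt 2 * sqrt pi * sqrt var"
        by (simp_all add: real_sqrt_mult)
      then show ?thesis using assms by (simp add: d_def real_sqrt_divide field_simps)
    qed
    ultimately show ?thesis
      by (metis mult.assoc mult_right_mono exp_ge_zero)
  qed
  have "(\<integral>\<^sup>+x. ennreal (exp (- (c * (x - s)\<^sup>2))) \<partial>normal_law 0 var)
     = (\<integral>\<^sup>+x. ennreal (normal_density 0 (sqrt var) x) * ennreal (exp (- (c * (x - s)\<^sup>2))) \<partial>lborel)"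
    by (rule nn_integral_normal_law[OF assms(1)]) simp
  also have "\<dots> \<le> (\<integral>\<^sup>+x. ennreal d * ennreal (normal_density s \<tau> x) \<partial>lborel)"
  proof (rule nn_integral_mono)
    fix x
    have "d \<ge> 0" using assms by (simp add: d_def)
    then show "ennreal (normal_density 0 (sqrt var) x) * ennreal (exp (- (c * (x - s)\<^sup>2)))
      \<le> ennreal d * ennreal (normal_density s \<tau> x)"
      using le[of x] by (simp add: ennreal_mult[symmetric] ennreal_leI)
  qed
  also have "\<dots> = ennreal d * (\<integral>\<^sup>+x. ennreal (normal_density s \<tau> x) \<partial>lborel)"
    by (rule nn_integral_cmult) simp
  also have "(\<integral>\<^sup>+x. ennreal (normal_density s \<tau> x) \<partial>lborel) = 1"
    using \<tau>(1) by (subst nn_integral_eq_integral) auto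
  finally show ?thesis by (simp add: d_def)
qed

lemma normal_law_second_moment:
  assumes "var \<ge> 0"
  shows "(\<integral>\<^sup>+x. ennreal (x\<^sup>2) \<partial>normal_law 0 var) = ennreal var"
proof (cases "var = 0")
  case True
  then show ?thesis by (simp add: normal_law_def nn_integral_return)
next
  case False
  with assms have var: "var > 0" by simp
  have "(\<integral>\<^sup>+x. ennreal (x\<^sup>2) \<partial>normal_law 0 var)
     = (\<integral>\<^sup>+x. ennreal (normal_density 0 (sqrt var) x) * ennreal (x\<^sup>2) \<partial>lborel)"
    by (rule nn_integral_normal_law[OF var]) simp
  also have "\<dots> = (\<integral>\<^sup>+x. ennreal (normal_density 0 (sqrt var) x * (x - 0)^(2 * 1)) \<partial>lborel)"
    by (intro nn_integral_cong) (simp add: ennreal_mult)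
  also have "\<dots> = ennreal var"
    using normal_moment_even[of "sqrt var" 0 1] var
    by (subst nn_integral_eq_integral) (auto simp: has_bochner_integral_iff)
  finally show ?thesis .
qed

lemma Int_stable_events_of:
  fixes X :: "'a \<Rightarrow> 'b::topological_space"
  shows "Int_stable (events_of M X)"
  unfolding Int_stable_def events_of_def
proof safe
  fix A B assume "A \<in> sets (borel :: 'b measure)" "B \<in> sets (borel :: 'b measure)"
  then show "\<exists>C. X -` A \<inter> space M \<inter> (X -` B \<inter> space M) = X -` C \<inter> space M \<and> C \<in> sets borel"
    by (intro exI[of _ "A \<inter> B"]) auto
qed

section \<open>Integrating out independent noise\<close>

context prob_space
begin

text \<open>This plays the role of conditioning on \<open>G\<close>: under the product law, Fubini
  freezes \<open>Y\<close> and \<open>W\<close>, and a bound that is uniform in the shift factors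
  out.\<close>

lemma nn_integral_shift_indep:
  fixes X Y :: "'a \<Rightarrow> real" and W :: "'a \<Rightarrow> ennreal"
  assumes [measurable]: "X \<in> borel_measurable M" "f \<in> borel_measurable borel"
    and G: "subalgebra M G"
    and indep: "indep_set (events_of M X) (sets G)"
    and YG: "Y \<in> borel_measurable G" and WG: "W \<in> borel_measurable G"
    and bound: "\<And>s. (\<integral>\<^sup>+x. f (x - s) \<partial>distr M borel X) \<le> K"
  shows "(\<integral>\<^sup>+\<omega>. W \<omega> * f (X \<omega> - Y \<omega>) \<partial>M) \<le> K * (\<integral>\<^sup>+\<omega>. W \<omega> \<partial>M)"
proof -
  have [measurable]: "Y \<in> borel_measurable M" "W \<in> borel_measurable M"
    using measurable_from_subalg[OF G] YG WG by auto
  let ?B = "borel \<Otimes>\<^sub>M borel :: (real \<times> ennreal) measure"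
  have YW: "(\<lambda>\<omega>. (Y \<omega>, W \<omega>)) \<in> measurable G ?B" using YG WG by simp
  have spG: "space G = space M" using G by (simp add: subalgebra_def)
  \<comment> \<open>\<open>indep_var\<close> relates two variables with values in one type, so
    \<open>X\<close> is padded with a constant to match the pair of \<open>Y\<close> and
    \<open>W\<close>.\<close>
  define X' where "X' \<omega> = (X \<omega>, 0::ennreal)" for \<omega>
  have [measurable]: "X' \<in> measurable M ?B" by (simp add: X'_def[abs_def])
  have "indep_var ?B X' ?B (\<lambda>\<omega>. (Y \<omega>, W \<omega>))"
    unfolding indep_var_eq
  proof (intro conjI)
    have "indep_set (sigma_sets (space M) (events_of M X)) (sigma_sets (space M) (sets G))"
    proof (rule indep_set_sigma_sets[OF indep])
      show "Int_stable (events_of M X)" by (rule Int_stable_events_of)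
      show "Int_stable (sets G)" by (auto simp: Int_stable_def)
    qed
    moreover have "sigma_sets (space M) {(\<lambda>\<omega>. (Y \<omega>, W \<omega>)) -` A \<inter> space M |A. A \<in> sets ?B}
        \<subseteq> sigma_sets (space M) (sets G)"
      using measurable_sets[OF YW] by (intro sigma_sets_mono') (auto simp: spG)
    moreover have "sigma_sets (space M) {X' -` A \<inter> space M |A. A \<in> sets ?B}
        \<subseteq> sigma_sets (space M) (events_of M X)"
    proof (intro sigma_sets_mono', safe)
      fix A assume A: "A \<in> sets ?B"
      have "(\<lambda>x::real. (x, 0::ennreal)) \<in> measurable borel ?B" by simp
      from measurable_sets[OF this A] have "(\<lambda>x. (x, 0)) -` A \<in> sets borel" by simp
      then show "X' -` A \<inter> space M \<in> events_of M X"
        unfolding events_of_def X'_def by (intro CollectI exI[of _ "(\<lambda>x. (x, 0)) -` A"]) auto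
    qed
    ultimately show "indep_set (sigma_sets (space M) {X' -` A \<inter> space M |A. A \<in> sets ?B})
        (sigma_sets (space M) {(\<lambda>\<omega>. (Y \<omega>, W \<omega>)) -` A \<inter> space M |A. A \<in> sets ?B})"
      unfolding indep_sets2_eq by blast
  qed simp_all
  then have prod: "distr M ?B X' \<Otimes>\<^sub>M distr M ?B (\<lambda>\<omega>. (Y \<omega>, W \<omega>))
      = distr M (?B \<Otimes>\<^sub>M ?B) (\<lambda>\<omega>. (X' \<omega>, Y \<omega>, W \<omega>))"
    by (simp add: indep_var_distribution_eq)
  interpret P1: prob_space "distr M ?B X'" by (rule prob_space_distr) simp
  interpret P2: prob_space "distr M ?B (\<lambda>\<omega>. (Y \<omega>, W \<omega>))" by (rule prob_space_distr) simp
  interpret P: pair_sigma_finite "distr M ?B X'" "distr M ?B (\<lambda>\<omega>. (Y \<omega>, W \<omega>))" ..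
  have bound': "(\<integral>\<^sup>+x. f (fst x - s) \<partial>distr M ?B X') \<le> K" for s
    using bound[of s] by (simp add: nn_integral_distr X'_def)
  have "(\<integral>\<^sup>+\<omega>. W \<omega> * f (X \<omega> - Y \<omega>) \<partial>M)
      = (\<integral>\<^sup>+p. snd (snd p) * f (fst (fst p) - fst (snd p)) \<partial>distr M (?B \<Otimes>\<^sub>M ?B) (\<lambda>\<omega>. (X' \<omega>, Y \<omega>, W \<omega>)))"
    by (subst nn_integral_distr) (simp_all add: X'_def)
  also have "\<dots> = (\<integral>\<^sup>+q. \<integral>\<^sup>+x. snd q * f (fst x - fst q) \<partial>distr M ?B X' \<partial>distr M ?B (\<lambda>\<omega>. (Y \<omega>, W \<omega>)))"
    unfolding prod[symmetric] by (subst P.nn_integral_snd[symmetric]) simp_all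
  also have "\<dots> = (\<integral>\<^sup>+q. snd q * (\<integral>\<^sup>+x. f (fst x - fst q) \<partial>distr M ?B X') \<partial>distr M ?B (\<lambda>\<omega>. (Y \<omega>, W \<omega>)))"
    by (intro nn_integral_cong nn_integral_cmult) simp
  also have "\<dots> \<le> (\<integral>\<^sup>+q. snd q * K \<partial>distr M ?B (\<lambda>\<omega>. (Y \<omega>, W \<omega>)))"
    by (intro nn_integral_mono mult_left_mono bound') simp
  also have "\<dots> = (\<integral>\<^sup>+\<omega>. W \<omega> * K \<partial>M)"
    by (subst nn_integral_distr) simp_all
  also have "\<dots> = K * (\<integral>\<^sup>+\<omega>. W \<omega> \<partial>M)"
    by (simp only: mult.commute[of _ K]) (rule nn_integral_cmult, simp)
  finally show ?thesis .
qed

end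

lemma events_of_comp_subset:
  assumes "f \<in> borel_measurable borel"
  shows "events_of M (\<lambda>\<omega>. f (X \<omega>)) \<subseteq> events_of M X"
proof
  fix E assume "E \<in> events_of M (\<lambda>\<omega>. f (X \<omega>))"
  then obtain A where "A \<in> sets borel" and E: "E = (\<lambda>\<omega>. f (X \<omega>)) -` A \<inter> space M"
    by (auto simp: events_of_def)
  then have "f -` A \<in> sets borel" using measurable_sets[OF assms] by simp
  moreover have "E = X -` (f -` A) \<inter> space M" by (auto simp: E)
  ultimately show "E \<in> events_of M X" by (auto simp: events_of_def)
qed

lemma borel_measurable_events_of:
  assumes "space G = space M" "events_of M X \<subseteq> sets G"
  shows "X \<in> borel_measurable G"
  using assms by (intro measurableI) (auto simp: events_of_def)

text \<open>The factor relating the ensemble covariance form to the sum of squared differences: 1 /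
  N from the covariance, and 2 N + 2 from \<open>sum_centered_ge_sum_differences\<close>.\<close>

definition pair_const :: "nat \<Rightarrow> real" where
  "pair_const N = 1 / (real N * (2 * real N + 2))"

text \<open>The integral is finite by \<open>nn_integral_prod_Cauchy\<close>, so
  \<open>enn2real\<close> loses nothing. Only the dimension, the inflation and the ensemble size
  enter.\<close>

definition tilt_bound :: "'k::finite itself \<Rightarrow> real \<Rightarrow> nat \<Rightarrow> real" where
  "tilt_bound _ a N = 2 ^ CARD('k) * (max 1 (1 / sqrt (2 * pair_const N * a))) ^ (N - 1) *
     enn2real (\<integral>\<^sup>+z. ennreal (\<Prod>i\<in>UNIV. inverse (1 + (z $ i)\<^sup>2)) \<partial>(lborel :: (real^'k) measure))"

context prob_space
begin

text \<open>Only the one-dimensional marginals of the noise enter: conditionally on the past and on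
  the zeroth member, the differences of the other members to it are independent with bounded
  densities, however they are shifted.\<close>

lemma nn_integral_prod_differences_le:
  fixes \<xi> g :: "nat \<Rightarrow> 'a \<Rightarrow> real^'k"
  assumes indep: "indep_sets (\<lambda>i. if i < N then events_of M (\<xi> i) else sets F) ({..<N} \<union> {Suc N})"
    and F: "subalgebra M F"
    and [measurable]: "\<And>n. n < N \<Longrightarrow> \<xi> n \<in> borel_measurable M"
    and g: "\<And>n. n < N \<Longrightarrow> g n \<in> borel_measurable F"
    and law: "\<And>n z. n < N \<Longrightarrow> distr M borel (\<lambda>\<omega>. \<xi> n \<omega> \<bullet> z) = normal_law 0 (a * (norm z)\<^sup>2)"
    and "a > 0" "c > 0" "z \<noteq> 0"
  shows "m < N \<Longrightarrow> (\<integral>\<^sup>+\<omega>. (\<Prod>n\<in>{1..m}.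
      ennreal (exp (- (c * ((g n \<omega> + \<xi> n \<omega>) \<bullet> z - (g 0 \<omega> + \<xi> 0 \<omega>) \<bullet> z)\<^sup>2)))) \<partial>M)
    \<le> ennreal (1 / sqrt (2 * c * (a * (norm z)\<^sup>2))) ^ m"
proof (induction m)
  case 0
  then show ?case by (simp add: emeasure_space_1)
next
  case (Suc m)
  let ?K = "ennreal (1 / sqrt (2 * c * (a * (norm z)\<^sup>2)))"
  let ?E = "\<lambda>i. if i < N then events_of M (\<xi> i) else sets F"
  let ?I = "\<lambda>b. if b then {Suc m} else {..m} \<union> {Suc N}"
  \<comment> \<open>\<open>G\<close> is generated by the past and by the noises 0 to m, on which the
    first m factors depend. The past has the index \<open>Suc N\<close> because a run reserves the
    index \<open>N\<close> for the observation noise.\<close>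
  define G where "G = sigma (space M) (\<Union>i\<in>{..m} \<union> {Suc N}. ?E i)"
  define X where "X \<omega> = \<xi> (Suc m) \<omega> \<bullet> z" for \<omega>
  \<comment> \<open>The shift collects the zeroth member, noise included, and the drift of the new
    member; all of it is known to \<open>G\<close>, so the new factor costs one density
    bound.\<close>
  define Y where "Y \<omega> = (g 0 \<omega> + \<xi> 0 \<omega>) \<bullet> z - g (Suc m) \<omega> \<bullet> z" for \<omega>
  define W where "W \<omega> = (\<Prod>n\<in>{1..m}.
      ennreal (exp (- (c * ((g n \<omega> + \<xi> n \<omega>) \<bullet> z - (g 0 \<omega> + \<xi> 0 \<omega>) \<bullet> z)\<^sup>2))))" for \<omega>
  have ev: "?E i \<subseteq> events" if "i \<in> {..<N} \<union> {Suc N}" for i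
    using indep that unfolding indep_sets_def by blast
  have ev2: "(\<Union>i\<in>{..m} \<union> {Suc N}. ?E i) \<subseteq> events"
  proof (rule UN_least)
    fix i assume "i \<in> {..m} \<union> {Suc N}"
    then show "?E i \<subseteq> events" using Suc.prems by (intro ev) auto
  qed
  then have "(\<Union>i\<in>{..m} \<union> {Suc N}. ?E i) \<subseteq> Pow (space M)"
    using sets.space_closed by (rule order_trans)
  then have spG: "space G = space M"
    and setsG: "sets G = sigma_sets (space M) (\<Union>i\<in>{..m} \<union> {Suc N}. ?E i)"
    unfolding G_def by (simp_all only: space_measure_of sets_measure_of)
  have subG: "subalgebra M G"
    unfolding subalgebra_def spG setsG using sets.sigma_sets_subset[OF ev2] by simp
  have basic: "?E i \<subseteq> sets G" if "i \<in> {..m} \<union> {Suc N}" for i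
    unfolding setsG using that by (intro subsetI sigma_sets.Basic) blast
  have gG: "g n \<in> borel_measurable G" if "n < N" for n
  proof (rule measurable_from_subalg[OF _ g[OF that]])
    show "subalgebra G F" using F basic[of "Suc N"] by (simp add: subalgebra_def spG)
  qed
  have \<xi>G: "\<xi> n \<in> borel_measurable G" if "n \<le> m" for n
    using basic[of n] that Suc.prems by (intro borel_measurable_events_of[OF spG]) auto
  have "Suc m < N" "0 < N" "m < N" using Suc.prems by auto
  have xG: "(\<lambda>\<omega>. (g n \<omega> + \<xi> n \<omega>) \<bullet> z) \<in> borel_measurable G" if "n \<le> m" for n
  proof -
    have [measurable]: "g n \<in> borel_measurable G" "\<xi> n \<in> borel_measurable G"
      using gG[of n] \<xi>G[OF that] that Suc.prems by simp_all
    show ?thesis by measurable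
  qed
  have YG: "Y \<in> borel_measurable G"
  proof -
    have [measurable]: "(\<lambda>\<omega>. (g 0 \<omega> + \<xi> 0 \<omega>) \<bullet> z) \<in> borel_measurable G" "g (Suc m) \<in> borel_measurable G"
      using xG[of 0] gG[OF \<open>Suc m < N\<close>] by simp_all
    show ?thesis unfolding Y_def[abs_def] by measurable
  qed
  have WG: "W \<in> borel_measurable G"
    unfolding W_def
  proof (rule borel_measurable_prod_ennreal)
    fix n assume "n \<in> {1..m}"
    then have [measurable]: "(\<lambda>\<omega>. (g n \<omega> + \<xi> n \<omega>) \<bullet> z) \<in> borel_measurable G"
        "(\<lambda>\<omega>. (g 0 \<omega> + \<xi> 0 \<omega>) \<bullet> z) \<in> borel_measurable G"
      using xG[of n] xG[of 0] by auto
    show "(\<lambda>\<omega>. ennreal (exp (- (c * ((g n \<omega> + \<xi> n \<omega>) \<bullet> z - (g 0 \<omega> + \<xi> 0 \<omega>) \<bullet> z)\<^sup>2)))) \<in> borel_measurable G"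
      by measurable
  qed
  have indep2: "indep_set (events_of M X) (sets G)"
  proof -
    have "indep_sets (\<lambda>j. sigma_sets (space M) (\<Union>i\<in>?I j. ?E i)) UNIV"
    proof (rule indep_sets_collect_sigma)
      show "indep_sets ?E (\<Union>j\<in>UNIV. ?I j)"
        by (rule indep_sets_mono_index[OF _ indep]) (use Suc.prems in \<open>auto split: if_splits\<close>)
      show "Int_stable (?E i)" for i
        using Int_stable_events_of[of M "\<xi> i"] by (auto simp: Int_stable_def)
      show "disjoint_family_on ?I UNIV"
        using Suc.prems by (auto simp: disjoint_family_on_def)
    qed
    then show ?thesis unfolding indep_set_def
    proof (rule indep_sets_mono_sets)
      fix j :: bool
      show "(case j of True \<Rightarrow> events_of M X | False \<Rightarrow> sets G) \<subseteq> sigma_sets (space M) (\<Union>i\<in>?I j. ?E i)"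
      proof (cases j)
        case True
        have "events_of M X \<subseteq> events_of M (\<xi> (Suc m))"
          unfolding X_def by (rule events_of_comp_subset) simp
        then show ?thesis using True Suc.prems by (auto intro!: sigma_sets.Basic)
      qed (simp add: setsG)
    qed
  qed
  have K: "(\<integral>\<^sup>+x. ennreal (exp (- (c * (x - s)\<^sup>2))) \<partial>distr M borel X) \<le> ?K" for s
    unfolding X_def law[OF \<open>Suc m < N\<close>]
    by (rule normal_law_small_ball) (use assms(6-8) in auto)
  have "(\<integral>\<^sup>+\<omega>. W \<omega> * ennreal (exp (- (c * (X \<omega> - Y \<omega>)\<^sup>2))) \<partial>M) \<le> ?K * (\<integral>\<^sup>+\<omega>. W \<omega> \<partial>M)"
  proof (rule nn_integral_shift_indep[OF _ _ subG indep2 YG WG, where f="\<lambda>x. ennreal (exp (- (c * x\<^sup>2)))"])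
    show "X \<in> borel_measurable M" using \<open>Suc m < N\<close> by (simp add: X_def[abs_def])
  qed (simp_all add: K)
  also have "\<dots> \<le> ?K * ?K ^ m"
    using Suc.IH[OF \<open>m < N\<close>] by (intro mult_left_mono) (simp_all add: W_def)
  finally have "(\<integral>\<^sup>+\<omega>. W \<omega> * ennreal (exp (- (c * (X \<omega> - Y \<omega>)\<^sup>2))) \<partial>M) \<le> ?K ^ Suc m" by simp
  moreover have "(\<Prod>n\<in>{1..Suc m}.
      ennreal (exp (- (c * ((g n \<omega> + \<xi> n \<omega>) \<bullet> z - (g 0 \<omega> + \<xi> 0 \<omega>) \<bullet> z)\<^sup>2))))
    = W \<omega> * ennreal (exp (- (c * (X \<omega> - Y \<omega>)\<^sup>2)))" for \<omega>
  proof -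
    have "(g (Suc m) \<omega> + \<xi> (Suc m) \<omega>) \<bullet> z - (g 0 \<omega> + \<xi> 0 \<omega>) \<bullet> z = X \<omega> - Y \<omega>"
      by (simp add: X_def Y_def inner_add_left)
    then show ?thesis by (simp add: W_def)
  qed
  ultimately show ?case by simp
qed

text \<open>Tonelli moves the expectation inside. For fixed \<open>z\<close>, the N - 1 differences
  yield decay of order N - 1, and the trivial bound 1 serves near the origin; the product of Cauchy
  factors dominates the result.\<close>

lemma expected_tilt_integral:
  fixes \<xi> g :: "nat \<Rightarrow> 'a \<Rightarrow> real^'k"
  assumes indep: "indep_sets (\<lambda>i. if i < N then events_of M (\<xi> i) else sets F) ({..<N} \<union> {Suc N})"
    and F: "subalgebra M F"
    and \<xi>: "\<And>n. n < N \<Longrightarrow> \<xi> n \<in> borel_measurable M"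
    and g: "\<And>n. n < N \<Longrightarrow> g n \<in> borel_measurable F"
    and law: "\<And>n z. n < N \<Longrightarrow> distr M borel (\<lambda>\<omega>. \<xi> n \<omega> \<bullet> z) = normal_law 0 (a * (norm z)\<^sup>2)"
    and a: "a > 0" and N: "N \<ge> 6 * CARD('k)"
  shows "(\<integral>\<^sup>+\<omega>. tilt_integral N (\<lambda>n. g n \<omega> + \<xi> n \<omega> - ens_mean N (\<lambda>n. g n \<omega> + \<xi> n \<omega>)) \<partial>M)
    \<le> ennreal (tilt_bound TYPE('k) a N)"
    and "(\<lambda>\<omega>. tilt_integral N (\<lambda>n. g n \<omega> + \<xi> n \<omega> - ens_mean N (\<lambda>n. g n \<omega> + \<xi> n \<omega>)))
      \<in> borel_measurable M"
proof -
  let ?k = "CARD('k)"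
  \<comment> \<open>The members are set to 0 from \<open>N\<close> on, which makes
    \<open>x n\<close> measurable for every \<open>n\<close>.\<close>
  define x where "x n \<omega> = (if n < N then g n \<omega> + \<xi> n \<omega> else 0)" for n \<omega>
  define h where "h n \<omega> = x n \<omega> - ens_mean N (\<lambda>n. x n \<omega>)" for n \<omega>
  define c where "c = pair_const N"
  \<comment> \<open>The maximum with 1 meets the hypothesis of
    \<open>weight_le_prod_Cauchy\<close>.\<close>
  define B where "B = max 1 (1 / sqrt (2 * c * a))"
  have k: "?k \<ge> 1" by (simp add: Suc_leI)
  have N0: "N > 0" and p: "3 * ?k + 2 \<le> N - 1" using N k by linarith+
  have c: "c > 0" using N0 by (simp add: c_def pair_const_def)
  have [measurable]: "x n \<in> borel_measurable M" for n
    using measurable_from_subalg[OF F g] \<xi> by (cases "n < N") (simp_all add: x_def[abs_def])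
  have hM [measurable]: "h n \<in> borel_measurable M" for n
    unfolding h_def[abs_def] ens_mean_def by measurable
  have tilt_eq: "tilt_integral N (\<lambda>n. g n \<omega> + \<xi> n \<omega> - ens_mean N (\<lambda>n. g n \<omega> + \<xi> n \<omega>))
      = tilt_integral N (\<lambda>n. h n \<omega>)" for \<omega>
    unfolding tilt_integral_def h_def ens_mean_def x_def by (simp cong: sum.cong_simp)
  have joint: "(\<lambda>(\<omega>, z). ennreal (norm z ^ (?k + 2) * exp (- ((1 / real N) * (\<Sum>n<N. (h n \<omega> \<bullet> z)\<^sup>2)))))
      \<in> borel_measurable (M \<Otimes>\<^sub>M lborel)"
    by measurable
  interpret L: pair_sigma_finite M "lborel :: (real^'k) measure" ..
  show "(\<lambda>\<omega>. tilt_integral N (\<lambda>n. g n \<omega> + \<xi> n \<omega> - ens_mean N (\<lambda>n. g n \<omega> + \<xi> n \<omega>)))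
      \<in> borel_measurable M"
    unfolding tilt_eq unfolding tilt_integral_def
    using lborel.borel_measurable_nn_integral_fst[OF joint] by simp
  have exp_bound: "(\<integral>\<^sup>+\<omega>. ennreal (exp (- ((1 / real N) * (\<Sum>n<N. (h n \<omega> \<bullet> z)\<^sup>2)))) \<partial>M)
      \<le> ennreal (min 1 ((B / norm z) ^ (N - 1)))" (is "?lhs \<le> _") if z: "z \<noteq> 0" for z
  proof -
    have "?lhs \<le> (\<integral>\<^sup>+\<omega>. 1 \<partial>M)"
      by (intro nn_integral_mono) (simp add: sum_nonneg ennreal_le_1)
    then have 1: "?lhs \<le> ennreal 1" by (simp add: emeasure_space_1)
    have pt: "ennreal (exp (- ((1 / real N) * (\<Sum>n<N. (h n \<omega> \<bullet> z)\<^sup>2))))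
        \<le> (\<Prod>n\<in>{1..N-1}. ennreal (exp (- (c * ((g n \<omega> + \<xi> n \<omega>) \<bullet> z - (g 0 \<omega> + \<xi> 0 \<omega>) \<bullet> z)\<^sup>2))))"
      for \<omega>
    proof -
      have "(\<Sum>n\<in>{1..<N}. (x n \<omega> \<bullet> z - x 0 \<omega> \<bullet> z)\<^sup>2)
          \<le> (2 * real N + 2) * (\<Sum>n<N. (x n \<omega> \<bullet> z - ens_mean N (\<lambda>n. x n \<omega>) \<bullet> z)\<^sup>2)"
        by (rule sum_centered_ge_sum_differences[OF N0])
      then have "c * (\<Sum>n\<in>{1..<N}. (x n \<omega> \<bullet> z - x 0 \<omega> \<bullet> z)\<^sup>2) \<le> (1 / real N) * (\<Sum>n<N. (h n \<omega> \<bullet> z)\<^sup>2)"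
        using N0 by (simp add: c_def pair_const_def h_def inner_diff_left divide_simps)
           (simp add: mult_ac)
      then have "exp (- ((1 / real N) * (\<Sum>n<N. (h n \<omega> \<bullet> z)\<^sup>2)))
          \<le> exp (- (c * (\<Sum>n\<in>{1..<N}. (x n \<omega> \<bullet> z - x 0 \<omega> \<bullet> z)\<^sup>2)))" by simp
      also have "\<dots> = (\<Prod>n\<in>{1..<N}. exp (- (c * (x n \<omega> \<bullet> z - x 0 \<omega> \<bullet> z)\<^sup>2)))"
        by (simp add: sum_distrib_left sum_negf[symmetric] exp_sum)
      also have "\<dots> = (\<Prod>n\<in>{1..N-1}. exp (- (c * ((g n \<omega> + \<xi> n \<omega>) \<bullet> z - (g 0 \<omega> + \<xi> 0 \<omega>) \<bullet> z)\<^sup>2)))"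
        using N0 by (intro prod.cong) (auto simp: x_def)
      finally show ?thesis by (subst prod_ennreal) (simp_all add: ennreal_leI)
    qed
    have "?lhs \<le> ennreal (1 / sqrt (2 * c * (a * (norm z)\<^sup>2))) ^ (N - 1)"
      by (intro order_trans[OF nn_integral_mono[OF pt]]
          nn_integral_prod_differences_le[OF indep F \<xi> g law a c z]) (use N0 in auto)
    also have "1 / sqrt (2 * c * (a * (norm z)\<^sup>2)) = 1 / sqrt (2 * c * a) / norm z"
      by (simp add: real_sqrt_mult)
    also have "ennreal (1 / sqrt (2 * c * a) / norm z) ^ (N - 1) \<le> ennreal (B / norm z) ^ (N - 1)"
      by (intro power_mono ennreal_leI divide_right_mono) (simp_all add: B_def)
    also have "\<dots> = ennreal ((B / norm z) ^ (N - 1))"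
      by (rule ennreal_power) (simp add: B_def)
    finally show ?thesis using 1 by (auto simp: min_def)
  qed
  have "(\<integral>\<^sup>+\<omega>. tilt_integral N (\<lambda>n. h n \<omega>) \<partial>M)
      = (\<integral>\<^sup>+z. \<integral>\<^sup>+\<omega>. ennreal (norm z ^ (?k + 2) * exp (- ((1 / real N) * (\<Sum>n<N. (h n \<omega> \<bullet> z)\<^sup>2)))) \<partial>M \<partial>lborel)"
    unfolding tilt_integral_def by (rule L.Fubini'[OF joint, symmetric])
  also have "\<dots> \<le> (\<integral>\<^sup>+z. ennreal (2 ^ ?k * B ^ (N - 1)) * ennreal (\<Prod>i\<in>UNIV. inverse (1 + (z $ i)\<^sup>2)) \<partial>(lborel :: (real^'k) measure))"
  proof (rule nn_integral_mono)
    fix z :: "real^'k"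
    have eq: "(\<integral>\<^sup>+\<omega>. ennreal (norm z ^ (?k + 2) * exp (- ((1 / real N) * (\<Sum>n<N. (h n \<omega> \<bullet> z)\<^sup>2)))) \<partial>M)
      = ennreal (norm z ^ (?k + 2)) * (\<integral>\<^sup>+\<omega>. ennreal (exp (- ((1 / real N) * (\<Sum>n<N. (h n \<omega> \<bullet> z)\<^sup>2)))) \<partial>M)"
      by (subst nn_integral_cmult[symmetric]) (simp_all add: ennreal_mult)
    also have "\<dots> \<le> ennreal (norm z ^ (?k + 2) * min 1 ((B / norm z) ^ (N - 1)))"
    proof (cases "z = 0")
      case False
      have "min 1 ((B / norm z) ^ (N - 1)) \<ge> 0" by (simp add: B_def)
      then show ?thesis using exp_bound[OF False]
        by (simp add: ennreal_mult mult_left_mono)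
    qed simp
    also have "\<dots> \<le> ennreal ((2 ^ ?k * B ^ (N - 1)) * (\<Prod>i\<in>UNIV. inverse (1 + (z $ i)\<^sup>2)))"
      using p by (intro ennreal_leI weight_le_prod_Cauchy) (simp_all add: B_def)
    also have "\<dots> = ennreal (2 ^ ?k * B ^ (N - 1)) * ennreal (\<Prod>i\<in>UNIV. inverse (1 + (z $ i)\<^sup>2))"
      by (rule ennreal_mult) (simp_all add: B_def prod_nonneg)
    finally show "(\<integral>\<^sup>+\<omega>. ennreal (norm z ^ (?k + 2) * exp (- ((1 / real N) * (\<Sum>n<N. (h n \<omega> \<bullet> z)\<^sup>2)))) \<partial>M)
      \<le> ennreal (2 ^ ?k * B ^ (N - 1)) * ennreal (\<Prod>i\<in>UNIV. inverse (1 + (z $ i)\<^sup>2))" .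
  qed
  also have "\<dots> = ennreal (2 ^ ?k * B ^ (N - 1)) *
      (\<integral>\<^sup>+z. ennreal (\<Prod>i\<in>UNIV. inverse (1 + (z $ i)\<^sup>2)) \<partial>(lborel :: (real^'k) measure))"
    by (rule nn_integral_cmult) measurable
  also have "\<dots> = ennreal (tilt_bound TYPE('k) a N)"
  proof -
    have "(\<integral>\<^sup>+z. ennreal (\<Prod>i\<in>UNIV. inverse (1 + (z $ i)\<^sup>2)) \<partial>(lborel :: (real^'k) measure))
      = ennreal (enn2real (\<integral>\<^sup>+z. ennreal (\<Prod>i\<in>UNIV. inverse (1 + (z $ i)\<^sup>2)) \<partial>(lborel :: (real^'k) measure)))"
      using nn_integral_prod_Cauchy[where 'k='k] by (subst ennreal_enn2real) (simp_all only: infinity_ennreal_def)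
    then show ?thesis
      unfolding tilt_bound_def c_def[symmetric] B_def[symmetric]
      by (subst ennreal_mult) (simp_all add: B_def)
  qed
  finally show "(\<integral>\<^sup>+\<omega>. tilt_integral N (\<lambda>n. g n \<omega> + \<xi> n \<omega> - ens_mean N (\<lambda>n. g n \<omega> + \<xi> n \<omega>)) \<partial>M)
    \<le> ennreal (tilt_bound TYPE('k) a N)"
    unfolding tilt_eq .
qed

end

subsection \<open>Runs of the filter\<close>

text \<open>The dynamics and the projection act on pairs of members, the analysis step on deviations
  from the mean; this identity passes between the two without loss.\<close>

lemma sum_pairs_eq_centered:
  fixes x :: "nat \<Rightarrow> 'a::real_inner"
  assumes "N > 0"
  shows "(\<Sum>n<N. \<Sum>m<N. (norm (x n - x m))\<^sup>2) = 2 * real N * (\<Sum>n<N. (norm (x n - ens_mean N x))\<^sup>2)"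
proof -
  define \<mu> where "\<mu> = ens_mean N x"
  define d where "d n = x n - \<mu>" for n
  have d0: "(\<Sum>n<N. d n) = 0"
    using ens_mean_sum[OF assms, of x] by (simp add: d_def sum_subtractf \<mu>_def scaleR_conv_of_real sum_constant_scaleR)
  have "(\<Sum>m<N. (norm (x n - x m))\<^sup>2) = real N * (norm (d n))\<^sup>2 + (\<Sum>m<N. (norm (d m))\<^sup>2)" for n
  proof -
    have "(norm (x n - x m))\<^sup>2 = (norm (d n))\<^sup>2 + (norm (d m))\<^sup>2 - 2 * (d n \<bullet> d m)" for m
    proof -
      have "x n - x m = d n - d m" by (simp add: d_def)
      then show ?thesis by (simp add: power2_norm_eq_inner inner_diff_left inner_diff_right inner_commute)
    qed
    then have "(\<Sum>m<N. (norm (x n - x m))\<^sup>2)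
        = real N * (norm (d n))\<^sup>2 + (\<Sum>m<N. (norm (d m))\<^sup>2) - 2 * (d n \<bullet> (\<Sum>m<N. d m))"
      by (simp add: sum.distrib sum_subtractf inner_sum_right sum_distrib_left)
    then show ?thesis by (simp add: d0)
  qed
  then have "(\<Sum>n<N. \<Sum>m<N. (norm (x n - x m))\<^sup>2) = 2 * real N * (\<Sum>n<N. (norm (d n))\<^sup>2)"
    by (simp add: sum.distrib sum_distrib_left mult.assoc)
  then show ?thesis by (simp add: d_def \<mu>_def)
qed

lemma sum_centered_le:
  fixes x :: "nat \<Rightarrow> 'a::real_inner"
  assumes "N > 0"
  shows "(\<Sum>n<N. (norm (x n - ens_mean N x))\<^sup>2) \<le> (\<Sum>n<N. (norm (x n))\<^sup>2)"
proof -
  define \<mu> where "\<mu> = ens_mean N x"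
  have "(norm (x n - \<mu>))\<^sup>2 = (norm (x n))\<^sup>2 + (norm \<mu>)\<^sup>2 - 2 * (x n \<bullet> \<mu>)" for n
    by (simp add: power2_norm_eq_inner inner_diff_left inner_diff_right inner_commute)
  then have "(\<Sum>n<N. (norm (x n - \<mu>))\<^sup>2)
      = (\<Sum>n<N. (norm (x n))\<^sup>2) + real N * (norm \<mu>)\<^sup>2 - 2 * ((\<Sum>n<N. x n) \<bullet> \<mu>)"
    by (simp add: sum.distrib sum_subtractf inner_sum_left sum_distrib_left)
  also have "(\<Sum>n<N. x n) \<bullet> \<mu> = real N * (norm \<mu>)\<^sup>2"
    using ens_mean_sum[OF assms, of x] by (simp add: \<mu>_def power2_norm_eq_inner)
  finally show ?thesis by (simp add: \<mu>_def)
qed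

lemma mean_square_le:
  fixes x :: "nat \<Rightarrow> real"
  assumes "N > 0"
  shows "((1 / real N) * (\<Sum>n<N. x n))\<^sup>2 \<le> (1 / real N) * (\<Sum>n<N. (x n)\<^sup>2)"
proof -
  have "(\<Sum>n<N. x n * 1)\<^sup>2 \<le> (\<Sum>n<N. (x n)\<^sup>2) * (\<Sum>n<N. 1\<^sup>2)"
    by (rule Cauchy_Schwarz_ineq_sum)
  then show ?thesis using assms by (simp add: power_mult_distrib power2_eq_square field_simps)
qed

text \<open>Convexity of the square. Applied to a contraction by \<theta> plus a defect, the weight
  \<theta> turns \<theta>^2 into \<theta>, still below 1, and only the defect pays 1 / (1 -
  \<theta>).\<close>

lemma weighted_square_sum_le:
  fixes x y \<theta> :: real
  assumes "0 < \<theta>" "\<theta> < 1"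
  shows "(x + y)\<^sup>2 \<le> x\<^sup>2 / \<theta> + y\<^sup>2 / (1 - \<theta>)"
proof -
  have "0 \<le> ((1 - \<theta>) * x - \<theta> * y)\<^sup>2 / (\<theta> * (1 - \<theta>))" using assms by simp
  also have "\<dots> = x\<^sup>2 / \<theta> + y\<^sup>2 / (1 - \<theta>) - (x + y)\<^sup>2"
    using assms by (simp add: field_simps power2_eq_square)
  finally show ?thesis by simp
qed

lemma square_add_le: "(x + y)\<^sup>2 \<le> 2 * x\<^sup>2 + 2 * y\<^sup>2" for x y :: real
  using weighted_square_sum_le[of "1/2" x y] by simp

lemma norm_ens_mean_le: "norm (ens_mean N v) \<le> (1 / real N) * (\<Sum>n<N. norm (v n))"
  by (simp add: ens_mean_def divide_right_mono norm_sum)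

lemma ens_mean_diff_const: "N > 0 \<Longrightarrow> ens_mean N (\<lambda>n. v n - x) = ens_mean N v - x"
  by (simp add: ens_mean_def sum_subtractf scaleR_diff_right sum_constant_scaleR)

text \<open>A single run with all its data. The bounds \<open>r0\<close> and \<open>\<rho>\<close>
  on \<open>R\<close> are parameters, so that they can be fixed before \<epsilon>, \<delta> and the
  surrogate.\<close>

locale enkf_run = prob_space M + coisometry_V H \<beta>
  for M :: "'w measure"
    and H :: "'h::{real_inner,complete_space,second_countable_topology} \<Rightarrow> real^'k" and \<beta> :: real +
  fixes F :: "nat \<Rightarrow> 'w measure" and \<Psi> \<Psi>s :: "'h \<Rightarrow> 'h" and R :: "real^'k^'k"
    and \<epsilon> a r L \<alpha> \<kappa> Ls \<delta> :: real and N :: nat and m0 u0 :: 'h and C0 :: "'h \<Rightarrow> 'h"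
    and \<eta> :: "nat \<Rightarrow> 'w \<Rightarrow> real^'k" and \<xi> U :: "nat \<Rightarrow> nat \<Rightarrow> 'w \<Rightarrow> 'h" and r0 \<rho> :: real
  assumes R_pos: "x \<noteq> 0 \<Longrightarrow> x \<bullet> (R *v x) > 0"
    and A: "assumption_A \<Psi> H r \<beta> L \<alpha>"
    and B: "assumption_B \<Psi> \<Psi>s H r \<beta> \<kappa> Ls \<delta>"
    and run: "enkf_s_run M F \<Psi> \<Psi>s H R \<epsilon> a r \<beta> N m0 C0 u0 \<eta> \<xi> U"
    and N: "N \<ge> 6 * CARD('k)"
    and a_pos: "a > 0" and \<epsilon>_pos: "\<epsilon> > 0"
    and r0_pos: "r0 > 0" and r0: "r0 * (norm z)\<^sup>2 \<le> z \<bullet> (R *v z)"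
    and \<rho>_nonneg: "\<rho> \<ge> 0" and \<rho>: "norm (R *v z) \<le> \<rho> * norm z"
begin

definition \<theta> where "\<theta> = sqrt \<alpha>"
definition p where "p j n \<omega> = proj_BV H \<beta> r (U j n \<omega>)"
definition fc where "fc j n \<omega> = \<Psi>s (p (j - 1) n \<omega>) + \<xi> j n \<omega>"
definition anom where "anom j n \<omega> = fc j n \<omega> - ens_mean N (\<lambda>n. fc j n \<omega>)"
definition sig where "sig j = (\<Psi> ^^ j) u0"
definition tr where "tr = (\<Sum>i\<in>UNIV. R $ i $ i)"
text \<open>The inflation noise has covariance a P, so its unobserved part vanishes only almost
  surely. The spread bounds hold for every outcome of this kind, with no expectation.\<close>

definition good where "good \<omega> \<longleftrightarrow> \<omega> \<in> space M \<and> (\<forall>j\<ge>1. \<forall>n<N. Q (\<xi> j n \<omega>) = 0)"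
definition spread where
  "spread j \<omega> = (\<Sum>n<N. \<Sum>m<N. (Vn H \<beta> (p j n \<omega> - p j m \<omega>))\<^sup>2)"
definition err where "err j \<omega> = Vn H \<beta> (ens_mean N (\<lambda>n. U j n \<omega>) - sig j)"
text \<open>The recursion closes for this quantity: the next forecast sees the members only after
  projection.\<close>

definition Adist where "Adist j \<omega> = (1 / real N) * (\<Sum>n<N. Vn H \<beta> (p j n \<omega> - sig j))"

lemma k_pos: "CARD('k) \<ge> 1"
  by (simp add: Suc_leI)

lemma N_gt_1: "N > 1" and N_pos: "N > 0"
  using N k_pos by linarith+

lemma A_facts: "r > 0" "0 < \<alpha>" "\<alpha> < 1" "absorbing_fwd_inv \<Psi> (ballB r)"
  "u \<in> ballB r \<Longrightarrow> v \<in> ballB r \<Longrightarrow>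
    (Vn H \<beta> ((\<Psi> u - \<Psi> v) - projP H (\<Psi> u - \<Psi> v)))\<^sup>2 \<le> \<alpha> * (Vn H \<beta> (u - v))\<^sup>2"
  using A unfolding assumption_A_def by blast+

lemma B_facts: "\<kappa> > 0" "Ls > 0" "\<delta> > 0"
  "u \<in> ballB r \<Longrightarrow> norm (\<Psi>s u - \<Psi> u) \<le> \<kappa>"
  "u \<in> ballB r \<Longrightarrow> v \<in> ballB r \<Longrightarrow> (Vn H \<beta> (\<Psi>s u - \<Psi>s v))\<^sup>2 \<le> Ls * (Vn H \<beta> (u - v))\<^sup>2"
  "u \<in> ballB r \<Longrightarrow> norm ((\<Psi>s u - \<Psi> u) - projP H (\<Psi>s u - \<Psi> u)) \<le> \<delta>"
  using B unfolding assumption_B_def by blast+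

lemma \<theta>: "0 < \<theta>" "\<theta> < 1" "\<theta>\<^sup>2 = \<alpha>"
  using A_facts by (simp_all add: \<theta>_def)

lemma p_ball: "p j n \<omega> \<in> ballB r"
  by (simp add: p_def proj_BV_props(1)[OF A_facts(1)])

lemma \<Psi>_ball: "u \<in> ballB r \<Longrightarrow> \<Psi> u \<in> ballB r"
  using A_facts(4) by (auto simp: absorbing_fwd_inv_def)

lemma sig_Suc: "sig (Suc j) = \<Psi> (sig j)"
  by (simp add: sig_def)

lemma sig_eventually_ball: "\<exists>J. \<forall>j\<ge>J. sig j \<in> ballB r"
proof -
  have "bounded {u0}" by simp
  then obtain J where "\<forall>j\<ge>J. (\<Psi> ^^ j) ` {u0} \<subseteq> ballB r"
    using A_facts(4) unfolding absorbing_fwd_inv_def by blast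
  then show ?thesis by (auto simp: sig_def)
qed

section \<open>Contraction in the unobserved directions\<close>

lemma Q_\<Psi>_contract:
  assumes "u \<in> ballB r" "v \<in> ballB r"
  shows "norm (Q (\<Psi> u - \<Psi> v)) \<le> \<theta> * Vn H \<beta> (u - v)"
proof (rule power2_le_imp_le)
  show "(norm (Q (\<Psi> u - \<Psi> v)))\<^sup>2 \<le> (\<theta> * Vn H \<beta> (u - v))\<^sup>2"
    using A_facts(5)[OF assms] by (simp only: Vn_Q power_mult_distrib \<theta>(3))
qed (simp add: \<theta> less_imp_le Vn_nonneg)

lemma norm_Q_\<Psi>s_\<Psi>: "u \<in> ballB r \<Longrightarrow> norm (Q (\<Psi>s u - \<Psi> u)) \<le> \<delta>"
  by (rule B_facts(6))

lemma Q_\<Psi>s_\<Psi>: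
  assumes "u \<in> ballB r" "v \<in> ballB r"
  shows "norm (Q (\<Psi>s u - \<Psi> v)) \<le> \<theta> * Vn H \<beta> (u - v) + \<delta>"
proof -
  have "Q (\<Psi>s u - \<Psi> v) = Q (\<Psi> u - \<Psi> v) + Q (\<Psi>s u - \<Psi> u)"
    unfolding Q_add[symmetric] by simp
  then have "norm (Q (\<Psi>s u - \<Psi> v)) \<le> norm (Q (\<Psi> u - \<Psi> v)) + norm (Q (\<Psi>s u - \<Psi> u))"
    by (simp only: norm_triangle_ineq)
  then show ?thesis using Q_\<Psi>_contract[OF assms] norm_Q_\<Psi>s_\<Psi>[OF assms(1)] by linarith
qed

text \<open>\<open>Ls\<close> may exceed 1, so the contraction is borrowed from \<Psi>, at the price
  of one \<delta> for each argument. This is how \<delta> enters the spread.\<close>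

lemma Q_\<Psi>s_\<Psi>s:
  assumes "u \<in> ballB r" "v \<in> ballB r"
  shows "norm (Q (\<Psi>s u - \<Psi>s v)) \<le> \<theta> * Vn H \<beta> (u - v) + 2 * \<delta>"
proof -
  have "Q (\<Psi>s u - \<Psi>s v) = Q (\<Psi>s u - \<Psi> v) - Q (\<Psi>s v - \<Psi> v)"
    unfolding Q_diff[symmetric] by simp
  then have "norm (Q (\<Psi>s u - \<Psi>s v)) \<le> norm (Q (\<Psi>s u - \<Psi> v)) + norm (Q (\<Psi>s v - \<Psi> v))"
    by (simp only: norm_triangle_ineq4)
  then show ?thesis using Q_\<Psi>s_\<Psi>[OF assms] norm_Q_\<Psi>s_\<Psi>[OF assms(2)] by linarith
qed

lemma norm_\<Psi>s_le: "u \<in> ballB r \<Longrightarrow> norm (\<Psi>s u) \<le> r + \<kappa>"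
proof -
  assume u: "u \<in> ballB r"
  have "norm (\<Psi>s u) \<le> norm (\<Psi> u) + norm (\<Psi>s u - \<Psi> u)" by (rule norm_triangle_sub)
  then show ?thesis using B_facts(4)[OF u] \<Psi>_ball[OF u] by (simp add: ballB_def)
qed

lemma run_facts:
  "\<And>j. subalgebra M (F j)"
  "\<And>n. n < N \<Longrightarrow> U 0 n \<in> borel_measurable (F 0)"
  "\<And>j. j \<ge> 1 \<Longrightarrow> \<eta> j \<in> borel_measurable (F j)"
  "\<And>j n. j \<ge> 1 \<Longrightarrow> n < N \<Longrightarrow> \<xi> j n \<in> borel_measurable (F j)"
  "\<And>j n. j \<ge> 1 \<Longrightarrow> n < N \<Longrightarrow> U j n \<in> borel_measurable (F j)"
  "\<And>j n. j \<ge> 1 \<Longrightarrow> n < N \<Longrightarrow> gaussian_rv M (\<xi> j n) 0 (\<lambda>x. a *\<^sub>R projP H x)"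
  "\<And>j. j \<ge> 1 \<Longrightarrow> indep_sets
        (\<lambda>i. if i < N then events_of M (\<xi> j i)
             else if i = N then events_of M (\<eta> j) else sets (F (j - 1))) {..N+1}"
  "\<And>j i. j \<ge> 1 \<Longrightarrow> integrable M (\<lambda>\<omega>. (\<eta> j \<omega> $ i)\<^sup>2)"
  "\<And>j i l. j \<ge> 1 \<Longrightarrow> integral\<^sup>L M (\<lambda>\<omega>. \<eta> j \<omega> $ i * \<eta> j \<omega> $ l) = R $ i $ l"
  "\<And>j \<omega>. j \<ge> 1 \<Longrightarrow> \<omega> \<in> space M \<Longrightarrow> enkf_analysis_ok H R \<epsilon> N (H (sig j) + \<epsilon> *\<^sub>R \<eta> j \<omega>)
          (\<lambda>n. fc j n \<omega>) (\<lambda>n. U j n \<omega>)"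
  using run unfolding enkf_s_run_def sig_def fc_def p_def by blast+

text \<open>The symmetry of \<open>R\<close> is that of the covariance of the observation
  noise.\<close>

lemma R_sym: "R $ i $ l = R $ l $ i"
  using run_facts(9)[of 1 i l] run_facts(9)[of 1 l i] by (simp add: mult.commute)

lemma tr_nonneg: "tr \<ge> 0"
  unfolding tr_def
proof (rule sum_nonneg)
  fix i :: 'k
  have "axis i 1 \<bullet> (R *v axis i 1) = R $ i $ i"
    by (simp add: inner_axis' matrix_vector_mult_basis column_def)
  then show "0 \<le> R $ i $ i" using R_pos[of "axis i 1"] by (simp add: axis_eq_0_iff)
qed

section \<open>Recursion for the spread, outcome by outcome\<close>

lemma analysis:
  assumes "j \<ge> 1" "\<omega> \<in> space M"
  shows "enkf_analysis H R \<epsilon> N (H (sig j) + \<epsilon> *\<^sub>R \<eta> j \<omega>) (\<lambda>n. fc j n \<omega>) (\<lambda>n. U j n \<omega>)"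
  using R_pos R_sym \<epsilon>_pos N_gt_1 run_facts(10)[OF assms] by unfold_locales auto

text \<open>On good outcomes the noise has no unobserved part, so unobserved differences of
  forecasts are those of surrogate images, to which \<open>Q_\<Psi>s_\<Psi>s\<close> applies pair by
  pair.\<close>

lemma sum_square_Q_anom_le:
  assumes "good \<omega>" "j \<ge> 1"
  shows "2 * real N * (\<Sum>n<N. (norm (Q (anom j n \<omega>)))\<^sup>2)
    \<le> \<theta> * spread (j - 1) \<omega> + 4 * (real N)\<^sup>2 * \<delta>\<^sup>2 / (1 - \<theta>)"
proof -
  have Qfc: "Q (fc j n \<omega>) - Q (fc j m \<omega>) = Q (\<Psi>s (p (j - 1) n \<omega>) - \<Psi>s (p (j - 1) m \<omega>))"
    if "n < N" "m < N" for n m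
  proof -
    have "Q (fc j i \<omega>) = Q (\<Psi>s (p (j - 1) i \<omega>))" if "i < N" for i
      using assms that by (simp only: fc_def Q_add good_def add_0_right)
    then show ?thesis using that by (simp only: Q_diff)
  qed
  have "Q (anom j n \<omega>) = Q (fc j n \<omega>) - ens_mean N (\<lambda>n. Q (fc j n \<omega>))" for n
    by (simp only: anom_def Q_diff linear_ens_mean[OF linear_Q])
  then have "2 * real N * (\<Sum>n<N. (norm (Q (anom j n \<omega>)))\<^sup>2)
      = (\<Sum>n<N. \<Sum>m<N. (norm (Q (fc j n \<omega>) - Q (fc j m \<omega>)))\<^sup>2)"
    using sum_pairs_eq_centered[OF N_pos, of "\<lambda>n. Q (fc j n \<omega>)"] by (simp only:)
  also have "\<dots> \<le> (\<Sum>n<N. \<Sum>m<N.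
      \<theta> * (Vn H \<beta> (p (j - 1) n \<omega> - p (j - 1) m \<omega>))\<^sup>2 + (2 * \<delta>)\<^sup>2 / (1 - \<theta>))"
  proof (intro sum_mono)
    fix n m assume nm: "n \<in> {..<N}" "m \<in> {..<N}"
    let ?V = "Vn H \<beta> (p (j - 1) n \<omega> - p (j - 1) m \<omega>)"
    have "(norm (Q (fc j n \<omega>) - Q (fc j m \<omega>)))\<^sup>2 \<le> (\<theta> * ?V + 2 * \<delta>)\<^sup>2"
    proof (rule power_mono)
      show "norm (Q (fc j n \<omega>) - Q (fc j m \<omega>)) \<le> \<theta> * ?V + 2 * \<delta>"
        using Q_\<Psi>s_\<Psi>s[OF p_ball p_ball, of "j - 1" n \<omega> "j - 1" m \<omega>] nm by (simp only: Qfc lessThan_iff)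
    qed simp
    also have "\<dots> \<le> (\<theta> * ?V)\<^sup>2 / \<theta> + (2 * \<delta>)\<^sup>2 / (1 - \<theta>)"
      by (rule weighted_square_sum_le[OF \<theta>(1,2)])
    also have "(\<theta> * ?V)\<^sup>2 / \<theta> = \<theta> * ?V\<^sup>2" using \<theta>(1) by (simp add: power2_eq_square)
    finally show "(norm (Q (fc j n \<omega>) - Q (fc j m \<omega>)))\<^sup>2 \<le> \<theta> * ?V\<^sup>2 + (2 * \<delta>)\<^sup>2 / (1 - \<theta>)" .
  qed
  also have "\<dots> = \<theta> * spread (j - 1) \<omega> + 4 * (real N)\<^sup>2 * \<delta>\<^sup>2 / (1 - \<theta>)"
    by (simp add: spread_def sum.distrib sum_distrib_left power2_eq_square)
  finally show ?thesis .
qed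

definition anal where "anal j n \<omega> = U j n \<omega> - ens_mean N (\<lambda>n. U j n \<omega>)"

lemma sum_square_V_anal_le:
  assumes "j \<ge> 1" "\<omega> \<in> space M"
  shows "(\<Sum>n<N. (Vn H \<beta> (anal j n \<omega>))\<^sup>2)
    \<le> (1 + \<beta>) * ((real N - 1) * \<epsilon>\<^sup>2 * tr) + (\<Sum>n<N. (norm (Q (anom j n \<omega>)))\<^sup>2)"
proof -
  interpret E: enkf_analysis H R \<epsilon> N "H (sig j) + \<epsilon> *\<^sub>R \<eta> j \<omega>" "\<lambda>n. fc j n \<omega>" "\<lambda>n. U j n \<omega>"
    by (rule analysis[OF assms])
  have c: "E.c n = anal j n \<omega>" and b: "E.b n = anom j n \<omega>" for n
    by (simp_all add: E.c_def E.b_def anal_def anom_def)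
  have "(\<Sum>n<N. (Vn H \<beta> (anal j n \<omega>))\<^sup>2)
      = (1 + \<beta>) * (\<Sum>n<N. (norm (H (anal j n \<omega>)))\<^sup>2) + (\<Sum>n<N. (norm (Q (anal j n \<omega>)))\<^sup>2)"
    by (simp only: Vn_square sum.distrib sum_distrib_left)
  also have "\<dots> \<le> (1 + \<beta>) * ((real N - 1) * \<epsilon>\<^sup>2 * tr) + (\<Sum>n<N. (norm (Q (anom j n \<omega>)))\<^sup>2)"
    using E.observed_spread[unfolded c, folded tr_def] E.unobserved_spread[unfolded c b] \<beta>_nonneg
    by (intro add_mono mult_left_mono) auto
  finally show ?thesis .
qed

lemma spread_step:
  assumes "good \<omega>" "j \<ge> 1"
  shows "spread j \<omega> \<le> \<theta> * spread (j - 1) \<omega> +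
    (4 * (real N)\<^sup>2 * \<delta>\<^sup>2 / (1 - \<theta>) + 2 * real N * ((1 + \<beta>) * ((real N - 1) * \<epsilon>\<^sup>2 * tr)))"
proof -
  have \<omega>: "\<omega> \<in> space M" using assms by (simp add: good_def)
  have "spread j \<omega> \<le> (\<Sum>n<N. \<Sum>m<N. (norm (T (U j n \<omega>) - T (U j m \<omega>)))\<^sup>2)"
    unfolding spread_def p_def
    by (intro sum_mono power_mono)
       (simp_all add: Vn_nonneg proj_BV_nonexpansive[OF A_facts(1)] flip: T_diff Vn_eq_norm)
  also have "\<dots> = 2 * real N * (\<Sum>n<N. (Vn H \<beta> (anal j n \<omega>))\<^sup>2)"
  proof -
    have lT: "linear T" by (intro linearI T_add T_scaleR)
    show ?thesis
      using sum_pairs_eq_centered[OF N_pos, of "\<lambda>n. T (U j n \<omega>)"]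
      by (simp add: Vn_eq_norm anal_def T_diff linear_ens_mean[OF lT])
  qed
  also have "\<dots> \<le> 2 * real N * ((1 + \<beta>) * ((real N - 1) * \<epsilon>\<^sup>2 * tr) + (\<Sum>n<N. (norm (Q (anom j n \<omega>)))\<^sup>2))"
    by (intro mult_left_mono sum_square_V_anal_le[OF assms(2) \<omega>]) simp
  also have "\<dots> = 2 * real N * ((1 + \<beta>) * ((real N - 1) * \<epsilon>\<^sup>2 * tr)) + 2 * real N * (\<Sum>n<N. (norm (Q (anom j n \<omega>)))\<^sup>2)"
    by (rule distrib_left)
  finally show ?thesis using sum_square_Q_anom_le[OF assms] by linarith
qed

definition s where "s = \<epsilon> + \<delta>"
definition diam where "diam = sqrt (1 + \<beta>) * (2 * r)"
text \<open>The recursion \<open>spread_step\<close> has its fixed point below (C1 - 1) s^2, namely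
  the forcing over 1 - \<theta>; the added 1 leaves room for the transient.\<close>

definition C1 where
  "C1 = 1 + (4 * (real N)\<^sup>2 / (1 - \<theta>) + 2 * real N * ((1 + \<beta>) * ((real N - 1) * tr))) / (1 - \<theta>)"
text \<open>\<open>C2 * s\<close> bounds the unobserved standard deviation of the forecast once the
  spread is at most C1 s^2; \<open>C3 * s\<close> bounds the standard deviation of the analysis
  ensemble in the V-norm.\<close>

definition C2 where "C2 = sqrt (\<theta> * C1 + 4 * (real N)\<^sup>2 / (1 - \<theta>))"
definition C3 where "C3 = sqrt ((1 + \<beta>) * tr + C2\<^sup>2)"

lemma s: "s > 0" "\<epsilon> \<le> s" "\<delta> \<le> s" "\<epsilon>\<^sup>2 \<le> s\<^sup>2" "\<delta>\<^sup>2 \<le> s\<^sup>2"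
  using \<epsilon>_pos B_facts(3) by (auto simp: s_def intro!: power_mono)

lemma C1_ge: "C1 \<ge> 1"
  using \<theta> tr_nonneg \<beta>_nonneg N_gt_1 by (simp add: C1_def)

lemma C2: "C2 \<ge> 0" "C2\<^sup>2 = \<theta> * C1 + 4 * (real N)\<^sup>2 / (1 - \<theta>)"
  using \<theta> C1_ge by (simp_all add: C2_def)

lemma C3: "C3 \<ge> 0" "C3\<^sup>2 = (1 + \<beta>) * tr + C2\<^sup>2"
  using tr_nonneg \<beta>_nonneg by (simp_all add: C3_def)

lemma Vn_ball_le_diam:
  assumes "u \<in> ballB r" "v \<in> ballB r"
  shows "Vn H \<beta> (u - v) \<le> diam"
proof -
  have "norm (u - v) \<le> 2 * r"
    using norm_triangle_ineq4[of u v] assms by (simp add: ballB_def)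
  then show ?thesis
    unfolding diam_def using \<beta>_nonneg by (intro order_trans[OF Vn_le_norm] mult_left_mono) auto
qed

lemma spread_geometric:
  assumes "good \<omega>"
  shows "spread j \<omega> \<le> \<theta> ^ j * ((real N)\<^sup>2 * diam\<^sup>2) + (C1 - 1) * s\<^sup>2"
proof (induction j)
  case 0
  have "spread 0 \<omega> \<le> (\<Sum>n<N. \<Sum>m<N. diam\<^sup>2)"
    unfolding spread_def by (intro sum_mono power_mono Vn_ball_le_diam p_ball Vn_nonneg)
  moreover have "0 \<le> (C1 - 1) * s\<^sup>2" using C1_ge by simp
  ultimately show ?case by (simp add: power2_eq_square mult.assoc)
next
  case (Suc j)
  let ?E = "4 * (real N)\<^sup>2 * \<delta>\<^sup>2 / (1 - \<theta>) + 2 * real N * ((1 + \<beta>) * ((real N - 1) * \<epsilon>\<^sup>2 * tr))"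
  have "?E \<le> 4 * (real N)\<^sup>2 * s\<^sup>2 / (1 - \<theta>) + 2 * real N * ((1 + \<beta>) * ((real N - 1) * s\<^sup>2 * tr))"
    using \<theta> \<beta>_nonneg N_gt_1 tr_nonneg s
    by (intro add_mono mult_left_mono mult_right_mono divide_right_mono) auto
  also have "\<dots> = (4 * (real N)\<^sup>2 / (1 - \<theta>) + 2 * real N * ((1 + \<beta>) * ((real N - 1) * tr))) * s\<^sup>2"
    by (simp add: algebra_simps)
  also have "\<dots> = (1 - \<theta>) * ((C1 - 1) * s\<^sup>2)"
    using \<theta> by (simp add: C1_def)
  finally have E: "?E \<le> (1 - \<theta>) * ((C1 - 1) * s\<^sup>2)" .
  have "spread (Suc j) \<omega> \<le> \<theta> * spread j \<omega> + ?E"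
    using spread_step[OF assms, of "Suc j"] by simp
  also have "\<dots> \<le> \<theta> * (\<theta> ^ j * ((real N)\<^sup>2 * diam\<^sup>2) + (C1 - 1) * s\<^sup>2) + (1 - \<theta>) * ((C1 - 1) * s\<^sup>2)"
    using \<theta> by (intro add_mono E mult_left_mono Suc.IH) auto
  also have "\<dots> = \<theta> ^ Suc j * ((real N)\<^sup>2 * diam\<^sup>2) + (C1 - 1) * s\<^sup>2"
    by (simp add: algebra_simps)
  finally show ?case .
qed

text \<open>One \<open>J\<close> serves all good outcomes, since the projected ensemble starts
  inside a ball whose diameter bounds the transient. Expectations can thus be taken from a fixed
  time on.\<close>

lemma spread_eventually: "\<exists>J. \<forall>j\<ge>J. \<forall>\<omega>. good \<omega> \<longrightarrow> spread j \<omega> \<le> C1 * s\<^sup>2"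
proof -
  have "(\<lambda>j. \<theta> ^ j * ((real N)\<^sup>2 * diam\<^sup>2)) \<longlonglongrightarrow> 0 * ((real N)\<^sup>2 * diam\<^sup>2)"
    by (intro tendsto_mult LIMSEQ_power_zero tendsto_const) (use \<theta> in simp)
  moreover have "0 * ((real N)\<^sup>2 * diam\<^sup>2) < s\<^sup>2" using s(1) by simp
  ultimately have "eventually (\<lambda>j. \<theta> ^ j * ((real N)\<^sup>2 * diam\<^sup>2) < s\<^sup>2) sequentially"
    by (rule order_tendstoD)
  then obtain J where J: "\<And>j. j \<ge> J \<Longrightarrow> \<theta> ^ j * ((real N)\<^sup>2 * diam\<^sup>2) < s\<^sup>2"
    by (auto simp: eventually_sequentially)
  have "spread j \<omega> \<le> C1 * s\<^sup>2" if "j \<ge> J" "good \<omega>" for j \<omega>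
    using spread_geometric[OF that(2), of j] J[OF that(1)] by (simp add: left_diff_distrib)
  then show ?thesis by blast
qed

lemma unobserved_anom_le:
  assumes "good \<omega>" "j \<ge> 1" and sp: "spread (j - 1) \<omega> \<le> C1 * s\<^sup>2"
  shows "(1 / real N) * (\<Sum>n<N. (norm (Q (anom j n \<omega>)))\<^sup>2) \<le> (C2 * s)\<^sup>2"
proof -
  let ?S = "\<Sum>n<N. (norm (Q (anom j n \<omega>)))\<^sup>2"
  have S0: "?S \<ge> 0" by (simp add: sum_nonneg)
  have "2 * real N * ?S \<le> \<theta> * (C1 * s\<^sup>2) + 4 * (real N)\<^sup>2 * s\<^sup>2 / (1 - \<theta>)"
    using \<theta> s
    by (intro order_trans[OF sum_square_Q_anom_le[OF assms(1,2)]] add_mono mult_left_mono sp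
        divide_right_mono) auto
  also have "\<dots> = (C2 * s)\<^sup>2" by (simp add: power_mult_distrib C2(2) algebra_simps)
  finally have "2 * real N * ?S \<le> (C2 * s)\<^sup>2" .
  moreover have "(1 / real N) * ?S \<le> 1 * ?S" using N_gt_1 by (intro mult_right_mono S0) auto
  moreover have "1 * ?S \<le> 2 * real N * ?S" using N_gt_1 by (intro mult_right_mono S0) auto
  ultimately show ?thesis by linarith
qed

text \<open>The signal lies in the ball, so projecting a member does not move it away from the
  signal; a member then differs from the mean by its deviation, whose average is at most the
  standard deviation.\<close>

lemma Adist_le_err:
  assumes "good \<omega>" "j \<ge> 1" and sp: "spread (j - 1) \<omega> \<le> C1 * s\<^sup>2" and sig: "sig j \<in> ballB r"
  shows "Adist j \<omega> \<le> err j \<omega> + C3 * s"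
proof -
  have \<omega>: "\<omega> \<in> space M" using assms by (simp add: good_def)
  have "Vn H \<beta> (p j n \<omega> - sig j) \<le> err j \<omega> + Vn H \<beta> (anal j n \<omega>)" for n
  proof -
    have "Vn H \<beta> (p j n \<omega> - sig j) \<le> Vn H \<beta> (U j n \<omega> - sig j)"
      unfolding p_def by (rule proj_BV_dist_le[OF A_facts(1) sig])
    also have "U j n \<omega> - sig j = (ens_mean N (\<lambda>n. U j n \<omega>) - sig j) + anal j n \<omega>"
      by (simp add: anal_def)
    also have "Vn H \<beta> \<dots> \<le> err j \<omega> + Vn H \<beta> (anal j n \<omega>)"
      unfolding err_def by (rule Vn_add_le)
    finally show ?thesis .
  qed
  then have "Adist j \<omega> \<le> (1 / real N) * (\<Sum>n<N. err j \<omega> + Vn H \<beta> (anal j n \<omega>))"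
    unfolding Adist_def by (intro mult_left_mono sum_mono) auto
  also have "\<dots> = err j \<omega> + (1 / real N) * (\<Sum>n<N. Vn H \<beta> (anal j n \<omega>))"
    using N_pos by (simp add: sum.distrib distrib_left)
  also have "(1 / real N) * (\<Sum>n<N. Vn H \<beta> (anal j n \<omega>)) \<le> C3 * s"
  proof (rule power2_le_imp_le)
    have "((1 / real N) * (\<Sum>n<N. Vn H \<beta> (anal j n \<omega>)))\<^sup>2
        \<le> (1 / real N) * (\<Sum>n<N. (Vn H \<beta> (anal j n \<omega>))\<^sup>2)"
      by (rule mean_square_le[OF N_pos])
    also have "\<dots> \<le> (1 / real N) * ((1 + \<beta>) * ((real N - 1) * \<epsilon>\<^sup>2 * tr) + (\<Sum>n<N. (norm (Q (anom j n \<omega>)))\<^sup>2))"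
      by (intro mult_left_mono sum_square_V_anal_le[OF assms(2) \<omega>]) simp
    also have "\<dots> = ((real N - 1) / real N) * ((1 + \<beta>) * (\<epsilon>\<^sup>2 * tr)) + (1 / real N) * (\<Sum>n<N. (norm (Q (anom j n \<omega>)))\<^sup>2)"
      by (simp add: distrib_left mult_ac)
    also have "\<dots> \<le> 1 * ((1 + \<beta>) * (s\<^sup>2 * tr)) + (C2 * s)\<^sup>2"
      using N_gt_1 \<beta>_nonneg tr_nonneg s
      by (intro add_mono mult_mono unobserved_anom_le[OF assms(1-3)]) auto
    also have "\<dots> = (C3 * s)\<^sup>2" by (simp add: power_mult_distrib C3(2) algebra_simps)
    finally show "((1 / real N) * (\<Sum>n<N. Vn H \<beta> (anal j n \<omega>)))\<^sup>2 \<le> (C3 * s)\<^sup>2" .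
  qed (use C3 s in simp)
  finally show ?thesis by simp
qed

section \<open>Error of the mean in one step, outcome by outcome\<close>

definition Hsq where "Hsq j \<omega> = (\<Sum>n<N. (norm (H (\<xi> j n \<omega>)))\<^sup>2)"

lemma observed_innovation_le:
  assumes "sig j \<in> ballB r"
  shows "(norm (H (sig j - ens_mean N (\<lambda>n. fc j n \<omega>))))\<^sup>2 \<le> 2 * (2 * r + \<kappa>)\<^sup>2 + 2 * Hsq j \<omega>"
proof -
  define g where "g n = \<Psi>s (p (j - 1) n \<omega>)" for n
  have mean: "ens_mean N (\<lambda>n. fc j n \<omega>) - sig j = ens_mean N (\<lambda>n. fc j n \<omega> - sig j)"
    by (simp add: ens_mean_diff_const[OF N_pos])
  have "norm (H (sig j - ens_mean N (\<lambda>n. fc j n \<omega>))) = norm (H (ens_mean N (\<lambda>n. fc j n \<omega> - sig j)))"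
    unfolding mean[symmetric] by (simp add: H.diff norm_minus_commute)
  also have "\<dots> \<le> (1 / real N) * (\<Sum>n<N. norm (H (fc j n \<omega> - sig j)))"
    unfolding H.ens_mean by (rule norm_ens_mean_le)
  also have "\<dots> \<le> (1 / real N) * (\<Sum>n<N. (2 * r + \<kappa>) + norm (H (\<xi> j n \<omega>)))"
  proof (intro mult_left_mono sum_mono)
    fix n
    have "fc j n \<omega> - sig j = (g n - sig j) + \<xi> j n \<omega>" by (simp add: fc_def g_def)
    then have "norm (H (fc j n \<omega> - sig j)) \<le> norm (H (g n - sig j)) + norm (H (\<xi> j n \<omega>))"
      by (simp only: H.add norm_triangle_ineq)
    also have "norm (H (g n - sig j)) \<le> norm (g n) + norm (sig j)"
      by (rule order_trans[OF norm_H_le norm_triangle_ineq4])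
    \<comment> \<open>The surrogate image of a point of the ball has norm at most r + \<kappa>, the
      signal at most r.\<close>
    also have "\<dots> \<le> (r + \<kappa>) + r"
      using norm_\<Psi>s_le[OF p_ball] assms by (intro add_mono) (simp_all add: g_def ballB_def)
    finally show "norm (H (fc j n \<omega> - sig j)) \<le> (2 * r + \<kappa>) + norm (H (\<xi> j n \<omega>))" by simp
  qed simp
  also have "\<dots> = (2 * r + \<kappa>) + (1 / real N) * (\<Sum>n<N. norm (H (\<xi> j n \<omega>)))"
    using N_pos by (simp add: sum.distrib distrib_left)
  finally have "(norm (H (sig j - ens_mean N (\<lambda>n. fc j n \<omega>))))\<^sup>2
      \<le> ((2 * r + \<kappa>) + (1 / real N) * (\<Sum>n<N. norm (H (\<xi> j n \<omega>))))\<^sup>2"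
    by (rule power_mono) simp
  also have "\<dots> \<le> 2 * (2 * r + \<kappa>)\<^sup>2 + 2 * ((1 / real N) * (\<Sum>n<N. norm (H (\<xi> j n \<omega>))))\<^sup>2"
    by (rule square_add_le)
  also have "((1 / real N) * (\<Sum>n<N. norm (H (\<xi> j n \<omega>))))\<^sup>2 \<le> 1 * Hsq j \<omega>"
  proof -
    have "((1 / real N) * (\<Sum>n<N. norm (H (\<xi> j n \<omega>))))\<^sup>2 \<le> (1 / real N) * Hsq j \<omega>"
      unfolding Hsq_def by (rule mean_square_le[OF N_pos])
    also have "\<dots> \<le> 1 * Hsq j \<omega>"
      using N_pos by (intro mult_right_mono) (simp_all add: Hsq_def sum_nonneg)
    finally show ?thesis .
  qed
  finally show ?thesis by simp
qed

lemma observed_anom_le: "(1 / real N) * (\<Sum>n<N. (norm (H (anom j n \<omega>)))\<^sup>2) \<le> 2 * (r + \<kappa>)\<^sup>2 + 2 * Hsq j \<omega>"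
proof -
  have "(\<Sum>n<N. (norm (H (anom j n \<omega>)))\<^sup>2) \<le> (\<Sum>n<N. (norm (H (fc j n \<omega>)))\<^sup>2)"
    using sum_centered_le[OF N_pos, of "\<lambda>n. H (fc j n \<omega>)"]
    by (simp add: anom_def H.diff H.ens_mean)
  also have "\<dots> \<le> (\<Sum>n<N. 2 * (r + \<kappa>)\<^sup>2 + 2 * (norm (H (\<xi> j n \<omega>)))\<^sup>2)"
  proof (rule sum_mono)
    fix n
    have "norm (H (fc j n \<omega>)) \<le> norm (H (\<Psi>s (p (j - 1) n \<omega>))) + norm (H (\<xi> j n \<omega>))"
      by (simp add: fc_def H.add norm_triangle_ineq)
    also have "\<dots> \<le> (r + \<kappa>) + norm (H (\<xi> j n \<omega>))"
      by (intro add_right_mono order_trans[OF norm_H_le norm_\<Psi>s_le[OF p_ball]])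
    finally have "(norm (H (fc j n \<omega>)))\<^sup>2 \<le> ((r + \<kappa>) + norm (H (\<xi> j n \<omega>)))\<^sup>2"
      by (rule power_mono) simp
    then show "(norm (H (fc j n \<omega>)))\<^sup>2 \<le> 2 * (r + \<kappa>)\<^sup>2 + 2 * (norm (H (\<xi> j n \<omega>)))\<^sup>2"
      by (rule order_trans[OF _ square_add_le])
  qed
  also have "\<dots> = real N * (2 * (r + \<kappa>)\<^sup>2) + 2 * Hsq j \<omega>"
    by (simp add: sum.distrib Hsq_def sum_distrib_left)
  finally have "(1 / real N) * (\<Sum>n<N. (norm (H (anom j n \<omega>)))\<^sup>2)
      \<le> (1 / real N) * (real N * (2 * (r + \<kappa>)\<^sup>2) + 2 * Hsq j \<omega>)"
    by (rule mult_left_mono) simp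
  also have "\<dots> = 2 * (r + \<kappa>)\<^sup>2 + (1 / real N) * (2 * Hsq j \<omega>)"
    using N_pos by (simp add: distrib_left)
  also have "(1 / real N) * (2 * Hsq j \<omega>) \<le> 1 * (2 * Hsq j \<omega>)"
    using N_pos by (intro mult_right_mono) (simp_all add: Hsq_def sum_nonneg)
  finally show ?thesis by simp
qed

text \<open>The coefficients of \<open>mean_error\<close>, weighted as in the V-norm: the observed
  ones by sqrt (1 + \<beta>), the unobserved ones by \<open>C2\<close>. The leading 1 accounts for
  the \<delta> of the forecast.\<close>

definition C4 where
  "C4 = 1 + sqrt (1 + \<beta>) * (\<rho> / (2 * sqrt r0) + (1 + \<rho> / r0)) + C2 * (1 + 1 / sqrt r0)"

lemma C4_ge: "C4 \<ge> 1"
  using \<beta>_nonneg \<rho>_nonneg r0_pos C2 by (simp add: C4_def)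

text \<open>The 3 adds up the 1 in 1 + W + h, the one in h <= 1 + h^2, and the one in
  \<open>t\<close>.\<close>

definition c0 where "c0 = 3 + 2 * (2 * r + \<kappa>)\<^sup>2 + 2 * (r + \<kappa>)\<^sup>2"

text \<open>The innovation is bounded without reference to \<open>Adist\<close>, so the previous
  error appears only with the factor \<theta>. Everything else is multiplied by \<open>s\<close>,
  through \<epsilon> in the observed directions and through the spread or \<delta> in the
  others.\<close>

lemma err_step_real:
  assumes "good \<omega>" "j \<ge> 1" and sp: "spread (j - 1) \<omega> \<le> C1 * s\<^sup>2"
    and sig: "sig (j - 1) \<in> ballB r"
    and g: "tilt_integral N (\<lambda>n. H (anom j n \<omega>)) = ennreal g" "g \<ge> 0"
  shows "err j \<omega> \<le> \<theta> * Adist (j - 1) \<omega> + C4 * s *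
    (c0 + 4 * Hsq j \<omega> + (norm (\<eta> j \<omega>))\<^sup>2 + tilt_const TYPE('k) * g)"
proof -
  have \<omega>: "\<omega> \<in> space M" using assms by (simp add: good_def)
  interpret E: enkf_analysis H R \<epsilon> N "H (sig j) + \<epsilon> *\<^sub>R \<eta> j \<omega>" "\<lambda>n. fc j n \<omega>" "\<lambda>n. U j n \<omega>"
    by (rule analysis[OF assms(2) \<omega>])
  have b: "E.b n = anom j n \<omega>" for n by (simp add: E.b_def anom_def)
  have sigj: "sig j = \<Psi> (sig (j - 1))" using sig_Suc[of "j - 1"] assms(2) by simp
  then have sig': "sig j \<in> ballB r" using \<Psi>_ball[OF sig] by simp
  define t where "t = 1 + (1 / real N) * (\<Sum>n<N. (norm (H (anom j n \<omega>)))\<^sup>2) + tilt_const TYPE('k) * g"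
  have t1: "t \<ge> 1"
    using g(2) tilt_const_pos[where 'k='k] by (simp add: t_def sum_nonneg less_imp_le)
  define lam where "lam = 1 / t"
  have lam0: "lam > 0" using t1 by (simp add: lam_def)
  have lam: "lam * (norm z)\<^sup>2 \<le> z \<bullet> E.S z" for z
    using quadratic_form_lower_bound[OF g, of z]
    by (simp add: lam_def t_def E.inner_S b power2_eq_square)
  define w where "w = norm (H (sig j - ens_mean N (\<lambda>n. fc j n \<omega>)))"
  define h where "h = norm (\<eta> j \<omega>)"
  define W where "W = w / sqrt lam"
  have W0: "W \<ge> 0" using lam0 by (simp add: W_def w_def)
  have h0: "h \<ge> 0" by (simp add: h_def)
  have mH: "norm (H (ens_mean N (\<lambda>n. U j n \<omega>) - sig j)) \<le> \<epsilon> * (\<rho> / (2 * sqrt r0) * W + (1 + \<rho> / r0) * h)"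
    unfolding W_def w_def h_def
    by (rule E.mean_error(1)[OF lam0 lam r0_pos r0 \<rho>_nonneg \<rho> refl])
  have mQ: "norm (Q (ens_mean N (\<lambda>n. U j n \<omega>) - sig j)) \<le> norm (Q (ens_mean N (\<lambda>n. fc j n \<omega>) - sig j)) +
      sqrt ((1 / real N) * (\<Sum>n<N. (norm (Q (anom j n \<omega>)))\<^sup>2)) * (W + h / sqrt r0)"
    unfolding W_def w_def h_def
    using E.mean_error(2)[OF lam0 lam r0_pos r0 \<rho>_nonneg \<rho> refl] by (simp only: b)
  have \<tau>: "sqrt ((1 / real N) * (\<Sum>n<N. (norm (Q (anom j n \<omega>)))\<^sup>2)) \<le> C2 * s"
    by (rule real_le_lsqrt) (use unobserved_anom_le[OF assms(1-3)] C2 s in auto)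
  have fQ: "norm (Q (ens_mean N (\<lambda>n. fc j n \<omega>) - sig j)) \<le> \<theta> * Adist (j - 1) \<omega> + \<delta>"
  proof -
    have "Q (ens_mean N (\<lambda>n. fc j n \<omega>) - sig j) = ens_mean N (\<lambda>n. Q (fc j n \<omega> - sig j))"
      by (simp only: ens_mean_diff_const[OF N_pos, symmetric] linear_ens_mean[OF linear_Q])
    then have "norm (Q (ens_mean N (\<lambda>n. fc j n \<omega>) - sig j))
        \<le> (1 / real N) * (\<Sum>n<N. norm (Q (fc j n \<omega> - sig j)))"
      by (simp only: norm_ens_mean_le)
    also have "\<dots> \<le> (1 / real N) * (\<Sum>n<N. \<theta> * Vn H \<beta> (p (j - 1) n \<omega> - sig (j - 1)) + \<delta>)"
    proof (intro mult_left_mono sum_mono)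
      fix n assume "n \<in> {..<N}"
      then have Q\<xi>: "Q (\<xi> j n \<omega>) = 0" using assms(1,2) by (simp add: good_def)
      have "fc j n \<omega> - sig j = (\<Psi>s (p (j - 1) n \<omega>) - \<Psi> (sig (j - 1))) + \<xi> j n \<omega>"
        by (simp add: fc_def sigj)
      then have "Q (fc j n \<omega> - sig j) = Q (\<Psi>s (p (j - 1) n \<omega>) - \<Psi> (sig (j - 1)))"
        by (simp only: Q_add Q\<xi> add_0_right)
      then show "norm (Q (fc j n \<omega> - sig j)) \<le> \<theta> * Vn H \<beta> (p (j - 1) n \<omega> - sig (j - 1)) + \<delta>"
        using Q_\<Psi>s_\<Psi>[OF p_ball sig] by (simp only:)
    qed simp
    also have "\<dots> = \<theta> * Adist (j - 1) \<omega> + \<delta>"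
      using N_pos by (simp add: Adist_def sum.distrib distrib_left sum_distrib_left)
    finally show ?thesis .
  qed
  have "err j \<omega> \<le> sqrt (1 + \<beta>) * norm (H (ens_mean N (\<lambda>n. U j n \<omega>) - sig j))
      + norm (Q (ens_mean N (\<lambda>n. U j n \<omega>) - sig j))"
    unfolding err_def by (rule Vn_le_H_Q)
  also have "\<dots> \<le> sqrt (1 + \<beta>) * (s * (\<rho> / (2 * sqrt r0) * W + (1 + \<rho> / r0) * h))
      + ((\<theta> * Adist (j - 1) \<omega> + s) + C2 * s * (W + h / sqrt r0))"
  proof (intro add_mono mult_left_mono)
    show "norm (H (ens_mean N (\<lambda>n. U j n \<omega>) - sig j)) \<le> s * (\<rho> / (2 * sqrt r0) * W + (1 + \<rho> / r0) * h)"
      using s(2) W0 h0 \<rho>_nonneg r0_pos by (intro order_trans[OF mH] mult_right_mono) auto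
    have "sqrt ((1 / real N) * (\<Sum>n<N. (norm (Q (anom j n \<omega>)))\<^sup>2)) * (W + h / sqrt r0) \<le> C2 * s * (W + h / sqrt r0)"
      using W0 h0 r0_pos by (intro mult_right_mono \<tau>) auto
    then show "norm (Q (ens_mean N (\<lambda>n. U j n \<omega>) - sig j))
      \<le> (\<theta> * Adist (j - 1) \<omega> + s) + C2 * s * (W + h / sqrt r0)"
      using mQ fQ s(3) by linarith
  qed (use \<beta>_nonneg in simp)
  also have "\<dots> \<le> \<theta> * Adist (j - 1) \<omega> + C4 * s * (1 + W + h)"
  proof -
    define x1 x2 x3 x4 where "x1 = sqrt (1 + \<beta>)" and "x2 = \<rho> / (2 * sqrt r0)"
      and "x3 = 1 + \<rho> / r0" and "x4 = 1 / sqrt r0"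
    have x0: "x1 \<ge> 0" "x2 \<ge> 0" "x3 \<ge> 0" "x4 \<ge> 0"
      using \<beta>_nonneg \<rho>_nonneg r0_pos by (simp_all add: x1_def x2_def x3_def x4_def)
    have "x1 * (x2 * W + x3 * h) + (1 + C2 * (W + x4 * h))
        \<le> x1 * ((x2 + x3) * (1 + W + h)) + (1 * (1 + W + h) + C2 * ((1 + x4) * (1 + W + h)))"
      using x0 W0 h0 C2(1) by (intro add_mono mult_left_mono) (simp_all add: algebra_simps)
    also have "\<dots> = C4 * (1 + W + h)"
    proof -
      have "C4 = 1 + x1 * (x2 + x3) + C2 * (1 + x4)"
        by (simp only: C4_def x1_def x2_def x3_def x4_def)
      then show ?thesis by (simp add: algebra_simps)
    qed
    finally have "s * (x1 * (x2 * W + x3 * h) + (1 + C2 * (W + x4 * h))) \<le> s * (C4 * (1 + W + h))"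
      by (rule mult_left_mono) (use s in simp)
    moreover have "h / sqrt r0 = x4 * h" by (simp add: x4_def)
    ultimately show ?thesis
      unfolding x1_def[symmetric] x2_def[symmetric] x3_def[symmetric] by (simp add: algebra_simps)
  qed
  also have "\<dots> \<le> \<theta> * Adist (j - 1) \<omega> + C4 * s *
    (c0 + 4 * Hsq j \<omega> + (norm (\<eta> j \<omega>))\<^sup>2 + tilt_const TYPE('k) * g)"
  proof (intro add_left_mono mult_left_mono)
    \<comment> \<open>This separates the innovation from the inverse eigenvalue, two dependent
      variables: a second moment of the one and a first moment of the other suffice.\<close>
    have "W \<le> w\<^sup>2 + t"
    proof -
      have "W = w * sqrt t" using t1 by (simp add: W_def lam_def real_sqrt_divide)
      also have "\<dots> \<le> w\<^sup>2 + (sqrt t)\<^sup>2"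
      proof -
        have "w * sqrt t \<ge> 0" using t1 by (simp add: w_def)
        then show ?thesis using sum_squares_bound[of w "sqrt t"] by linarith
      qed
      finally show ?thesis using t1 by simp
    qed
    moreover have "h \<le> 1 + h\<^sup>2"
      using sum_squares_bound[of h 1] h0 by simp
    moreover have "w\<^sup>2 \<le> 2 * (2 * r + \<kappa>)\<^sup>2 + 2 * Hsq j \<omega>"
      unfolding w_def by (rule observed_innovation_le[OF sig'])
    moreover have "t \<le> 1 + (2 * (r + \<kappa>)\<^sup>2 + 2 * Hsq j \<omega>) + tilt_const TYPE('k) * g"
      unfolding t_def by (intro add_mono order_refl observed_anom_le)
    ultimately show "1 + W + h \<le> c0 + 4 * Hsq j \<omega> + (norm (\<eta> j \<omega>))\<^sup>2 + tilt_const TYPE('k) * g"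
      unfolding c0_def h_def[symmetric] by linarith
  qed (use C4_ge s in simp)
  finally show ?thesis .
qed

end

section \<open>Measurability and the law of the noise\<close>

lemma norm_square_axis_sum: "(norm x)\<^sup>2 = (\<Sum>i\<in>UNIV. (x \<bullet> axis i 1)\<^sup>2)" for x :: "real^'k"
  by (simp only: power2_norm_eq_inner, simp add: inner_vec_def[of x x] inner_axis power2_eq_square)

context enkf_run
begin

lemma H_measurable [measurable]: "H \<in> borel_measurable borel"
  by (intro borel_measurable_continuous_onI H.continuous_on continuous_on_id)

lemma Vn_measurable [measurable]: "Vn H \<beta> \<in> borel_measurable borel"
proof -
  have "Vn H \<beta> = (\<lambda>u. sqrt (norm u ^ 2 + \<beta> * norm (H u) ^ 2))"
    by (simp add: fun_eq_iff Vn_def norm_projP)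
  then show ?thesis by simp
qed

lemma measurable_M: "X \<in> borel_measurable (F j) \<Longrightarrow> X \<in> borel_measurable M"
  using measurable_from_subalg[OF run_facts(1)] by blast

lemma U_measurable: "n < N \<Longrightarrow> U j n \<in> borel_measurable (F j)"
  using run_facts(2)[of n] run_facts(5)[of j n] by (cases "j = 0") auto

lemma p_measurable:
  assumes "n < N"
  shows "(\<lambda>\<omega>. p j n \<omega>) \<in> borel_measurable M"
proof -
  \<comment> \<open>The identity is Lipschitz on the ball with constant 1, so the projection alone
    is an instance.\<close>
  have "continuous_on UNIV (\<lambda>u. id (proj_BV H \<beta> r u))"
    by (rule continuous_comp_proj_BV[OF A_facts(1), of 1]) auto
  then have "proj_BV H \<beta> r \<in> borel_measurable borel"
    by (simp add: borel_measurable_continuous_onI)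
  then show ?thesis
    unfolding p_def using measurable_M[OF U_measurable[OF assms]] by measurable
qed

lemma \<Psi>s_p_measurable:
  assumes "n < N"
  shows "(\<lambda>\<omega>. \<Psi>s (p j n \<omega>)) \<in> borel_measurable (F j)"
proof -
  have "continuous_on UNIV (\<lambda>u. \<Psi>s (proj_BV H \<beta> r u))"
    by (rule continuous_comp_proj_BV[OF A_facts(1), of Ls]) (use B_facts in \<open>auto simp: less_imp_le\<close>)
  then have "(\<lambda>u. \<Psi>s (proj_BV H \<beta> r u)) \<in> borel_measurable borel"
    by (rule borel_measurable_continuous_onI)
  then show ?thesis
    unfolding p_def using U_measurable[OF assms, of j] by measurable
qed

lemma Adist_measurable [measurable]: "Adist j \<in> borel_measurable M"
proof -
  have "(\<lambda>\<omega>. \<Sum>n<N. Vn H \<beta> (p j n \<omega> - sig j)) \<in> borel_measurable M"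
    using p_measurable by (intro borel_measurable_sum) (simp add: measurable_compose[OF _ Vn_measurable])
  then show ?thesis unfolding Adist_def[abs_def] by simp
qed

lemma Adist_nonneg: "Adist j \<omega> \<ge> 0"
  by (simp add: Adist_def sum_nonneg Vn_nonneg)

lemma err_nonneg: "err j \<omega> \<ge> 0"
  by (simp add: err_def Vn_nonneg)

lemma noise_law:
  assumes "j \<ge> 1" "n < N"
  shows "distr M borel (\<lambda>\<omega>. \<phi> \<bullet> \<xi> j n \<omega>) = normal_law 0 (a * (norm (H \<phi>))\<^sup>2)"
proof -
  have "distr M borel (\<lambda>\<omega>. \<phi> \<bullet> \<xi> j n \<omega>) = normal_law (\<phi> \<bullet> 0) (\<phi> \<bullet> (a *\<^sub>R projP H \<phi>))"
    using run_facts(6)[OF assms] unfolding gaussian_rv_def by blast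
  then show ?thesis by (simp add: projP_def inner_adjoint power2_norm_eq_inner)
qed

lemma H_noise_law:
  assumes "j \<ge> 1" "n < N"
  shows "distr M borel (\<lambda>\<omega>. H (\<xi> j n \<omega>) \<bullet> z) = normal_law 0 (a * (norm z)\<^sup>2)"
  using noise_law[OF assms, of "adjoint H z"] by (simp add: inner_adjoint' H_adjoint)

text \<open>For each \<open>d\<close>, the scalar \<open>Q d \<bullet> \<xi> j n \<omega>\<close>
  has variance a |H (Q d)|^2 = 0. Separability makes a single null set serve a countable dense set
  of \<open>d\<close>, and the directions detecting a nonzero vector form an open set.\<close>

lemma AE_Q_noise:
  assumes "j \<ge> 1" "n < N"
  shows "AE \<omega> in M. Q (\<xi> j n \<omega>) = 0"
proof -
  have [measurable]: "\<xi> j n \<in> borel_measurable M"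
    by (rule measurable_M[OF run_facts(4)[OF assms]])
  obtain D :: "'h set" where D: "countable D" "\<And>X. open X \<Longrightarrow> X \<noteq> {} \<Longrightarrow> \<exists>d\<in>D. d \<in> X"
    using countable_dense_exists by blast
  have "AE \<omega> in M. \<forall>d\<in>D. Q d \<bullet> \<xi> j n \<omega> = 0"
  proof (rule AE_ball_countable'[OF _ D(1)])
    fix d :: 'h
    have "distr M borel (\<lambda>\<omega>. Q d \<bullet> \<xi> j n \<omega>) = return borel 0"
      using noise_law[OF assms, of "Q d"] by (simp only: H_Q norm_zero) (simp add: normal_law_def)
    moreover have "AE x in return borel (0::real). x = 0"
      by (simp add: AE_return)
    ultimately have "AE x in distr M borel (\<lambda>\<omega>. Q d \<bullet> \<xi> j n \<omega>). x = 0" by (simp only:)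
    then show "AE \<omega> in M. Q d \<bullet> \<xi> j n \<omega> = 0"
      by (subst (asm) AE_distr_iff) simp_all
  qed
  then show ?thesis
  proof (rule AE_mp, intro AE_I2 impI)
    fix \<omega> assume *: "\<forall>d\<in>D. Q d \<bullet> \<xi> j n \<omega> = 0"
    show "Q (\<xi> j n \<omega>) = 0"
    proof (rule ccontr)
      define q where "q = Q (\<xi> j n \<omega>)"
      assume "Q (\<xi> j n \<omega>) \<noteq> 0"
      then have "q \<in> {d. d \<bullet> q \<noteq> 0}" by (simp add: q_def)
      moreover have "open {d. d \<bullet> q \<noteq> 0}"
        by (intro open_Collect_neq continuous_intros)
      ultimately obtain d where "d \<in> D" "d \<bullet> q \<noteq> 0" using D(2) by blast
      then show False using * unfolding q_def by (simp only: Q_selfadjoint)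
    qed
  qed
qed

lemma AE_good: "AE \<omega> in M. good \<omega>"
proof -
  have "AE \<omega> in M. \<forall>j\<in>{1..}. \<forall>n\<in>{..<N}. Q (\<xi> j n \<omega>) = 0"
    by (intro AE_ball_countable' AE_Q_noise) auto
  then show ?thesis
    by (rule AE_mp) (intro AE_I2 impI, auto simp: good_def)
qed

section \<open>Expected size of the random forcing\<close>

definition Xi where
  "Xi j \<omega> = ennreal (c0 + 4 * Hsq j \<omega> + (norm (\<eta> j \<omega>))\<^sup>2)
    + ennreal (tilt_const TYPE('k)) * tilt_integral N (\<lambda>n. H (anom j n \<omega>))"

definition K where
  "K = c0 + 4 * (real N * (real CARD('k) * a)) + tr + tilt_const TYPE('k) * tilt_bound TYPE('k) a N"

lemma c0_nonneg: "c0 \<ge> 0"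
  by (simp add: c0_def)

lemma Hsq_nonneg: "Hsq j \<omega> \<ge> 0"
  by (simp add: Hsq_def sum_nonneg)

lemma tilt_bound_nonneg: "tilt_bound TYPE('k) a N \<ge> 0"
  by (simp add: tilt_bound_def)

lemma K_nonneg: "K \<ge> 0"
  using c0_nonneg tr_nonneg a_pos tilt_bound_nonneg tilt_const_pos[where 'k='k] by (simp add: K_def)

lemma err_step:
  assumes "good \<omega>" "j \<ge> 1" "spread (j - 1) \<omega> \<le> C1 * s\<^sup>2" "sig (j - 1) \<in> ballB r"
  shows "ennreal (err j \<omega>) \<le> ennreal \<theta> * ennreal (Adist (j - 1) \<omega>) + ennreal (C4 * s) * Xi j \<omega>"
proof (cases "tilt_integral N (\<lambda>n. H (anom j n \<omega>))")
  case (real g)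
  have t: "tilt_const TYPE('k) * g \<ge> 0" using real tilt_const_pos[where 'k='k] by simp
  have "ennreal (err j \<omega>) \<le> ennreal (\<theta> * Adist (j - 1) \<omega> + C4 * s *
      (c0 + 4 * Hsq j \<omega> + (norm (\<eta> j \<omega>))\<^sup>2 + tilt_const TYPE('k) * g))"
    by (rule ennreal_leI[OF err_step_real[OF assms real(2,1)]])
  also have "\<dots> = ennreal \<theta> * ennreal (Adist (j - 1) \<omega>) + ennreal (C4 * s) * Xi j \<omega>"
    using \<theta> Adist_nonneg[of "j - 1" \<omega>] C4_ge s(1) c0_nonneg Hsq_nonneg[of j \<omega>] t real(1) tilt_const_pos[where 'k='k]
    by (simp add: Xi_def real(2) ennreal_mult ennreal_plus)
  finally show ?thesis .
next
  \<comment> \<open>A divergent tilt integral makes the forcing infinite, and the claim is trivial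
    because its coefficient is positive.\<close>
  case top
  have "Xi j \<omega> = \<infinity>"
    using tilt_const_pos[where 'k='k] by (simp add: Xi_def top ennreal_mult_top)
  then show ?thesis using C4_ge s(1) by (simp add: ennreal_mult_top)
qed

lemma expected_tilt:
  assumes "j \<ge> 1"
  shows "(\<integral>\<^sup>+\<omega>. tilt_integral N (\<lambda>n. H (anom j n \<omega>)) \<partial>M) \<le> ennreal (tilt_bound TYPE('k) a N)"
    and "(\<lambda>\<omega>. tilt_integral N (\<lambda>n. H (anom j n \<omega>))) \<in> borel_measurable M"
proof -
  define x where "x n \<omega> = H (\<xi> j n \<omega>)" for n \<omega>
  \<comment> \<open>In observation space a forecast is a shift known at time j - 1 plus fresh noise,
    as \<open>expected_tilt_integral\<close> asks.\<close>
  define g where "g n \<omega> = H (\<Psi>s (p (j - 1) n \<omega>))" for n \<omega>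
  have eq: "H (anom j n \<omega>) = g n \<omega> + x n \<omega> - ens_mean N (\<lambda>n. g n \<omega> + x n \<omega>)" for n \<omega>
    by (simp add: anom_def H.diff H.ens_mean fc_def H.add g_def x_def)
  have ind: "indep_sets (\<lambda>i. if i < N then events_of M (x i) else sets (F (j - 1))) ({..<N} \<union> {Suc N})"
  proof (rule indep_sets_mono[OF run_facts(7)[OF assms]])
    fix i assume "i \<in> {..<N} \<union> {Suc N}"
    moreover have "events_of M (x i) \<subseteq> events_of M (\<xi> j i)"
      unfolding x_def by (rule events_of_comp_subset) simp
    ultimately show "(if i < N then events_of M (x i) else sets (F (j - 1)))
      \<subseteq> (if i < N then events_of M (\<xi> j i)
             else if i = N then events_of M (\<eta> j) else sets (F (j - 1)))" by auto
  qed auto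
  have xm: "x n \<in> borel_measurable M" if "n < N" for n
    unfolding x_def using measurable_M[OF run_facts(4)[OF assms that]] by measurable
  have gm: "g n \<in> borel_measurable (F (j - 1))" if "n < N" for n
    unfolding g_def using \<Psi>s_p_measurable[OF that, of "j - 1"] by measurable
  have law: "distr M borel (\<lambda>\<omega>. x n \<omega> \<bullet> z) = normal_law 0 (a * (norm z)\<^sup>2)" if "n < N" for n z
    unfolding x_def by (rule H_noise_law[OF assms that])
  show "(\<integral>\<^sup>+\<omega>. tilt_integral N (\<lambda>n. H (anom j n \<omega>)) \<partial>M) \<le> ennreal (tilt_bound TYPE('k) a N)"
    unfolding eq by (rule expected_tilt_integral(1)[OF ind run_facts(1) xm gm law a_pos N])
  show "(\<lambda>\<omega>. tilt_integral N (\<lambda>n. H (anom j n \<omega>))) \<in> borel_measurable M"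
    unfolding eq by (rule expected_tilt_integral(2)[OF ind run_facts(1) xm gm law a_pos N])
qed

lemma expected_H_noise_square:
  assumes "j \<ge> 1" "n < N"
  shows "(\<integral>\<^sup>+\<omega>. ennreal ((norm (H (\<xi> j n \<omega>)))\<^sup>2) \<partial>M) = ennreal (real CARD('k) * a)"
proof -
  have [measurable]: "\<xi> j n \<in> borel_measurable M"
    by (rule measurable_M[OF run_facts(4)[OF assms]])
  have one: "(\<integral>\<^sup>+\<omega>. ennreal ((H (\<xi> j n \<omega>) \<bullet> axis i 1)\<^sup>2) \<partial>M) = ennreal a" for i
  proof -
    have "(\<integral>\<^sup>+\<omega>. ennreal ((H (\<xi> j n \<omega>) \<bullet> axis i 1)\<^sup>2) \<partial>M)
        = (\<integral>\<^sup>+x. ennreal (x\<^sup>2) \<partial>distr M borel (\<lambda>\<omega>. H (\<xi> j n \<omega>) \<bullet> axis i 1))"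
      by (subst nn_integral_distr) simp_all
    also have "\<dots> = ennreal (a * (norm (axis i 1 :: real^'k))\<^sup>2)"
      unfolding H_noise_law[OF assms] by (rule normal_law_second_moment) (use a_pos in simp)
    finally show ?thesis by simp
  qed
  have "(\<integral>\<^sup>+\<omega>. ennreal ((norm (H (\<xi> j n \<omega>)))\<^sup>2) \<partial>M)
      = (\<integral>\<^sup>+\<omega>. (\<Sum>i\<in>UNIV. ennreal ((H (\<xi> j n \<omega>) \<bullet> axis i 1)\<^sup>2)) \<partial>M)"
    by (simp add: norm_square_axis_sum sum_ennreal)
  also have "\<dots> = (\<Sum>i\<in>(UNIV::'k set). \<integral>\<^sup>+\<omega>. ennreal ((H (\<xi> j n \<omega>) \<bullet> axis i 1)\<^sup>2) \<partial>M)"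
    by (rule nn_integral_sum) simp
  also have "\<dots> = ennreal (real CARD('k) * a)"
    using a_pos by (simp add: one ennreal_mult ennreal_of_nat_eq_real_of_nat)
  finally show ?thesis .
qed

lemma expected_obs_noise_square:
  assumes "j \<ge> 1"
  shows "(\<integral>\<^sup>+\<omega>. ennreal ((norm (\<eta> j \<omega>))\<^sup>2) \<partial>M) = ennreal tr"
proof -
  have [measurable]: "\<eta> j \<in> borel_measurable M"
    by (rule measurable_M[OF run_facts(3)[OF assms]])
  have R0: "R $ i $ i \<ge> 0" for i
    using run_facts(9)[OF assms, of i i, symmetric] by simp
  have one: "(\<integral>\<^sup>+\<omega>. ennreal ((\<eta> j \<omega> $ i)\<^sup>2) \<partial>M) = ennreal (R $ i $ i)" for i
    using run_facts(8)[OF assms, of i] run_facts(9)[OF assms, of i i]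
    by (subst nn_integral_eq_integral) (simp_all add: power2_eq_square)
  have "(\<integral>\<^sup>+\<omega>. ennreal ((norm (\<eta> j \<omega>))\<^sup>2) \<partial>M) = (\<integral>\<^sup>+\<omega>. (\<Sum>i\<in>UNIV. ennreal ((\<eta> j \<omega> $ i)\<^sup>2)) \<partial>M)"
    by (simp add: norm_square_axis_sum inner_axis sum_ennreal)
  also have "\<dots> = (\<Sum>i\<in>(UNIV::'k set). \<integral>\<^sup>+\<omega>. ennreal ((\<eta> j \<omega> $ i)\<^sup>2) \<partial>M)"
    by (rule nn_integral_sum) (simp add: cart_eq_inner_axis)
  also have "\<dots> = ennreal tr" using R0 by (simp add: one tr_def sum_ennreal)
  finally show ?thesis .
qed

lemma Hsq_measurable [measurable]: "j \<ge> 1 \<Longrightarrow> Hsq j \<in> borel_measurable M"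
  unfolding Hsq_def[abs_def]
proof (rule borel_measurable_sum)
  fix n assume "j \<ge> 1" "n \<in> {..<N}"
  then have [measurable]: "\<xi> j n \<in> borel_measurable M"
    using measurable_M[OF run_facts(4)] by simp
  show "(\<lambda>\<omega>. (norm (H (\<xi> j n \<omega>)))\<^sup>2) \<in> borel_measurable M" by measurable
qed

lemma Xi_measurable:
  assumes "j \<ge> 1"
  shows "Xi j \<in> borel_measurable M"
proof -
  have [measurable]: "\<eta> j \<in> borel_measurable M"
    by (rule measurable_M[OF run_facts(3)[OF assms]])
  note [measurable] = Hsq_measurable[OF assms] expected_tilt(2)[OF assms]
  show ?thesis unfolding Xi_def[abs_def] by measurable
qed

lemma expected_Xi:
  assumes "j \<ge> 1"
  shows "(\<integral>\<^sup>+\<omega>. Xi j \<omega> \<partial>M) \<le> ennreal K"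
proof -
  have [measurable]: "\<eta> j \<in> borel_measurable M"
    by (rule measurable_M[OF run_facts(3)[OF assms]])
  note [measurable] = Hsq_measurable[OF assms] expected_tilt(2)[OF assms]
  have hs: "(\<integral>\<^sup>+\<omega>. ennreal (Hsq j \<omega>) \<partial>M) = ennreal (real N * (real CARD('k) * a))"
  proof -
    have "(\<integral>\<^sup>+\<omega>. ennreal (Hsq j \<omega>) \<partial>M) = (\<integral>\<^sup>+\<omega>. (\<Sum>n<N. ennreal ((norm (H (\<xi> j n \<omega>)))\<^sup>2)) \<partial>M)"
      by (simp add: Hsq_def sum_ennreal)
    also have "\<dots> = (\<Sum>n<N. \<integral>\<^sup>+\<omega>. ennreal ((norm (H (\<xi> j n \<omega>)))\<^sup>2) \<partial>M)"
    proof (rule nn_integral_sum)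
      fix n assume "n \<in> {..<N}"
      then have [measurable]: "\<xi> j n \<in> borel_measurable M"
        using measurable_M[OF run_facts(4)[OF assms]] by simp
      show "(\<lambda>\<omega>. ennreal ((norm (H (\<xi> j n \<omega>)))\<^sup>2)) \<in> borel_measurable M" by measurable
    qed
    also have "\<dots> = ennreal (real N * (real CARD('k) * a))"
      using a_pos by (simp add: expected_H_noise_square[OF assms] ennreal_mult ennreal_of_nat_eq_real_of_nat)
    finally show ?thesis .
  qed
  have "(\<integral>\<^sup>+\<omega>. Xi j \<omega> \<partial>M) = (\<integral>\<^sup>+\<omega>. ennreal c0 + ennreal 4 * ennreal (Hsq j \<omega>)
      + ennreal ((norm (\<eta> j \<omega>))\<^sup>2)
      + ennreal (tilt_const TYPE('k)) * tilt_integral N (\<lambda>n. H (anom j n \<omega>)) \<partial>M)"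
    by (intro nn_integral_cong)
       (simp add: Xi_def c0_nonneg Hsq_nonneg ennreal_plus ennreal_mult'')
  also have "\<dots> = ennreal c0 + ennreal 4 * (\<integral>\<^sup>+\<omega>. ennreal (Hsq j \<omega>) \<partial>M)
      + (\<integral>\<^sup>+\<omega>. ennreal ((norm (\<eta> j \<omega>))\<^sup>2) \<partial>M)
      + ennreal (tilt_const TYPE('k)) * (\<integral>\<^sup>+\<omega>. tilt_integral N (\<lambda>n. H (anom j n \<omega>)) \<partial>M)"
    by (simp add: nn_integral_add nn_integral_cmult emeasure_space_1 del: ennreal_numeral)
  also have "\<dots> \<le> ennreal c0 + ennreal 4 * ennreal (real N * (real CARD('k) * a)) + ennreal tr
      + ennreal (tilt_const TYPE('k)) * ennreal (tilt_bound TYPE('k) a N)"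
    unfolding hs expected_obs_noise_square[OF assms]
    by (intro add_left_mono mult_left_mono expected_tilt(1)[OF assms]) simp
  also have "\<dots> = ennreal K"
    using c0_nonneg a_pos tr_nonneg tilt_bound_nonneg tilt_const_pos[where 'k='k]
    by (simp add: K_def ennreal_plus ennreal_mult less_imp_le del: ennreal_numeral)
  finally show ?thesis .
qed

section \<open>The recursion in expectation and its limit\<close>

definition D where "D = C4 * K + C3"

lemma D_nonneg: "D \<ge> 0"
  using C4_ge K_nonneg C3 by (simp add: D_def)

lemma expected_err_step:
  assumes "j \<ge> 1" "sig (j - 1) \<in> ballB r"
    and sp: "\<And>\<omega>. good \<omega> \<Longrightarrow> spread (j - 1) \<omega> \<le> C1 * s\<^sup>2"
  shows "(\<integral>\<^sup>+\<omega>. ennreal (err j \<omega>) \<partial>M)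
      \<le> ennreal \<theta> * (\<integral>\<^sup>+\<omega>. ennreal (Adist (j - 1) \<omega>) \<partial>M) + ennreal (C4 * K * s)"
proof -
  note [measurable] = Xi_measurable[OF assms(1)]
  have "(\<integral>\<^sup>+\<omega>. ennreal (err j \<omega>) \<partial>M)
      \<le> (\<integral>\<^sup>+\<omega>. ennreal \<theta> * ennreal (Adist (j - 1) \<omega>) + ennreal (C4 * s) * Xi j \<omega> \<partial>M)"
    by (rule nn_integral_mono_AE, rule AE_mp[OF AE_good]) (intro AE_I2 impI err_step assms)
  also have "\<dots> = ennreal \<theta> * (\<integral>\<^sup>+\<omega>. ennreal (Adist (j - 1) \<omega>) \<partial>M) + ennreal (C4 * s) * (\<integral>\<^sup>+\<omega>. Xi j \<omega> \<partial>M)"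
    by (simp add: nn_integral_add nn_integral_cmult)
  also have "\<dots> \<le> ennreal \<theta> * (\<integral>\<^sup>+\<omega>. ennreal (Adist (j - 1) \<omega>) \<partial>M) + ennreal (C4 * s) * ennreal K"
    by (intro add_left_mono mult_left_mono expected_Xi[OF assms(1)]) simp
  also have "ennreal (C4 * s) * ennreal K = ennreal (C4 * K * s)"
    using C4_ge s(1) K_nonneg by (simp add: ennreal_mult[symmetric] mult_ac)
  finally show ?thesis .
qed

text \<open>The factor \<theta> is deterministic and the forcing additive, so linearity of the
  expectation carries the recursion over, whatever the dependence between the two terms.\<close>

lemma expected_Adist_step:
  assumes "j \<ge> 1" "sig (j - 1) \<in> ballB r"
    and sp: "\<And>\<omega>. good \<omega> \<Longrightarrow> spread (j - 1) \<omega> \<le> C1 * s\<^sup>2"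
  shows "(\<integral>\<^sup>+\<omega>. ennreal (Adist j \<omega>) \<partial>M)
      \<le> ennreal \<theta> * (\<integral>\<^sup>+\<omega>. ennreal (Adist (j - 1) \<omega>) \<partial>M) + ennreal (D * s)"
proof -
  note [measurable] = Xi_measurable[OF assms(1)]
  have sig': "sig j \<in> ballB r"
    using \<Psi>_ball[OF assms(2)] sig_Suc[of "j - 1"] assms(1) by simp
  have pt: "ennreal (Adist j \<omega>) \<le> (ennreal \<theta> * ennreal (Adist (j - 1) \<omega>) + ennreal (C4 * s) * Xi j \<omega>) + ennreal (C3 * s)"
    if "good \<omega>" for \<omega>
  proof -
    have "ennreal (Adist j \<omega>) \<le> ennreal (err j \<omega> + C3 * s)"
      by (intro ennreal_leI Adist_le_err[OF that assms(1) sp[OF that] sig'])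
    also have "\<dots> = ennreal (err j \<omega>) + ennreal (C3 * s)"
      using err_nonneg C3 s by (simp add: ennreal_plus)
    finally show ?thesis
      using err_step[OF that assms(1) sp[OF that] assms(2)] by (meson add_right_mono order_trans)
  qed
  have "(\<integral>\<^sup>+\<omega>. ennreal (Adist j \<omega>) \<partial>M)
      \<le> (\<integral>\<^sup>+\<omega>. (ennreal \<theta> * ennreal (Adist (j - 1) \<omega>) + ennreal (C4 * s) * Xi j \<omega>) + ennreal (C3 * s) \<partial>M)"
    by (rule nn_integral_mono_AE, rule AE_mp[OF AE_good]) (intro AE_I2 impI pt)
  also have "\<dots> = ennreal \<theta> * (\<integral>\<^sup>+\<omega>. ennreal (Adist (j - 1) \<omega>) \<partial>M) + ennreal (C4 * s) * (\<integral>\<^sup>+\<omega>. Xi j \<omega> \<partial>M) + ennreal (C3 * s)"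
    by (simp add: nn_integral_add nn_integral_cmult emeasure_space_1)
  also have "\<dots> \<le> ennreal \<theta> * (\<integral>\<^sup>+\<omega>. ennreal (Adist (j - 1) \<omega>) \<partial>M) + ennreal (C4 * s) * ennreal K + ennreal (C3 * s)"
    by (intro add_right_mono add_left_mono mult_left_mono expected_Xi[OF assms(1)]) simp
  also have "\<dots> = ennreal \<theta> * (\<integral>\<^sup>+\<omega>. ennreal (Adist (j - 1) \<omega>) \<partial>M) + (ennreal (C4 * s) * ennreal K + ennreal (C3 * s))"
    by (simp add: add.assoc)
  also have "ennreal (C4 * s) * ennreal K + ennreal (C3 * s) = ennreal (D * s)"
    using C4_ge s(1) K_nonneg C3
    by (simp add: D_def ennreal_mult[symmetric] ennreal_plus[symmetric] algebra_simps del: ennreal_plus)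
  finally show ?thesis .
qed

text \<open>The 1 absorbs the transient, \<open>D / (1 - \<theta>)\<close> is the fixed point of the
  recursion for \<open>Adist\<close>, and \<open>C4 * K\<close> is the forcing of the last
  step.\<close>

definition Cs where "Cs = 1 + D / (1 - \<theta>) + C4 * K"

theorem limsup_error:
  "limsup (\<lambda>j. \<integral>\<^sup>+ \<omega>. ennreal (norm (ens_mean N (\<lambda>n. U j n \<omega>) - (\<Psi> ^^ j) u0)) \<partial>M)
    \<le> ennreal (Cs * (\<epsilon> + \<delta>))"
proof -
  obtain J1 where J1: "\<And>j. j \<ge> J1 \<Longrightarrow> sig j \<in> ballB r" using sig_eventually_ball by blast
  obtain J2 where J2: "\<And>j \<omega>. j \<ge> J2 \<Longrightarrow> good \<omega> \<Longrightarrow> spread j \<omega> \<le> C1 * s\<^sup>2"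
    using spread_eventually by blast
  define J where "J = max J1 J2"
  \<comment> \<open>From time \<open>J\<close> on the signal is in the ball, as the projected
    members always are. The recursion therefore starts from a finite value, whatever happened
    before.\<close>
  have Ad0: "(\<integral>\<^sup>+\<omega>. ennreal (Adist J \<omega>) \<partial>M) \<le> ennreal diam"
  proof -
    have "Adist J \<omega> \<le> diam" for \<omega>
    proof -
      have "Adist J \<omega> \<le> (1 / real N) * (\<Sum>n<N. diam)"
        unfolding Adist_def
        by (intro mult_left_mono sum_mono Vn_ball_le_diam p_ball J1) (simp_all add: J_def)
      then show ?thesis using N_pos by simp
    qed
    then have "(\<integral>\<^sup>+\<omega>. ennreal (Adist J \<omega>) \<partial>M) \<le> (\<integral>\<^sup>+\<omega>. ennreal diam \<partial>M)"
      by (intro nn_integral_mono ennreal_leI)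
    then show ?thesis by (simp add: emeasure_space_1)
  qed
  have diam: "diam \<ge> 0" using A_facts(1) \<beta>_nonneg by (simp add: diam_def)
  have Ds: "D * s / (1 - \<theta>) \<ge> 0" using D_nonneg s(1) \<theta> by simp
  have geo: "(\<integral>\<^sup>+\<omega>. ennreal (Adist (J + i) \<omega>) \<partial>M) \<le> ennreal (\<theta> ^ i * diam + D * s / (1 - \<theta>))" for i
  proof (induction i)
    case 0
    show ?case using order_trans[OF Ad0 ennreal_leI[of diam "diam + D * s / (1 - \<theta>)"]] Ds by simp
  next
    case (Suc i)
    have "(\<integral>\<^sup>+\<omega>. ennreal (Adist (J + Suc i) \<omega>) \<partial>M)
        \<le> ennreal \<theta> * (\<integral>\<^sup>+\<omega>. ennreal (Adist (J + i) \<omega>) \<partial>M) + ennreal (D * s)"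
      using expected_Adist_step[of "J + Suc i"] J1 J2 by (simp add: J_def)
    also have "\<dots> \<le> ennreal \<theta> * ennreal (\<theta> ^ i * diam + D * s / (1 - \<theta>)) + ennreal (D * s)"
      by (intro add_right_mono mult_left_mono Suc.IH) simp
    also have "\<dots> = ennreal (\<theta> * (\<theta> ^ i * diam + D * s / (1 - \<theta>)) + D * s)"
      using \<theta> diam D_nonneg s(1) by (simp add: ennreal_mult ennreal_plus)
    also have "\<theta> * (\<theta> ^ i * diam + D * s / (1 - \<theta>)) + D * s = \<theta> ^ Suc i * diam + D * s / (1 - \<theta>)"
      using \<theta> by (simp add: field_simps)
    finally show ?case .
  qed
  have "(\<lambda>i. \<theta> ^ i * diam) \<longlonglongrightarrow> 0 * diam"
    by (intro tendsto_mult LIMSEQ_power_zero tendsto_const) (use \<theta> in simp)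
  then have "eventually (\<lambda>i. \<theta> ^ i * diam < s) sequentially"
    using s(1) by (intro order_tendstoD) auto
  then obtain I where I: "\<And>i. i \<ge> I \<Longrightarrow> \<theta> ^ i * diam < s"
    by (auto simp: eventually_sequentially)
  have bound: "(\<integral>\<^sup>+ \<omega>. ennreal (norm (ens_mean N (\<lambda>n. U j n \<omega>) - (\<Psi> ^^ j) u0)) \<partial>M) \<le> ennreal (Cs * s)"
    if "j \<ge> Suc (J + I)" for j
  proof -
    \<comment> \<open>The error at time j is controlled by \<open>Adist\<close> at time j - 1 = J +
      i, hence the shift by one.\<close>
    define i where "i = j - Suc J"
    have j: "j = Suc (J + i)" "i \<ge> I" using that by (simp_all add: i_def)
    have "(\<integral>\<^sup>+ \<omega>. ennreal (norm (ens_mean N (\<lambda>n. U j n \<omega>) - (\<Psi> ^^ j) u0)) \<partial>M)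
        \<le> (\<integral>\<^sup>+ \<omega>. ennreal (err j \<omega>) \<partial>M)"
      unfolding err_def sig_def by (intro nn_integral_mono ennreal_leI norm_le_Vn)
    also have "\<dots> \<le> ennreal \<theta> * (\<integral>\<^sup>+\<omega>. ennreal (Adist (J + i) \<omega>) \<partial>M) + ennreal (C4 * K * s)"
      using expected_err_step[of j] J1 J2 by (simp add: J_def j)
    also have "\<dots> \<le> ennreal 1 * ennreal (s + D * s / (1 - \<theta>)) + ennreal (C4 * K * s)"
      using I[OF j(2)] \<theta>
      by (intro add_right_mono mult_mono order_trans[OF geo] ennreal_leI) simp_all
    also have "\<dots> = ennreal (1 * (s + D * s / (1 - \<theta>)) + C4 * K * s)"
      using Ds s(1) C4_ge K_nonneg by (simp add: ennreal_plus)
    also have "1 * (s + D * s / (1 - \<theta>)) + C4 * K * s = Cs * s"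
      by (simp add: Cs_def algebra_simps)
    finally show ?thesis .
  qed
  have "limsup (\<lambda>j. \<integral>\<^sup>+ \<omega>. ennreal (norm (ens_mean N (\<lambda>n. U j n \<omega>) - (\<Psi> ^^ j) u0)) \<partial>M)
      \<le> ennreal (Cs * s)"
    by (rule Limsup_bounded) (use bound in \<open>auto simp: eventually_sequentially\<close>)
  then show ?thesis by (simp add: s_def)
qed

end

theorem theorem2p8:
  fixes \<Psi> :: "'h::{real_inner,complete_space,second_countable_topology} \<Rightarrow> 'h"
    and H :: "'h \<Rightarrow> real^'k"
    and R :: "real^'k^'k"
    and u0 m0 :: 'h and C0 :: "'h \<Rightarrow> 'h"
    and r \<beta> L \<alpha> \<kappa> Ls :: real and N :: nat
  assumes "bounded_linear H"
    and "\<forall>y. H (adjoint H y) = y"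
    and "\<forall>x. x \<noteq> 0 \<longrightarrow> x \<bullet> (R *v x) > 0"
    and "assumption_A \<Psi> H r \<beta> L \<alpha>"
    and "\<kappa> > 0" and "Ls > 0"
    and "N \<ge> 6 * CARD('k)"
  shows "\<exists>a0>0. \<forall>a\<ge>a0. \<exists>C. \<forall>\<epsilon>>0. \<forall>\<delta>. \<forall>\<Psi>s.
           assumption_B \<Psi> \<Psi>s H r \<beta> \<kappa> Ls \<delta> \<longrightarrow>
           (\<forall>(M::'w measure) F \<eta> \<xi> U.
              enkf_s_run M F \<Psi> \<Psi>s H R \<epsilon> a r \<beta> N m0 C0 u0 \<eta> \<xi> U \<longrightarrow>
              limsup (\<lambda>j. \<integral>\<^sup>+ \<omega>. ennreal (norm (ens_mean N (\<lambda>n. U j n \<omega>) - (\<Psi> ^^ j) u0)) \<partial>M)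
                \<le> ennreal (C * (\<epsilon> + \<delta>)))"
proof -
  obtain r0 where r0: "r0 > 0" "\<And>x. r0 * (norm x)\<^sup>2 \<le> x \<bullet> (R *v x)"
    using pos_def_lower_bound[of R] assms(3) by blast
  obtain \<rho> where \<rho>: "\<rho> \<ge> 0" "\<And>x. norm (R *v x) \<le> \<rho> * norm x"
    using bounded_linear.nonneg_bounded[OF matrix_vector_mul_bounded_linear[of R]]
    by (auto simp: mult.commute)
  \<comment> \<open>The arguments of \<open>enkf_run.Cs\<close> list all that the constant depends
    on. Neither \<epsilon>, \<delta>, the surrogate nor the run is among them, so it can be chosen
    before they are.\<close>
  have main: "limsup (\<lambda>j. \<integral>\<^sup>+ \<omega>. ennreal (norm (ens_mean N (\<lambda>n. U j n \<omega>) - (\<Psi> ^^ j) u0)) \<partial>M)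
      \<le> ennreal (enkf_run.Cs \<beta> R a r \<alpha> \<kappa> N r0 \<rho> * (\<epsilon> + \<delta>))"
    if "a \<ge> 1" "\<epsilon> > 0" "assumption_B \<Psi> \<Psi>s H r \<beta> \<kappa> Ls \<delta>"
      and run: "enkf_s_run M F \<Psi> \<Psi>s H R \<epsilon> a r \<beta> N m0 C0 u0 \<eta> \<xi> U"
    for a \<epsilon> \<delta> \<Psi>s and M :: "'w measure" and F \<eta> \<xi> U
  proof -
    have "enkf_run M H \<beta> F \<Psi> \<Psi>s R \<epsilon> a r L \<alpha> \<kappa> Ls \<delta> N m0 u0 C0 \<eta> \<xi> U r0 \<rho>"
      unfolding enkf_run_def enkf_run_axioms_def coisometry_V_def coisometry_V_axioms_def
        coisometry_def
      using run that assms r0 \<rho> by (auto simp: enkf_s_run_def assumption_A_def)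
    then show ?thesis by (rule enkf_run.limsup_error)
  qed
  show ?thesis
  \<comment> \<open>The bounds hold for every positive inflation, with a constant depending on it; 1
    is merely a convenient threshold.\<close>
  proof (rule exI[of _ "1::real"], rule conjI, simp, intro allI impI)
    fix a :: real assume "a \<ge> 1"
    then show "\<exists>C. \<forall>\<epsilon>>0. \<forall>\<delta>. \<forall>\<Psi>s.
           assumption_B \<Psi> \<Psi>s H r \<beta> \<kappa> Ls \<delta> \<longrightarrow>
           (\<forall>(M::'w measure) F \<eta> \<xi> U.
              enkf_s_run M F \<Psi> \<Psi>s H R \<epsilon> a r \<beta> N m0 C0 u0 \<eta> \<xi> U \<longrightarrow>
              limsup (\<lambda>j. \<integral>\<^sup>+ \<omega>. ennreal (norm (ens_mean N (\<lambda>n. U j n \<omega>) - (\<Psi> ^^ j) u0)) \<partial>M)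
                \<le> ennreal (C * (\<epsilon> + \<delta>)))"
      using main by blast
  qed
qed

end
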